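(* Let $\ell>0$, $\sigma\in[0,1)$, $\Omega=(0,\pi)\times(-\ell,\ell)$, let $f\in L^2(\Omega)$, and let $u\in H^2_*(\Omega)$ be a (weak) solution of $$\begin{cases}\Delta^2u=f & \text{in }\Omega,\\ u(0,y)=u_{xx}(0,y)=u(\pi,y)=u_{xx}(\pi,y)=0 & \text{for } y\in(-\ell,\ell),\\ u_{yy}(x,\pm\ell)+\sigma u_{xx}(x,\pm\ell)=u_{yyy}(x,\pm\ell)+(2-\sigma)u_{xxy}(x,\pm\ell)=0 & \text{for } x\in(0,\pi).\end{cases}$$ If $f\geq0$ and $f\not\equiv0$ in $\Omega$, then $u>0$ in $(0,\pi)\times[-\ell,\ell]$, and $u_x(0,y)>0$ and $u_x(\pi,y)<0$ for all $y\in[-\ell,\ell]$, where these derivatives of $u$ are meant in the classical sense.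
   Context: $H^2_*(\Omega)=\{u\in H^2(\Omega): u=0 \text{ on } \{0,\pi\}\times(-\ell,\ell)\}$ (it embeds into continuous functions on $\overline\Omega$), a Hilbert space with the scalar product $$(u,v)_{H^2_*(\Omega)}=\int_\Omega\left[\Delta u\,\Delta v+(1-\sigma)(2u_{xy}v_{xy}-u_{xx}v_{yy}-u_{yy}v_{xx})\right]dx\,dy.$$ A weak solution of the boundary value problem is $u\in H^2_*(\Omega)$ with $(u,\varphi)_{H^2_*(\Omega)}=\int_\Omega f\varphi\,dx\,dy$ for all $\varphi\in H^2_*(\Omega)$. *)

theory Defs
  imports "HOL-Analysis.Analysis"
begin

definition plate :: "real \<Rightarrow> (real \<times> real) set" where
  "plate l = {0<..<pi} \<times> {-l<..<l}"

text \<open>Elements of \<open>L2 S\<close> and \<open>H2 S\<close> are represented by functions on the plane; only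
  their values on \<open>S\<close> (up to null sets) matter.\<close>

definition L2 :: "(real \<times> real) set \<Rightarrow> (real \<times> real \<Rightarrow> real) set" where
  "L2 S = {f. f \<in> borel_measurable (lebesgue_on S) \<and>
              integrable (lebesgue_on S) (\<lambda>z. (f z)\<^sup>2)}"

primrec C_k :: "nat \<Rightarrow> ('a::real_normed_vector \<Rightarrow> real) \<Rightarrow> bool" where
  "C_k 0 f \<longleftrightarrow> continuous_on UNIV f"
| "C_k (Suc k) f \<longleftrightarrow> (\<forall>z. f differentiable (at z)) \<and>
                    (\<forall>v. C_k k (\<lambda>z. frechet_derivative f (at z) v))"

definition test_functions :: "(real \<times> real) set \<Rightarrow> (real \<times> real \<Rightarrow> real) set" where
  "test_functions S = {\<phi>. (\<forall>k. C_k k \<phi>) \<and>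
      compact (closure {z. \<phi> z \<noteq> 0}) \<and> closure {z. \<phi> z \<noteq> 0} \<subseteq> S}"

definition partial_x :: "(real \<times> real \<Rightarrow> real) \<Rightarrow> real \<times> real \<Rightarrow> real" where
  "partial_x \<phi> = (\<lambda>(x, y). deriv (\<lambda>s. \<phi> (s, y)) x)"

definition partial_y :: "(real \<times> real \<Rightarrow> real) \<Rightarrow> real \<times> real \<Rightarrow> real" where
  "partial_y \<phi> = (\<lambda>(x, y). deriv (\<lambda>t. \<phi> (x, t)) y)"

text \<open>\<open>g\<close> is the weak derivative of order \<open>i\<close> in \<open>x\<close> and \<open>j\<close> in \<open>y\<close> of \<open>u\<close>. Used only for
  \<open>u\<close>, \<open>g\<close> in \<open>L2 S\<close>, so that both integrands are integrable.\<close>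

definition has_weak_derivative ::
  "(real \<times> real) set \<Rightarrow> nat \<Rightarrow> nat \<Rightarrow> (real \<times> real \<Rightarrow> real) \<Rightarrow> (real \<times> real \<Rightarrow> real) \<Rightarrow> bool" where
  "has_weak_derivative S i j u g \<longleftrightarrow>
     (\<forall>\<phi>\<in>test_functions S.
        (\<integral>z. u z * (partial_x ^^ i) ((partial_y ^^ j) \<phi>) z \<partial>(lebesgue_on S)) =
        (-1) ^ (i + j) * (\<integral>z. g z * \<phi> z \<partial>(lebesgue_on S)))"

definition H2 :: "(real \<times> real) set \<Rightarrow> (real \<times> real \<Rightarrow> real) set" where
  "H2 S = {u \<in> L2 S. \<forall>i j. i + j \<le> 2 \<longrightarrow> (\<exists>g\<in>L2 S. has_weak_derivative S i j u g)}"

text \<open>A representative of the weak derivative, which is unique almost everywhere in \<open>S\<close>.\<close>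

definition weak_derivative ::
  "(real \<times> real) set \<Rightarrow> nat \<Rightarrow> nat \<Rightarrow> (real \<times> real \<Rightarrow> real) \<Rightarrow> real \<times> real \<Rightarrow> real" where
  "weak_derivative S i j u = (SOME g. g \<in> L2 S \<and> has_weak_derivative S i j u g)"

text \<open>Since \<open>H2 (plate l)\<close> embeds into the continuous functions on the closed rectangle, every
  element of the space is identified with its representative that is continuous there;
  the boundary condition and all pointwise statements refer to this representative.\<close>

definition H2_star :: "real \<Rightarrow> (real \<times> real \<Rightarrow> real) set" where
  "H2_star l = {u \<in> H2 (plate l). continuous_on (closure (plate l)) u \<and>
                  (\<forall>z \<in> {0, pi} \<times> {-l<..<l}. u z = 0)}"

definition H2_star_inner ::
  "real \<Rightarrow> real \<Rightarrow> (real \<times> real \<Rightarrow> real) \<Rightarrow> (real \<times> real \<Rightarrow> real) \<Rightarrow> real" where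
  "H2_star_inner l \<sigma> u v =
     (let D = weak_derivative (plate l) in
      \<integral>z. (D 2 0 u z + D 0 2 u z) * (D 2 0 v z + D 0 2 v z)
         + (1 - \<sigma>) * (2 * D 1 1 u z * D 1 1 v z - D 2 0 u z * D 0 2 v z - D 0 2 u z * D 2 0 v z)
        \<partial>(lebesgue_on (plate l)))"

text \<open>Weak solutions of \<open>\<Delta>\<^sup>2 u = f\<close> in the plate with \<open>u = u\<^sub>x\<^sub>x = 0\<close> on the two vertical edges and
  \<open>u\<^sub>y\<^sub>y + \<sigma> u\<^sub>x\<^sub>x = u\<^sub>y\<^sub>y\<^sub>y + (2 - \<sigma>) u\<^sub>x\<^sub>x\<^sub>y = 0\<close> on the two horizontal ones. The conditions
  other than \<open>u = 0\<close> are natural, i.e. encoded in the variational equation.\<close>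

definition weak_solution ::
  "real \<Rightarrow> real \<Rightarrow> (real \<times> real \<Rightarrow> real) \<Rightarrow> (real \<times> real \<Rightarrow> real) \<Rightarrow> bool" where
  "weak_solution l \<sigma> f u \<longleftrightarrow> u \<in> H2_star l \<and>
     (\<forall>\<phi>\<in>H2_star l. H2_star_inner l \<sigma> u \<phi> = (\<integral>z. f z * \<phi> z \<partial>(lebesgue_on (plate l))))"

end

theory Submission
  imports Defs
begin

text \<open>Let \<open>U\<^sub>m(y) = \<integral> u sin(m x) dx\<close> and \<open>F\<^sub>m(y) = \<integral> f sin(m x) dx\<close>. Testing with \<open>sin(m x) \<psi>(y)\<close> shows
  \<open>U\<^sub>m(y) = \<integral> g\<^sub>m(y, w) F\<^sub>m(w) dw\<close>, where \<open>g\<^sub>m\<close> is the Green function on \<open>(-l, l)\<close> of the form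
  \<open>a\<^sub>m(U, W) = \<integral> U'' W'' - \<sigma> m\<^sup>2 (U'' W + U W'') + m\<^sup>4 U W + 2 (1 - \<sigma>) m\<^sup>2 U' W'\<close>.
  An explicit formula and the minimum principle give \<open>|\<partial>\<^sup>2g\<^sub>m| < m\<^sup>2 g\<^sub>m\<close> pointwise. Evaluating \<open>a\<^sub>m\<close> and \<open>a\<^sub>n\<close>
  on the pair \<open>Y = g\<^sub>m(y, \<cdot>)\<close>, \<open>W = g\<^sub>n(w, \<cdot>)\<close> yields
  \<open>n\<^sup>2 g\<^sub>n(y, w) - m\<^sup>2 g\<^sub>m(y, w) = (n\<^sup>2 - m\<^sup>2) \<integral> (Y'' W'' - m\<^sup>2 n\<^sup>2 Y W)\<close>, which is negative for \<open>m < n\<close>, so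
  \<open>c\<^sub>m = m\<^sup>2 g\<^sub>m\<close> is positive and strictly decreasing in \<open>m\<close>. By the Fejer-Jackson inequality the
  sums \<open>\<Sum>\<^sub>k\<^sub>\<le>\<^sub>n sin(k x) sin(k \<rho>) / k\<^sup>2\<close> are nonnegative, and Abel summation bounds the Green function
  \<open>(2/\<pi>) \<Sum> g\<^sub>m(y, w) sin(m x) sin(m \<rho>)\<close> of the plate from below by \<open>(2/\<pi>) (c\<^sub>1 - c\<^sub>2) sin x sin \<rho>\<close>.
  Hence \<open>u(x, y) \<ge> K sin x\<close> with \<open>K > 0\<close>, which gives positivity and the signs of \<open>u\<^sub>x\<close>
  on the two vertical edges.\<close>

section \<open>Primitives\<close>

text \<open>A fourth order operator obeys no general maximum principle, so positivity is read off
  from the Green function, reduced to second order facts: at frequency 1 both \<open>g - g''\<close>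
  and \<open>g + g''\<close> are positive. For \<open>g + g''\<close> the differential inequality
  leaves the value at the pole open; it is computed from the explicit formula. The factor m^2 is
  dictated by the sines: partial sums of sin(k x) sin(k \<rho>) change sign, those weighted by 1/k^2
  do not, so m^2 g_m rather than g_m has to decrease. With f only square integrable and u only in
  H^2, no regularity theory is used. Tests by tensor products turn u into absolutely continuous
  modes, expressed by \<open>prim\<close>; a vanishing primitive,
  \<open>prim a b (\<lambda>_. 0) R\<close>, stands for R = 0 almost everywhere. Since g_m itself is
  the test function, it carries the natural boundary conditions, and none has to be derived for the
  modes. The bound g_m = O(m^-3) makes the differentiated sine series converge, hence u_x is
  classical up to the edges.\<close>

definition prim :: "real \<Rightarrow> real \<Rightarrow> (real \<Rightarrow> real) \<Rightarrow> (real \<Rightarrow> real) \<Rightarrow> bool" where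
  "prim a b U V \<longleftrightarrow> set_integrable lborel {a..b} V \<and>
     (\<forall>y\<in>{a..b}. U y = U a + (LINT t:{a..y}|lborel. V t))"

lemma prim_integrable: "prim a b U V \<Longrightarrow> set_integrable lborel {a..b} V"
  by (simp add: prim_def)

lemma prim_integral: "prim a b U V \<Longrightarrow> y \<in> {a..b} \<Longrightarrow> (LINT t:{a..y}|lborel. V t) = U y - U a"
proof -
  assume a: "prim a b U V" "y \<in> {a..b}"
  have "U y = U a + (LINT t:{a..y}|lborel. V t)" using a unfolding prim_def by blast
  then show ?thesis by linarith
qed

lemma primI:
  assumes "set_integrable lborel {a..b} V" "\<And>y. y \<in> {a..b} \<Longrightarrow> (LINT t:{a..y}|lborel. V t) = U y - U a"
  shows "prim a b U V"
  unfolding prim_def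
proof (intro conjI ballI)
  fix y assume "y \<in> {a..b}"
  from assms(2)[OF this] show "U y = U a + (LINT t:{a..y}|lborel. V t)" by linarith
qed fact

lemma prim_continuous:
  assumes "prim a b U V"
  shows "continuous_on {a..b} U"
proof -
  have V: "set_integrable lborel {a..b} V"
    using assms by (rule prim_integrable)
  have "U y = U a + integral {a..y} V" if "y \<in> {a..b}" for y
  proof -
    have "set_integrable lborel {a..y} V"
      by (rule set_integrable_subset[OF V]) (use that in auto)
    then show ?thesis
      using prim_integral[OF assms that] set_borel_integral_eq_integral(2) by fastforce
  qed
  moreover have "continuous_on {a..b} (\<lambda>y. U a + integral {a..y} V)"
    by (intro continuous_intros indefinite_integral_continuous_1 set_borel_integral_eq_integral(1)[OF V])
  ultimately show ?thesis
    by (metis (mono_tags, lifting) continuous_on_cong)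
qed

lemma set_integrable_mult_continuous:
  fixes V C :: "real \<Rightarrow> real"
  assumes V: "set_integrable lborel {a..b} V" and C: "continuous_on {a..b} C"
  shows "set_integrable lborel {a..b} (\<lambda>t. V t * C t)"
proof -
  have "compact (C ` {a..b})"
    by (rule compact_continuous_image[OF C]) auto
  then obtain K where K: "\<And>t. t \<in> {a..b} \<Longrightarrow> \<bar>C t\<bar> \<le> K"
    by (force dest!: compact_imp_bounded simp: bounded_iff)
  have m: "set_borel_measurable lborel {a..b} C"
    using borel_measurable_continuous_on_indicator[OF _ C] by (simp add: set_borel_measurable_def)
  show ?thesis
    unfolding set_integrable_def
  proof (rule Bochner_Integration.integrable_bound)
    show "integrable lborel (\<lambda>t. K * (indicator {a..b} t *\<^sub>R V t))"
      using V unfolding set_integrable_def by (intro integrable_mult_right) simp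
    have "(\<lambda>t. (indicator {a..b} t *\<^sub>R V t) * (indicator {a..b} t *\<^sub>R C t)) \<in> borel_measurable lborel"
      using V m unfolding set_integrable_def set_borel_measurable_def
      by (intro borel_measurable_times) auto
    also have "(\<lambda>t. (indicator {a..b} t *\<^sub>R V t) * (indicator {a..b} t *\<^sub>R C t)) = (\<lambda>t. indicator {a..b} t *\<^sub>R (V t * C t))"
      by (auto simp: indicator_def)
    finally show "\<dots> \<in> borel_measurable lborel" .
    show "AE t in lborel. norm (indicator {a..b} t *\<^sub>R (V t * C t)) \<le> norm (K * (indicator {a..b} t *\<^sub>R V t))"
    proof (rule AE_I2)
      fix t
      show "norm (indicator {a..b} t *\<^sub>R (V t * C t)) \<le> norm (K * (indicator {a..b} t *\<^sub>R V t))"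
      proof (cases "t \<in> {a..b}")
        case True
        have "\<bar>V t\<bar> * \<bar>C t\<bar> \<le> \<bar>V t\<bar> * \<bar>K\<bar>"
          using K[OF True] by (intro mult_left_mono) auto
        with True show ?thesis
          by (simp add: abs_mult mult.commute)
      qed auto
    qed
  qed
qed

text \<open>Fubini for V(t) D(s) on the triangle t \<le> s: integration in t first leaves D(s) (U(s)
  - U(a)), integration in s first leaves V(t) (C(b) - C(t)). No pointwise differentiability enters,
  so the rule covers modes whose derivatives exist only almost everywhere.\<close>

lemma prim_parts:
  assumes U: "prim a b U V" and C: "prim a b C D" and "a \<le> b"
  shows "(LINT t:{a..b}|lborel. V t * C t) + (LINT t:{a..b}|lborel. U t * D t) = U b * C b - U a * C a"
proof -
  define v where "v = (\<lambda>t. indicator {a..b} t * V t)"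
  define d where "d = (\<lambda>t. indicator {a..b} t * D t)"
  have v: "integrable lborel v" and d: "integrable lborel d"
    using prim_integrable[OF U] prim_integrable[OF C] by (auto simp: v_def d_def set_integrable_def)
  have vm[measurable]: "v \<in> borel_measurable borel" and dm[measurable]: "d \<in> borel_measurable borel"
    using v d by (auto dest: borel_measurable_integrable)
  define I where "I = (\<lambda>(t, s). (if t \<le> s then v t * d s else 0) :: real)"
  have prod: "integrable (lborel \<Otimes>\<^sub>M lborel) (\<lambda>(t, s). v t * d s)"
    by (rule lborel_pair.Fubini_integrable) (use v d in \<open>auto simp: abs_mult integrable_abs\<close>)
  have I: "integrable (lborel \<Otimes>\<^sub>M lborel) I"
  proof (rule Bochner_Integration.integrable_bound[OF prod])
    show "I \<in> borel_measurable (lborel \<Otimes>\<^sub>M lborel)"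
      unfolding I_def by measurable
  qed (auto simp: I_def)
  have swap: "(\<integral>s. (\<integral>t. I (t, s) \<partial>lborel) \<partial>lborel) = (\<integral>t. (\<integral>s. I (t, s) \<partial>lborel) \<partial>lborel)"
    using lborel_pair.Fubini_integral[of "\<lambda>t s. I (t, s)"] I by simp
  have Uy: "(\<integral>t. I (t, s) \<partial>lborel) = d s * (U s - U a)" for s
  proof (cases "s \<in> {a..b}")
    case True
    have "U s - U a = (\<integral>t. indicator {a..s} t * V t \<partial>lborel)"
      using prim_integral[OF U True] by (simp add: set_lebesgue_integral_def)
    moreover have "(\<lambda>t. I (t, s)) = (\<lambda>t. d s * (indicator {a..s} t * V t))"
      using True by (auto simp: I_def v_def indicator_def)
    ultimately show ?thesis by simp
  next
    case False
    then have "d s = 0" by (simp add: d_def)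
    then show ?thesis by (simp add: I_def cong: if_cong)
  qed
  have Cy: "(\<integral>s. I (t, s) \<partial>lborel) = v t * (C b - C t)" for t
  proof (cases "t \<in> {a..b}")
    case True
    have D1: "integrable lborel (\<lambda>s. indicator {a..t} s * D s)"
      using prim_integrable[OF C] set_integrable_subset[of lborel "{a..b}" D "{a..t}"] True
      by (auto simp: set_integrable_def)
    have "C b - C t = (\<integral>s. d s \<partial>lborel) - (\<integral>s. indicator {a..t} s * D s \<partial>lborel)"
      using prim_integral[OF C True] prim_integral[OF C, of b] True
      by (simp add: set_lebesgue_integral_def d_def)
    also have "\<dots> = (\<integral>s. d s - indicator {a..t} s * D s \<partial>lborel)"
      using d D1 by simp
    \<comment> \<open>The two integrands disagree at most at s = t, a null set.\<close>
    also have "\<dots> = (\<integral>s. (if t \<le> s then d s else 0) \<partial>lborel)"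
    proof (rule integral_cong_AE)
      show "(\<lambda>s. d s - indicator {a..t} s * D s) \<in> borel_measurable lborel"
        using d D1 by (intro borel_measurable_diff) auto
      show "(\<lambda>s. (if t \<le> s then d s else 0)) \<in> borel_measurable lborel" by measurable
      show "AE s in lborel. d s - indicator {a..t} s * D s = (if t \<le> s then d s else 0)"
        using AE_lborel_singleton[of t]
        by eventually_elim (use True in \<open>auto simp: d_def indicator_def\<close>)
    qed
    finally have "v t * (C b - C t) = (\<integral>s. v t * (if t \<le> s then d s else 0) \<partial>lborel)" by simp
    also have "(\<lambda>s. v t * (if t \<le> s then d s else 0)) = (\<lambda>s. I (t, s))"
      by (auto simp: I_def)
    finally show ?thesis ..
  next
    case False
    then have "v t = 0" by (simp add: v_def)
    then show ?thesis by (simp add: I_def cong: if_cong)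
  qed
  have E: "(\<integral>s. d s * (U s - U a) \<partial>lborel) = (\<integral>t. v t * (C b - C t) \<partial>lborel)"
    using swap by (simp only: Uy Cy)
  have VC: "integrable lborel (\<lambda>t. v t * C t)" and DU: "integrable lborel (\<lambda>t. d t * U t)"
    using set_integrable_mult_continuous[OF _ prim_continuous[OF C], of V]
      set_integrable_mult_continuous[OF _ prim_continuous[OF U], of D] prim_integrable[OF U] prim_integrable[OF C]
    by (auto simp: set_integrable_def v_def d_def mult.assoc)
  have "(\<integral>s. d s * U s \<partial>lborel) - U a * (\<integral>s. d s \<partial>lborel) = C b * (\<integral>t. v t \<partial>lborel) - (\<integral>t. v t * C t \<partial>lborel)"
    using E v d VC DU by (simp add: algebra_simps)
  moreover have "(\<integral>s. d s \<partial>lborel) = C b - C a" "(\<integral>s. v s \<partial>lborel) = U b - U a"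
    using prim_integral[OF C, of b] prim_integral[OF U, of b] \<open>a \<le> b\<close>
    by (auto simp: set_lebesgue_integral_def d_def v_def)
  moreover have "(LINT t:{a..b}|lborel. V t * C t) = (\<integral>t. v t * C t \<partial>lborel)"
    "(LINT t:{a..b}|lborel. U t * D t) = (\<integral>t. d t * U t \<partial>lborel)"
    by (auto simp: set_lebesgue_integral_def v_def d_def intro!: Bochner_Integration.integral_cong)
  ultimately show ?thesis by (simp add: algebra_simps)
qed

text \<open>The exceptional set serves the Green functions, whose second derivative has a corner at
  the pole.\<close>

lemma prim_FTC:
  fixes U V :: "real \<Rightarrow> real"
  assumes "finite S" "continuous_on {a..b} U" "set_integrable lborel {a..b} V"
    "\<And>x. x \<in> {a<..<b} - S \<Longrightarrow> (U has_real_derivative V x) (at x)"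
  shows "prim a b U V"
proof (rule primI)
  fix y assume y: "y \<in> {a..b}"
  have "(V has_integral (U y - U a)) {a..y}"
  proof (rule fundamental_theorem_of_calculus_interior_strong[OF \<open>finite S\<close>])
    show "continuous_on {a..y} U"
      by (rule continuous_on_subset[OF assms(2)]) (use y in auto)
  qed (use y assms(4) in \<open>auto simp flip: has_real_derivative_iff_has_vector_derivative\<close>)
  moreover have "set_integrable lborel {a..y} V"
    by (rule set_integrable_subset[OF assms(3)]) (use y in auto)
  ultimately show "(LINT t:{a..y}|lborel. V t) = U y - U a"
    by (simp add: set_borel_integral_eq_integral(2) integral_unique)
qed fact

lemma prim_C1:
  fixes U V :: "real \<Rightarrow> real"
  assumes "\<And>x. (U has_real_derivative V x) (at x)" "continuous_on {a..b} V"
  shows "prim a b U V"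
proof (rule prim_FTC[of "{}"])
  show "continuous_on {a..b} U"
    by (rule DERIV_continuous_on) (rule has_field_derivative_at_within[OF assms(1)])
  show "set_integrable lborel {a..b} V"
    by (rule borel_integrable_atLeastAtMost'[OF assms(2)])
  show "(U has_real_derivative V x) (at x)" for x by (rule assms(1))
qed simp

lemma prim_add:
  assumes "prim a b U V" "prim a b C D"
  shows "prim a b (\<lambda>x. U x + C x) (\<lambda>x. V x + D x)"
proof (rule primI)
  fix y assume y: "y \<in> {a..b}"
  have "set_integrable lborel {a..y} V" "set_integrable lborel {a..y} D"
    by (rule set_integrable_subset[OF assms(1)[THEN prim_integrable]], use y in auto)
       (rule set_integrable_subset[OF assms(2)[THEN prim_integrable]], use y in auto)
  then show "(LINT t:{a..y}|lborel. V t + D t) = U y + C y - (U a + C a)"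
    using assms[THEN prim_integral, OF y] by (simp add: set_integral_add(2))
qed (rule set_integral_add(1)[OF assms[THEN prim_integrable]])

lemma prim_cmult:
  assumes "prim a b U V"
  shows "prim a b (\<lambda>x. c * U x) (\<lambda>x. c * V x)"
proof (rule primI)
  show "set_integrable lborel {a..b} (\<lambda>x. c * V x)"
    using prim_integrable[OF assms] by simp
  show "(LINT t:{a..y}|lborel. c * V t) = c * U y - c * U a" if "y \<in> {a..b}" for y
    using prim_integral[OF assms that] by (simp add: right_diff_distrib)
qed

lemma prim_diff:
  assumes "prim a b U V" "prim a b C D"
  shows "prim a b (\<lambda>x. U x - C x) (\<lambda>x. V x - D x)"
  using prim_add[OF assms(1) prim_cmult[OF assms(2), of "-1"]] by simp

section \<open>Weak derivatives on an interval\<close>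

text \<open>A smooth function is carried along as the sequence of all its derivatives, so that
  supports and recursions are available at every order without iterating a derivative
  operator.\<close>

definition deriv_seq :: "(nat \<Rightarrow> real \<Rightarrow> real) \<Rightarrow> bool" where
  "deriv_seq F \<longleftrightarrow> (\<forall>n x. (F n has_real_derivative F (Suc n) x) (at x))"

definition test_seq :: "real \<Rightarrow> real \<Rightarrow> (nat \<Rightarrow> real \<Rightarrow> real) \<Rightarrow> bool" where
  "test_seq a b F \<longleftrightarrow> deriv_seq F \<and> (\<exists>c d. a < c \<and> c \<le> d \<and> d < b \<and> (\<forall>x. x \<notin> {c..d} \<longrightarrow> F 0 x = 0))"

lemma deriv_seqD: "deriv_seq F \<Longrightarrow> (F n has_real_derivative F (Suc n) x) (at x)"
  by (simp add: deriv_seq_def)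

lemma deriv_seq_continuous: "deriv_seq F \<Longrightarrow> continuous_on A (F n)"
  by (meson DERIV_isCont continuous_at_imp_continuous_on deriv_seqD)

lemma deriv_seq_prim: "deriv_seq F \<Longrightarrow> prim a b (F n) (F (Suc n))"
  by (intro prim_C1 deriv_seqD deriv_seq_continuous)

lemma deriv_seq_support:
  assumes F: "deriv_seq F" and z: "\<And>x. x \<notin> {c..d} \<Longrightarrow> F 0 x = 0"
  shows "x \<notin> {c..d} \<Longrightarrow> F n x = 0"
proof (induction n arbitrary: x)
  case (Suc n)
  have "open (- {c..d})" by auto
  then have "(F n has_real_derivative 0) (at x)"
    using Suc by (intro has_field_derivative_transform_within_open[OF DERIV_const[of 0], of "- {c..d}"]) auto
  then show ?case
    using deriv_seqD[OF F] DERIV_unique by blast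
qed (use z in auto)

lemma test_seqE:
  assumes "test_seq a b F"
  obtains c d where "a < c" "c \<le> d" "d < b" "\<And>n x. x \<notin> {c..d} \<Longrightarrow> F n x = 0"
proof -
  obtain c d where cd: "a < c" "c \<le> d" "d < b" "\<And>x. x \<notin> {c..d} \<Longrightarrow> F 0 x = 0"
    using assms by (auto simp: test_seq_def)
  moreover have "F n x = 0" if "x \<notin> {c..d}" for n x
    using assms that by (intro deriv_seq_support[of F, OF _ cd(4)]) (auto simp: test_seq_def)
  ultimately show ?thesis using that by blast
qed

lemma test_seq_deriv_seq: "test_seq a b F \<Longrightarrow> deriv_seq F"
  by (simp add: test_seq_def)

lemma test_seq_ends:
  assumes "test_seq a b F" shows "F n a = 0" "F n b = 0"
  using assms by (auto elim!: test_seqE)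

lemma test_seq_shift:
  assumes "test_seq a b F" shows "test_seq a b (\<lambda>n. F (Suc n))"
proof -
  obtain c d where "a < c" "c \<le> d" "d < b" "\<And>n x. x \<notin> {c..d} \<Longrightarrow> F n x = 0"
    using test_seqE[OF assms] by metis
  moreover have "deriv_seq (\<lambda>n. F (Suc n))"
    using assms by (simp add: test_seq_def deriv_seq_def)
  ultimately show ?thesis unfolding test_seq_def
    by (intro conjI exI[of _ c] exI[of _ d]) blast+
qed

section \<open>Smooth bumps and ramps on the line\<close>

definition exp_recip :: "nat \<Rightarrow> real \<Rightarrow> real" where
  "exp_recip n x = (if x > 0 then exp (- (1 / x)) / x ^ n else 0)"

lemma exp_recip_at_right: "(exp_recip n \<longlongrightarrow> 0) (at_right 0)"
proof -
  have "((\<lambda>x. (inverse x) ^ n / exp (inverse x)) \<longlongrightarrow> 0) (at_right (0::real))"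
    using filterlim_compose[OF tendsto_power_div_exp_0 filterlim_inverse_at_top_right] .
  moreover have "\<forall>\<^sub>F x in at_right 0. inverse x ^ n / exp (inverse x) = exp_recip n x"
    using eventually_at_right_less[of "0::real"]
    by eventually_elim (simp add: exp_recip_def exp_minus divide_simps power_inverse)
  ultimately show ?thesis
    by (rule Lim_transform_eventually)
qed

text \<open>Differentiating exp(-1/x) produces powers of 1/x, so these are built into the family. At
  0 the right difference quotient of member n is member n + 1, which tends to 0.\<close>

lemma exp_recip_deriv:
  "(exp_recip n has_real_derivative exp_recip (n + 2) x - n * exp_recip (n + 1) x) (at x)"
proof -
  consider "x > 0" | "x < 0" | "x = 0" by linarith
  then show ?thesis
  proof cases
    case 1
    have "((\<lambda>x. exp (- (1 / x)) / x ^ n) has_real_derivative exp_recip (n + 2) x - n * exp_recip (n + 1) x) (at x)"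
    proof (rule DERIV_cong[OF DERIV_divide[OF _ DERIV_pow]])
      show "((\<lambda>x. exp (- (1 / x))) has_real_derivative exp (- (1 / x)) / x^2) (at x)"
        using 1 by (auto intro!: derivative_eq_intros simp: power2_eq_square)
      show "(exp (- (1 / x)) / x\<^sup>2 * x ^ n - exp (- (1 / x)) * (real n * x ^ (n - Suc 0))) / (x ^ n * x ^ n) =
        exp_recip (n + 2) x - n * exp_recip (n + 1) x"
        using 1 by (cases n) (auto simp: exp_recip_def field_simps power2_eq_square)
    qed (use 1 in auto)
    then show ?thesis
      by (rule has_field_derivative_transform_within_open[of _ _ _ "{0<..}"]) (use 1 in \<open>auto simp: exp_recip_def\<close>)
  next
    case 2
    have "((\<lambda>x. 0) has_real_derivative exp_recip (n + 2) x - n * exp_recip (n + 1) x) (at x)"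
      using 2 by (simp add: exp_recip_def)
    then show ?thesis
      by (rule has_field_derivative_transform_within_open[of _ _ _ "{..<0}"]) (use 2 in \<open>auto simp: exp_recip_def\<close>)
  next
    case 3
    have "((\<lambda>h. (exp_recip n h - exp_recip n 0) / (h - 0)) \<longlongrightarrow> 0) (at 0)"
    proof (rule filterlim_split_at_real)
      show "((\<lambda>h. (exp_recip n h - exp_recip n 0) / (h - 0)) \<longlongrightarrow> 0) (at_right 0)"
        by (rule Lim_transform_eventually[OF exp_recip_at_right[of "Suc n"]])
           (auto simp: eventually_at_filter exp_recip_def)
      show "((\<lambda>h. (exp_recip n h - exp_recip n 0) / (h - 0)) \<longlongrightarrow> 0) (at_left 0)"
        by (rule Lim_transform_eventually[OF tendsto_const])
           (auto simp: eventually_at_filter exp_recip_def)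
    qed
    then show ?thesis
      using 3 by (simp add: has_field_derivative_iff exp_recip_def)
  qed
qed

text \<open>Closure under multiples, sums and products makes this set stable under differentiation,
  so each member is infinitely differentiable. This replaces a formula for the higher derivatives of
  the bump exp(-1/x) exp(-1/(1 - x)).\<close>

inductive_set bump_alg :: "(real \<Rightarrow> real) set" where
  left: "exp_recip n \<in> bump_alg"
| right: "(\<lambda>x. exp_recip n (1 - x)) \<in> bump_alg"
| cmult: "f \<in> bump_alg \<Longrightarrow> (\<lambda>x. c * f x) \<in> bump_alg"
| add: "f \<in> bump_alg \<Longrightarrow> g \<in> bump_alg \<Longrightarrow> (\<lambda>x. f x + g x) \<in> bump_alg"
| mult: "f \<in> bump_alg \<Longrightarrow> g \<in> bump_alg \<Longrightarrow> (\<lambda>x. f x * g x) \<in> bump_alg"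

lemma bump_alg_deriv:
  "f \<in> bump_alg \<Longrightarrow> \<exists>g\<in>bump_alg. \<forall>x. (f has_real_derivative g x) (at x)"
proof (induction rule: bump_alg.induct)
  case (left n)
  show ?case
    using exp_recip_deriv[of n] bump_alg.add[OF bump_alg.left[of "n+2"] bump_alg.cmult[OF bump_alg.left[of "n+1"], of "- real n"]]
    by (intro bexI[of _ "\<lambda>x. exp_recip (n+2) x + (- real n) * exp_recip (n+1) x"]) auto
next
  case (right n)
  have "((\<lambda>x. exp_recip n (1 - x)) has_real_derivative (-1) * exp_recip (n+2) (1 - x) + real n * exp_recip (n+1) (1 - x)) (at x)" for x
  proof (rule DERIV_cong[OF DERIV_chain2[OF exp_recip_deriv]])
    show "((\<lambda>x. 1 - x) has_real_derivative -1) (at x)" by (auto intro!: derivative_eq_intros)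
  qed (simp add: algebra_simps)
  then show ?case
    by (intro bexI[OF _ bump_alg.add[OF bump_alg.cmult[OF bump_alg.right[of "n+2"], of "-1"]
          bump_alg.cmult[OF bump_alg.right[of "n+1"], of "real n"]]] allI)
next
  case (cmult f c)
  then obtain g where g: "g \<in> bump_alg" "\<forall>x. (f has_real_derivative g x) (at x)" by blast
  then have "((\<lambda>x. c * f x) has_real_derivative c * g x) (at x)" for x
    by (intro DERIV_cmult) auto
  then show ?case by (intro bexI[OF _ bump_alg.cmult[OF g(1)]] allI)
next
  case (add f g)
  then obtain f' g' where d: "f' \<in> bump_alg" "g' \<in> bump_alg" "\<forall>x. (f has_real_derivative f' x) (at x)"
    "\<forall>x. (g has_real_derivative g' x) (at x)" by blast
  then have "((\<lambda>x. f x + g x) has_real_derivative f' x + g' x) (at x)" for x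
    by (intro DERIV_add) auto
  then show ?case by (intro bexI[OF _ bump_alg.add[OF d(1,2)]] allI)
next
  case (mult f g)
  then obtain f' g' where d: "f' \<in> bump_alg" "g' \<in> bump_alg" "\<forall>x. (f has_real_derivative f' x) (at x)"
    "\<forall>x. (g has_real_derivative g' x) (at x)" by blast
  then have "((\<lambda>x. f x * g x) has_real_derivative f' x * g x + g' x * f x) (at x)" for x
    by (intro DERIV_mult) auto
  then show ?case
    by (intro bexI[OF _ bump_alg.add[OF bump_alg.mult[OF d(1) mult.hyps(2)] bump_alg.mult[OF d(2) mult.hyps(1)]]] allI)
qed

lemma deriv_seq_bump:
  obtains R where "deriv_seq R" "\<And>x. R 0 x \<ge> 0" "\<And>x. 0 < x \<Longrightarrow> x < 1 \<Longrightarrow> R 0 x > 0"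
    "\<And>x. x \<notin> {0..1} \<Longrightarrow> R 0 x = 0"
proof -
  define f where "f = (\<lambda>x. exp_recip 0 x * exp_recip 0 (1 - x))"
  have "f \<in> bump_alg"
    unfolding f_def by (intro bump_alg.intros)
  moreover obtain D where D: "\<And>f. f \<in> bump_alg \<Longrightarrow> D f \<in> bump_alg \<and> (\<forall>x. (f has_real_derivative D f x) (at x))"
    using bump_alg_deriv by metis
  ultimately have "(D ^^ n) f \<in> bump_alg" for n
    by (induction n) auto
  then have "deriv_seq (\<lambda>n. (D ^^ n) f)"
    using D by (auto simp: deriv_seq_def)
  moreover have "f x \<ge> 0" "0 < x \<Longrightarrow> x < 1 \<Longrightarrow> f x > 0" "x \<notin> {0..1} \<Longrightarrow> f x = 0" for x
    by (auto simp: f_def exp_recip_def)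
  ultimately show ?thesis
    using that[of "\<lambda>n. (D ^^ n) f"] by simp
qed

lemma antiderivative_real:
  fixes f :: "real \<Rightarrow> real"
  assumes "continuous_on UNIV f"
  obtains F where "\<And>x. (F has_real_derivative f x) (at x)" "F 0 = 0"
proof -
  have "\<exists>F. \<forall>x::real. -\<infinity> < ereal x \<longrightarrow> ereal x < \<infinity> \<longrightarrow> (F has_vector_derivative f x) (at x)"
    by (rule einterval_antiderivative) (use assms in \<open>auto simp: continuous_on_eq_continuous_at\<close>)
  then obtain F where F: "\<And>x. (F has_real_derivative f x) (at x)"
    by (auto simp: has_real_derivative_iff_has_vector_derivative)
  have "((\<lambda>x. F x - F 0) has_real_derivative f x) (at x)" for x
    using DERIV_diff[OF F DERIV_const, of "F 0" x] by simp
  then show ?thesis using that[of "\<lambda>x. F x - F 0"] by simp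
qed

lemma constant_deriv_affine:
  fixes f :: "real \<Rightarrow> real"
  assumes "\<And>x. (f has_real_derivative f' x) (at x)" "\<And>x. x \<in> {min u v<..<max u v} \<Longrightarrow> f' x = k"
  shows "f v = f u + k * (v - u)"
proof -
  consider "u < v" | "v < u" | "u = v" by linarith
  then show ?thesis
  proof cases
    case 1
    obtain z where "u < z" "z < v" "f v - f u = (v - u) * f' z"
      using MVT2[OF 1, of f f'] assms(1) by blast
    then show ?thesis using assms(2)[of z] 1 by (simp add: algebra_simps)
  next
    case 2
    obtain z where "v < z" "z < u" "f u - f v = (u - v) * f' z"
      using MVT2[OF 2, of f f'] assms(1) by blast
    then show ?thesis using assms(2)[of z] 2 by (simp add: algebra_simps)
  qed simp
qed

text \<open>A bump normalised to mass 1 is integrated twice, which smooths the positive part of x.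
  \<open>T 2\<close> is the mollifier, \<open>T 1\<close> its distribution function, and k the lag
  of the ramp behind x; k cancels in the second differences formed later.\<close>

lemma smooth_ramp:
  obtains T k where "deriv_seq T" "\<And>x. x \<le> 0 \<Longrightarrow> T 0 x = 0" "\<And>x. x \<ge> 1 \<Longrightarrow> T 0 x = x - k"
    "\<And>x. T 2 x \<ge> 0" "\<And>x. x \<notin> {0..1} \<Longrightarrow> T 2 x = 0" "\<And>x. x \<le> 0 \<Longrightarrow> T 1 x = 0" "\<And>x. x \<ge> 1 \<Longrightarrow> T 1 x = 1"
proof -
  obtain R where R: "deriv_seq R" "\<And>x. R 0 x \<ge> 0" "\<And>x. 0 < x \<Longrightarrow> x < 1 \<Longrightarrow> R 0 x > 0"
    "\<And>x. x \<notin> {0..1} \<Longrightarrow> R 0 x = 0" using deriv_seq_bump by blast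
  obtain S where S: "\<And>x. (S has_real_derivative R 0 x) (at x)" "S 0 = 0"
    using antiderivative_real[OF deriv_seq_continuous[OF R(1)]] by blast
  obtain z where z: "0 < z" "z < 1" "S 1 - S 0 = (1 - 0) * R 0 z"
    using MVT2[of 0 1 S "R 0"] S(1) by auto
  define Z where "Z = S 1"
  have Z: "Z > 0" using z R(3)[of z] S(2) by (simp add: Z_def)
  define S' where "S' = (\<lambda>x. S x / Z)"
  have S': "(S' has_real_derivative R 0 x / Z) (at x)" for x
    unfolding S'_def using S(1) by (intro DERIV_cdivide)
  have S'0: "S' x = 0" if "x \<le> 0" for x
    using constant_deriv_affine[OF S', of 0 x 0] that R(4) S(2) by (auto simp: S'_def)
  have S'1: "S' x = 1" if "x \<ge> 1" for x
    using constant_deriv_affine[OF S', of 1 x 0] that R(4) Z by (auto simp: S'_def Z_def)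
  have "continuous_on UNIV S'"
    using S' by (meson DERIV_isCont continuous_at_imp_continuous_on)
  then obtain T where T: "\<And>x. (T has_real_derivative S' x) (at x)" "T 0 = 0"
    using antiderivative_real by blast
  define F where "F = (\<lambda>n. case n of 0 \<Rightarrow> T | Suc m \<Rightarrow> (case m of 0 \<Rightarrow> S' | Suc j \<Rightarrow> (\<lambda>x. R j x / Z)))"
  have "deriv_seq F"
    unfolding deriv_seq_def F_def
    using T(1) S' DERIV_cdivide[OF deriv_seqD[OF R(1)]] by (auto split: nat.splits)
  moreover have "F 0 x = 0" if "x \<le> 0" for x
    using constant_deriv_affine[OF T(1), of 0 x 0] that S'0 T(2) by (auto simp: F_def)
  moreover have "F 0 x = x - (1 - T 1)" if "x \<ge> 1" for x
    using constant_deriv_affine[OF T(1), of 1 x 1] that S'1 by (auto simp: F_def)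
  moreover have "F 2 = (\<lambda>x. R 0 x / Z)" "F 1 = S'" by (auto simp: F_def numeral_2_eq_2)
  ultimately show ?thesis
    using that[of F "1 - T 1"] R(2,4) Z S'0 S'1 by auto
qed

section \<open>Du Bois-Reymond lemmas of orders one and two\<close>

lemma ramp_scale_deriv:
  assumes "deriv_seq T" "\<epsilon> > 0"
  shows "((\<lambda>x. T n ((x - p) / \<epsilon>)) has_real_derivative T (Suc n) ((x - p) / \<epsilon>) / \<epsilon>) (at x)"
  by (rule DERIV_cong[OF DERIV_chain2[OF deriv_seqD[OF assms(1)]]])
     (use assms(2) in \<open>auto intro!: derivative_eq_intros\<close>)

text \<open>The kernel is one-sided, supported in [p, p + \<epsilon>]. Its mass is 1 because the
  rescaled \<open>T 1\<close> climbs from 0 at a to 1 at b, so \<open>T 2\<close> never has to be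
  integrated by hand.\<close>

lemma mollifier_tendsto:
  fixes P :: "real \<Rightarrow> real"
  assumes T: "deriv_seq T" "\<And>x. T 2 x \<ge> 0" "\<And>x. x \<notin> {0..1} \<Longrightarrow> T 2 x = 0"
    "\<And>x. x \<le> 0 \<Longrightarrow> T 1 x = 0" "\<And>x. x \<ge> 1 \<Longrightarrow> T 1 x = 1"
    and P: "continuous_on {a..b} P" and p: "a < p" "p < b"
  shows "((\<lambda>\<epsilon>. LINT x:{a..b}|lborel. P x * (T 2 ((x - p) / \<epsilon>) / \<epsilon>)) \<longlongrightarrow> P p) (at_right 0)"
proof (rule tendstoI)
  fix \<eta> :: real assume \<eta>: "\<eta> > 0"
  have "isCont P p"
    using P p continuous_on_interior[of "{a..b}" P p] by simp
  then obtain \<delta> where \<delta>: "\<delta> > 0" "\<And>x. \<bar>x - p\<bar> < \<delta> \<Longrightarrow> \<bar>P x - P p\<bar> < \<eta> / 2"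
    using \<eta> half_gt_zero[OF \<eta>] unfolding continuous_at_real_range by (metis real_norm_def)
  have "\<forall>\<^sub>F \<epsilon> in at_right 0. \<epsilon> \<in> {0<..<min \<delta> (b - p)}"
    by (rule eventually_at_right_real) (use \<delta> p in auto)
  then show "\<forall>\<^sub>F \<epsilon> in at_right 0. dist (LINT x:{a..b}|lborel. P x * (T 2 ((x - p) / \<epsilon>) / \<epsilon>)) (P p) < \<eta>"
  proof eventually_elim
    fix \<epsilon> assume e: "\<epsilon> \<in> {0<..<min \<delta> (b - p)}"
    then have e0: "\<epsilon> > 0" by simp
    define r where "r = (\<lambda>x. T 2 ((x - p) / \<epsilon>) / \<epsilon>)"
    have rc: "continuous_on A r" for A
      unfolding r_def by (intro continuous_intros continuous_on_compose2[OF deriv_seq_continuous[OF T(1), of UNIV]])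
        (use e in auto)
    have r0: "r x \<ge> 0" for x using T(2) e0 by (simp add: r_def)
    have prim: "prim a b (\<lambda>x. T 1 ((x - p) / \<epsilon>)) r"
      using ramp_scale_deriv[OF T(1) e0, of 1 p] rc
      by (intro prim_C1) (auto simp: r_def numeral_2_eq_2)
    have b1: "T 1 ((b - p) / \<epsilon>) = 1" by (rule T(5)) (use e in auto)
    have a1: "T 1 ((a - p) / \<epsilon>) = 0" by (rule T(4)) (use e p in \<open>auto simp: divide_simps\<close>)
    have r1: "(LINT x:{a..b}|lborel. r x) = 1"
      using prim_integral[OF prim, of b] p a1 b1 by simp
    have ri: "set_integrable lborel {a..b} r" using prim by (rule prim_integrable)
    have Pi: "set_integrable lborel {a..b} (\<lambda>x. P x * r x)"
      by (intro borel_integrable_atLeastAtMost' continuous_intros P rc)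
    have "(LINT x:{a..b}|lborel. P x * r x) - P p = (LINT x:{a..b}|lborel. P x * r x) - (LINT x:{a..b}|lborel. P p * r x)"
      using r1 by simp
    also have "\<dots> = (LINT x:{a..b}|lborel. P x * r x - P p * r x)"
      using set_integral_diff(2)[OF Pi set_integrable_mult_right[OF ri]] by simp
    finally have "\<bar>(LINT x:{a..b}|lborel. P x * r x) - P p\<bar> = \<bar>LINT x:{a..b}|lborel. (P x - P p) * r x\<bar>"
      by (simp add: algebra_simps)
    also have "\<dots> \<le> (LINT x:{a..b}|lborel. \<bar>(P x - P p) * r x\<bar>)"
      unfolding set_lebesgue_integral_def
      by (rule order.trans[OF integral_abs_bound]) (simp add: abs_mult)
    also have "\<dots> \<le> (LINT x:{a..b}|lborel. (\<eta> / 2) * r x)"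
    proof (rule set_integral_mono)
      show "set_integrable lborel {a..b} (\<lambda>x. \<bar>(P x - P p) * r x\<bar>)"
        by (intro borel_integrable_atLeastAtMost' continuous_intros P rc)
      show "set_integrable lborel {a..b} (\<lambda>x. (\<eta> / 2) * r x)" using ri by simp
      fix x assume "x \<in> {a..b}"
      show "\<bar>(P x - P p) * r x\<bar> \<le> (\<eta> / 2) * r x"
      proof (cases "(x - p) / \<epsilon> \<in> {0..1}")
        case True
        then have "\<bar>x - p\<bar> < \<delta>" using e by (auto simp: field_simps abs_if)
        then have "\<bar>P x - P p\<bar> * r x \<le> (\<eta> / 2) * r x"
          using \<delta>(2)[of x] r0[of x] by (intro mult_right_mono) auto
        then show ?thesis using r0[of x] by (simp only: abs_mult abs_of_nonneg)
      qed (simp add: r_def T(3))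
    qed
    also have "\<dots> < \<eta>" using r1 \<eta> by simp
    finally show "dist (LINT x:{a..b}|lborel. P x * (T 2 ((x - p) / \<epsilon>) / \<epsilon>)) (P p) < \<eta>"
      by (simp add: dist_real_def r_def)
  qed
qed

text \<open>The test function is a second difference of a mollified positive part: a smooth hat whose
  second derivative approximates point masses at \<open>c\<close>, \<open>d\<close> and \<open>e\<close>.\<close>

lemma weak_affine_three_points:
  fixes P :: "real \<Rightarrow> real"
  assumes P: "continuous_on {a..b} P"
    and weak: "\<And>F. test_seq a b F \<Longrightarrow> (LINT x:{a..b}|lborel. P x * F 2 x) = 0"
    and cde: "a < c" "c < d" "d < e" "e < b"
  shows "(e - d) * P c - (e - c) * P d + (d - c) * P e = 0"
proof -
  obtain T k where T: "deriv_seq T" "\<And>x. x \<le> 0 \<Longrightarrow> T 0 x = 0" "\<And>x. x \<ge> 1 \<Longrightarrow> T 0 x = x - k"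
    "\<And>x. T 2 x \<ge> 0" "\<And>x. x \<notin> {0..1} \<Longrightarrow> T 2 x = 0" "\<And>x. x \<le> 0 \<Longrightarrow> T 1 x = 0" "\<And>x. x \<ge> 1 \<Longrightarrow> T 1 x = 1"
    using smooth_ramp by blast
  define I where "I = (\<lambda>p \<epsilon>. LINT x:{a..b}|lborel. P x * (T 2 ((x - p) / \<epsilon>) / \<epsilon>))"
  have lim: "(I p \<longlongrightarrow> P p) (at_right 0)" if "a < p" "p < b" for p
    unfolding I_def using mollifier_tendsto[OF T(1) T(4-7) P that] by simp
  have "((\<lambda>\<epsilon>. (e - d) * I c \<epsilon> - (e - c) * I d \<epsilon> + (d - c) * I e \<epsilon>) \<longlongrightarrow>
      (e - d) * P c - (e - c) * P d + (d - c) * P e) (at_right 0)"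
    by (intro tendsto_intros lim) (use cde in auto)
  moreover have "\<forall>\<^sub>F \<epsilon> in at_right 0. \<epsilon> \<in> {0<..<b - e}"
    by (rule eventually_at_right_real) (use cde in auto)
  then have "\<forall>\<^sub>F \<epsilon> in at_right 0. (e - d) * I c \<epsilon> - (e - c) * I d \<epsilon> + (d - c) * I e \<epsilon> = 0"
  proof eventually_elim
    fix \<epsilon> assume "\<epsilon> \<in> {0<..<b - e}"
    then have e0: "\<epsilon> > 0" and eb: "e + \<epsilon> < b" by auto
    \<comment> \<open>The weights e - d, - (e - c), d - c have sum 0 and first moment 0, so beyond e
      + \<epsilon> the linear parts and the lags k of the three ramps cancel and \<open>F 0\<close>
      has compact support. The factor \<epsilon> makes \<open>F 2\<close> a combination of
      mollifiers of mass 1.\<close>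
    define F where "F = (\<lambda>n x. \<epsilon> * (1 / \<epsilon>) ^ n *
      ((e - d) * T n ((x - c) / \<epsilon>) - (e - c) * T n ((x - d) / \<epsilon>) + (d - c) * T n ((x - e) / \<epsilon>)))"
    have "deriv_seq F"
      unfolding deriv_seq_def F_def
    proof (intro allI)
      fix n x
      show "((\<lambda>x. \<epsilon> * (1 / \<epsilon>) ^ n * ((e - d) * T n ((x - c) / \<epsilon>) - (e - c) * T n ((x - d) / \<epsilon>) + (d - c) * T n ((x - e) / \<epsilon>)))
        has_real_derivative \<epsilon> * (1 / \<epsilon>) ^ Suc n * ((e - d) * T (Suc n) ((x - c) / \<epsilon>) - (e - c) * T (Suc n) ((x - d) / \<epsilon>)
          + (d - c) * T (Suc n) ((x - e) / \<epsilon>))) (at x)"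
        by (rule DERIV_cong[OF DERIV_cmult[OF DERIV_add[OF DERIV_diff[OF DERIV_cmult DERIV_cmult] DERIV_cmult]]],
            (rule ramp_scale_deriv[OF T(1) e0])+) (simp add: field_simps)
    qed
    moreover have "F 0 x = 0" if "x \<notin> {c..e + \<epsilon>}" for x
    proof (cases "x < c")
      case True
      then show ?thesis
        using cde e0 T(2)[of "(x - c) / \<epsilon>"] T(2)[of "(x - d) / \<epsilon>"] T(2)[of "(x - e) / \<epsilon>"]
        by (simp add: F_def divide_simps)
    next
      case False
      then have "x > e + \<epsilon>" using that by auto
      then have "T 0 ((x - p) / \<epsilon>) = (x - p) / \<epsilon> - k" if "p \<le> e" for p
        by (intro T(3)) (use that e0 in \<open>auto simp: divide_simps\<close>)
      then have "F 0 x = \<epsilon> * ((e - d) * ((x - c) / \<epsilon> - k) - (e - c) * ((x - d) / \<epsilon> - k) + (d - c) * ((x - e) / \<epsilon> - k))"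
        using cde by (simp add: F_def)
      also have "\<dots> = 0" using e0 by (simp add: field_simps)
      finally show ?thesis .
    qed
    ultimately have "test_seq a b F"
      unfolding test_seq_def using cde e0 eb by (intro conjI exI[of _ c] exI[of _ "e + \<epsilon>"]) auto
    from weak[OF this] have "(LINT x:{a..b}|lborel. P x * F 2 x) = 0" .
    moreover define J where "J = (\<lambda>p x. P x * (T 2 ((x - p) / \<epsilon>) / \<epsilon>))"
    have "P x * F 2 x = (e - d) * J c x - (e - c) * J d x + (d - c) * J e x" for x
      using e0 by (simp add: J_def F_def power2_eq_square field_simps)
    ultimately have J0: "(LINT x:{a..b}|lborel. (e - d) * J c x - (e - c) * J d x + (d - c) * J e x) = 0" by simp
    have int: "set_integrable lborel {a..b} (J p)" for p
      unfolding J_def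
      by (intro borel_integrable_atLeastAtMost' continuous_intros P continuous_on_compose2[OF deriv_seq_continuous[OF T(1), of UNIV]])
         (use e0 in auto)
    have i: "set_integrable lborel {a..b} (\<lambda>x. q * J p x)" for q p
      by (rule set_integrable_mult_right) (rule int)
    have "(e - d) * (LINT x:{a..b}|lborel. J c x) - (e - c) * (LINT x:{a..b}|lborel. J d x) + (d - c) * (LINT x:{a..b}|lborel. J e x) = 0"
      using J0 set_integral_add(2)[OF set_integral_diff(1)[OF i i] i, of "e - d" c "e - c" d "d - c" e]
        set_integral_diff(2)[OF i i, of "e - d" c "e - c" d] by simp
    then show "(e - d) * I c \<epsilon> - (e - c) * I d \<epsilon> + (d - c) * I e \<epsilon> = 0"
      by (simp only: I_def J_def)
  qed
  ultimately have "((\<lambda>\<epsilon>. 0) \<longlongrightarrow> (e - d) * P c - (e - c) * P d + (d - c) * P e) (at_right (0::real))"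
    by (rule Lim_transform_eventually)
  then show ?thesis
    using tendsto_unique[OF trivial_limit_at_right_real _ tendsto_const] by blast
qed

text \<open>The three point relation is the vanishing of a collinearity determinant. Fixing two
  interior points p < q therefore puts the graph over the open interval on the line through them;
  the end points follow by continuity.\<close>

lemma weak_affine:
  fixes P :: "real \<Rightarrow> real"
  assumes ab: "a < b" and P: "continuous_on {a..b} P"
    and weak: "\<And>F. test_seq a b F \<Longrightarrow> (LINT x:{a..b}|lborel. P x * F 2 x) = 0"
  shows "\<exists>\<alpha> \<beta>. \<forall>x\<in>{a..b}. P x = \<alpha> + \<beta> * x"
proof -
  obtain p where p: "a < p" "p < b" using dense[OF ab] by blast
  obtain q where q: "p < q" "q < b" using dense[OF p(2)] by blast
  define \<beta> where "\<beta> = (P q - P p) / (q - p)"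
  define \<alpha> where "\<alpha> = P p - \<beta> * p"
  have tp: "(e - d) * P c - (e - c) * P d + (d - c) * P e = 0" if "a < c" "c < d" "d < e" "e < b" for c d e
    by (rule weak_affine_three_points[OF P _ that]) (rule weak)
  have in0: "P x - (\<alpha> + \<beta> * x) = 0" if x: "x \<in> {a<..<b}" for x
  proof -
    have "(q - p) * (P x - (\<alpha> + \<beta> * x)) = (q - p) * (P x - P p) - (\<beta> * (q - p)) * (x - p)"
      by (simp add: \<alpha>_def algebra_simps)
    also have "\<beta> * (q - p) = P q - P p" using q(1) by (simp add: \<beta>_def)
    finally have "(q - p) * (P x - (\<alpha> + \<beta> * x)) = (q - p) * (P x - P p) - (P q - P p) * (x - p)" .
    also have "\<dots> = 0"
    proof -
      consider "x < p" | "x = p" | "p < x" "x < q" | "x = q" | "q < x" by linarith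
      then show ?thesis
      proof cases
        case 1 then show ?thesis using tp[of x p q] x p q by (simp add: algebra_simps)
      next
        case 3 then show ?thesis using tp[of p x q] x p q by (simp add: algebra_simps)
      next
        case 5 then show ?thesis using tp[of p q x] x p q by (simp add: algebra_simps)
      qed auto
    qed
    finally show ?thesis using q(1) by simp
  qed
  have cl: "closure {a<..<b} = {a..b}" using ab by simp
  have "continuous_on (closure {a<..<b}) (\<lambda>x. P x - (\<alpha> + \<beta> * x))"
    unfolding cl by (intro continuous_intros P)
  from continuous_constant_on_closure[OF this, of 0] in0
  have "P x - (\<alpha> + \<beta> * x) = 0" if "x \<in> {a..b}" for x
    using that unfolding cl by blast
  then show ?thesis by (intro exI[of _ \<alpha>] exI[of _ \<beta>]) simp
qed

lemma prim_exists:
  assumes "set_integrable lborel {a..b} Q"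
  obtains W where "prim a b W Q"
proof
  show "prim a b (\<lambda>x. LINT t:{a..x}|lborel. Q t) Q"
  proof (rule primI[OF assms])
    fix y assume "y \<in> {a..b}"
    then have "set_integrable lborel {a..a} Q"
      by (intro set_integrable_subset[OF assms]) auto
    then have "(LINT t:{a..a}|lborel. Q t) = 0"
      using integral_refl[of a Q] by (simp add: set_borel_integral_eq_integral(2))
    then show "(LINT t:{a..y}|lborel. Q t) = (LINT t:{a..y}|lborel. Q t) - (LINT t:{a..a}|lborel. Q t)" by simp
  qed
qed

lemma prim_test_seq:
  assumes "prim a b W Q" "test_seq a b F" "a \<le> b"
  shows "(LINT x:{a..b}|lborel. Q x * F n x) = - (LINT x:{a..b}|lborel. W x * F (Suc n) x)"
  using prim_parts[OF assms(1) deriv_seq_prim[OF test_seq_deriv_seq[OF assms(2)]] assms(3), of n]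
  by (simp add: test_seq_ends[OF assms(2)])

lemma prim_affine: "prim a b (\<lambda>x. \<alpha> + \<beta> * x) (\<lambda>x. \<beta>)"
  by (rule prim_C1) (auto intro!: derivative_eq_intros)

lemma prim_cong:
  assumes "prim a b U V" "\<And>x. x \<in> {a..b} \<Longrightarrow> U x = U' x"
  shows "prim a b U' V"
proof (rule primI[OF prim_integrable[OF assms(1)]])
  fix y assume "y \<in> {a..b}"
  then show "(LINT t:{a..y}|lborel. V t) = U' y - U' a"
    using prim_integral[OF assms(1)] assms(2) by simp
qed

lemma set_integrable_continuous_test:
  assumes "continuous_on {a..b} P" "test_seq a b F"
  shows "set_integrable lborel {a..b} (\<lambda>x. P x * F n x)"
  by (intro borel_integrable_atLeastAtMost' continuous_intros assms deriv_seq_continuous test_seq_deriv_seq[OF assms(2)])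

text \<open>Comparison with a double primitive Z of Q: P - Z is annihilated by the second
  derivatives of all test functions, hence affine, and its slope is absorbed into the first
  derivative.\<close>

lemma weak_second_derivative:
  fixes P Q :: "real \<Rightarrow> real"
  assumes ab: "a < b" and P: "continuous_on {a..b} P" and Q: "set_integrable lborel {a..b} Q"
    and weak: "\<And>F. test_seq a b F \<Longrightarrow> (LINT x:{a..b}|lborel. Q x * F 0 x) = (LINT x:{a..b}|lborel. P x * F 2 x)"
  obtains P' where "prim a b P P'" "prim a b P' Q"
proof -
  obtain W where W: "prim a b W Q" using prim_exists[OF Q] .
  obtain Z where Z: "prim a b Z W"
    using prim_exists[OF borel_integrable_atLeastAtMost'[OF prim_continuous[OF W]]] .
  have w: "(LINT x:{a..b}|lborel. (P x - Z x) * F 2 x) = 0" if F: "test_seq a b F" for F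
  proof -
    have "(LINT x:{a..b}|lborel. P x * F 2 x) = (LINT x:{a..b}|lborel. Z x * F 2 x)"
      using weak[OF F] prim_test_seq[OF W F, of 0] prim_test_seq[OF Z F, of 1] ab by (simp add: numeral_2_eq_2)
    moreover have "(LINT x:{a..b}|lborel. P x * F 2 x - Z x * F 2 x) =
        (LINT x:{a..b}|lborel. P x * F 2 x) - (LINT x:{a..b}|lborel. Z x * F 2 x)"
      by (rule set_integral_diff(2)[OF set_integrable_continuous_test[OF P F] set_integrable_continuous_test[OF prim_continuous[OF Z] F]])
    ultimately show ?thesis by (simp add: left_diff_distrib)
  qed
  have c: "continuous_on {a..b} (\<lambda>x. P x - Z x)"
    by (intro continuous_intros P prim_continuous[OF Z])
  have "\<exists>\<alpha> \<beta>. \<forall>x\<in>{a..b}. P x - Z x = \<alpha> + \<beta> * x"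
    by (rule weak_affine[OF ab c]) (rule w)
  then obtain \<alpha> \<beta> where *: "\<And>x. x \<in> {a..b} \<Longrightarrow> P x - Z x = \<alpha> + \<beta> * x" by blast
  show ?thesis
  proof
    show "prim a b P (\<lambda>x. W x + \<beta>)"
      by (rule prim_cong[OF prim_add[OF Z prim_affine[of a b \<alpha> \<beta>]]]) (use * in force)
    show "prim a b (\<lambda>x. W x + \<beta>) Q"
      using prim_add[OF W prim_affine[of a b \<beta> 0]] by simp
  qed
qed

text \<open>R is regarded as a weak second derivative of 0. The intermediate derivative P' is then
  continuous, and integrating it against itself by parts shows that its square has integral
  0.\<close>

lemma weak_zero:
  fixes R :: "real \<Rightarrow> real"
  assumes ab: "a < b" and R: "set_integrable lborel {a..b} R"
    and weak: "\<And>F. test_seq a b F \<Longrightarrow> (LINT x:{a..b}|lborel. R x * F 0 x) = 0"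
  shows "prim a b (\<lambda>_. 0) R"
proof -
  obtain P' where P': "prim a b (\<lambda>_. 0) P'" "prim a b P' R"
    using weak_second_derivative[OF ab _ R, of "\<lambda>_. 0"] weak by auto
  have c: "continuous_on {a..b} (\<lambda>x. P' x * P' x)"
    by (intro continuous_intros prim_continuous[OF P'(2)])
  have "(LINT x:{a..b}|lborel. P' x * P' x) = 0"
    using prim_parts[OF P'] ab by simp
  then have "integral {a..b} (\<lambda>x. P' x * P' x) = 0"
    using set_borel_integral_eq_integral(2)[OF borel_integrable_atLeastAtMost'[OF c]] by simp
  then have "((\<lambda>x. P' x * P' x) has_integral 0) {a..b}"
    using integrable_continuous_interval[OF c] integrable_integral by fastforce
  then have "P' x * P' x = 0" if "x \<in> {a..b}" for x
    using has_integral_0_cbox_imp_0[of a b "\<lambda>x. P' x * P' x" x] c ab that by auto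
  then show ?thesis
    using prim_cong[OF P'(2), of "\<lambda>_. 0"] by simp
qed

text \<open>Affinity was obtained from second order tests, so the test sequence is shifted by one.
  This leaves a spurious slope \<beta>, which the first order hypothesis then forces to
  vanish.\<close>

lemma weak_first_derivative:
  fixes P Q :: "real \<Rightarrow> real"
  assumes ab: "a < b" and P: "continuous_on {a..b} P" and Q: "set_integrable lborel {a..b} Q"
    and weak: "\<And>F. test_seq a b F \<Longrightarrow> (LINT x:{a..b}|lborel. Q x * F 0 x) = - (LINT x:{a..b}|lborel. P x * F 1 x)"
  shows "prim a b P Q"
proof -
  obtain W where W: "prim a b W Q" using prim_exists[OF Q] .
  have z: "(LINT x:{a..b}|lborel. (P x - W x) * F 1 x) = 0" if F: "test_seq a b F" for F
  proof -
    have "(LINT x:{a..b}|lborel. P x * F 1 x) = (LINT x:{a..b}|lborel. W x * F 1 x)"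
      using weak[OF F] prim_test_seq[OF W F, of 0] ab by simp
    moreover have "(LINT x:{a..b}|lborel. P x * F 1 x - W x * F 1 x) =
        (LINT x:{a..b}|lborel. P x * F 1 x) - (LINT x:{a..b}|lborel. W x * F 1 x)"
      by (rule set_integral_diff(2)[OF set_integrable_continuous_test[OF P F] set_integrable_continuous_test[OF prim_continuous[OF W] F]])
    ultimately show ?thesis by (simp add: left_diff_distrib)
  qed
  have c: "continuous_on {a..b} (\<lambda>x. P x - W x)"
    by (intro continuous_intros P prim_continuous[OF W])
  have w: "(LINT x:{a..b}|lborel. (P x - W x) * F 2 x) = 0" if F: "test_seq a b F" for F
    using z[OF test_seq_shift[OF F]] by (simp add: numeral_2_eq_2)
  have "\<exists>\<alpha> \<beta>. \<forall>x\<in>{a..b}. P x - W x = \<alpha> + \<beta> * x"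
    by (rule weak_affine[OF ab c]) (rule w)
  then obtain \<alpha> \<beta> where *: "\<And>x. x \<in> {a..b} \<Longrightarrow> P x - W x = \<alpha> + \<beta> * x" by blast
  have aff: "prim a b (\<lambda>x. P x - W x) (\<lambda>x. \<beta>)"
    by (rule prim_cong[OF prim_affine]) (use * in auto)
  have "prim a b (\<lambda>_. 0) (\<lambda>x. \<beta>)"
  proof (rule weak_zero[OF ab])
    show "set_integrable lborel {a..b} (\<lambda>x. \<beta>)" using aff by (rule prim_integrable)
    show "(LINT x:{a..b}|lborel. \<beta> * F 0 x) = 0" if F: "test_seq a b F" for F
      using prim_test_seq[OF aff F, of 0] z[OF F] ab by simp
  qed
  then have "prim a b (\<lambda>x. P x - W x) (\<lambda>_. 0)"
    using prim_diff[OF aff] by fastforce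
  from prim_add[OF this W] show ?thesis by simp
qed

section \<open>The Green function of a single mode\<close>

lemma DERIV_glue_zero:
  fixes f :: "real \<Rightarrow> real"
  assumes p: "\<And>t. t \<ge> 0 \<Longrightarrow> f t = p t" "\<And>t. t \<ge> 0 \<Longrightarrow> (p has_real_derivative g t) (at t)"
    and q: "\<And>t. t \<le> 0 \<Longrightarrow> f t = q t" "\<And>t. t \<le> 0 \<Longrightarrow> (q has_real_derivative g t) (at t)"
  shows "(f has_real_derivative g t) (at t)"
proof -
  consider "t > 0" | "t < 0" | "t = 0" by linarith
  then show ?thesis
  proof cases
    case 1
    show ?thesis
      by (rule has_field_derivative_transform_within_open[OF p(2), of _ "{0<..}"]) (use 1 p(1) in auto)
  next
    case 2
    show ?thesis
      by (rule has_field_derivative_transform_within_open[OF q(2), of _ "{..<0}"]) (use 2 q(1) in auto)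
  next
    case 3
    have "((\<lambda>h. (f h - f 0) / (h - 0)) \<longlongrightarrow> g 0) (at 0)"
    proof (rule filterlim_split_at_real)
      have "((\<lambda>h. (p h - p 0) / (h - 0)) \<longlongrightarrow> g 0) (at_right 0)"
        using p(2)[of 0] by (simp add: has_field_derivative_iff filterlim_at_split)
      then show "((\<lambda>h. (f h - f 0) / (h - 0)) \<longlongrightarrow> g 0) (at_right 0)"
        by (rule Lim_transform_eventually) (use p(1) in \<open>auto simp: eventually_at_filter\<close>)
      have "((\<lambda>h. (q h - q 0) / (h - 0)) \<longlongrightarrow> g 0) (at_left 0)"
        using q(2)[of 0] by (simp add: has_field_derivative_iff filterlim_at_split)
      then show "((\<lambda>h. (f h - f 0) / (h - 0)) \<longlongrightarrow> g 0) (at_left 0)"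
        by (rule Lim_transform_eventually) (use q(1) in \<open>auto simp: eventually_at_filter\<close>)
    qed
    then show ?thesis using 3 by (simp add: has_field_derivative_iff)
  qed
qed

text \<open>At a nonpositive interior minimum h1 would vanish while h2 < 0, so h would decrease just
  to the right of it. Derivatives are required only in the open interval, which allows the pole of a
  Green function as an end point.\<close>

lemma minimum_principle:
  fixes h h1 h2 :: "real \<Rightarrow> real"
  assumes "a \<le> b" "continuous_on {a..b} h" "h a > 0" "h b > 0"
    and h1: "\<And>x. a < x \<Longrightarrow> x < b \<Longrightarrow> (h has_real_derivative h1 x) (at x)"
    and h2: "\<And>x. a < x \<Longrightarrow> x < b \<Longrightarrow> (h1 has_real_derivative h2 x) (at x)"
    and neg: "\<And>x. a < x \<Longrightarrow> x < b \<Longrightarrow> h x \<le> 0 \<Longrightarrow> h2 x < 0"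
    and x: "x \<in> {a..b}"
  shows "h x > 0"
proof (rule ccontr)
  assume nx: "\<not> h x > 0"
  obtain z where z: "z \<in> {a..b}" "\<And>y. y \<in> {a..b} \<Longrightarrow> h z \<le> h y"
    using continuous_attains_inf[OF compact_Icc _ assms(2)] \<open>a \<le> b\<close> by auto
  have hz: "h z \<le> 0" using z(2)[OF x] nx by simp
  then have zi: "a < z" "z < b" using z(1) assms(3,4) by (auto simp: less_le)
  have "h1 z = 0"
  proof (rule DERIV_local_min[OF h1[OF zi]])
    show "0 < min (z - a) (b - z)" using zi by simp
    show "\<forall>y. \<bar>z - y\<bar> < min (z - a) (b - z) \<longrightarrow> h z \<le> h y" using z(2) by (auto simp: abs_if split: if_splits)
  qed
  then obtain d where d: "d > 0" "\<And>t. 0 < t \<Longrightarrow> t < d \<Longrightarrow> h1 (z + t) < 0"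
    using DERIV_neg_dec_right[OF h2[OF zi] neg[OF zi hz]] by auto
  define t where "t = min d (b - z) / 2"
  have t: "0 < t" "t < d" "z + t < b" using d(1) zi by (auto simp: t_def min_def field_simps)
  have "\<exists>y>z. y < z + t \<and> h (z + t) - h z = (z + t - z) * h1 y"
    using t zi by (intro MVT2 h1) auto
  then obtain y where y: "z < y" "y < z + t" "h (z + t) - h z = t * h1 y" by auto
  have "h1 y < 0" using d(2)[of "y - z"] y t by auto
  then have "h (z + t) < h z" using y(3) t(1) by (smt (verit) mult_pos_neg)
  moreover have "h z \<le> h (z + t)" by (rule z(2)) (use zi t in auto)
  ultimately show False by simp
qed

text \<open>The fundamental solution of \<open>w'''' - 2 w'' + w = \<delta>\<close> on the line and its derivatives;
  \<open>ker3\<close> is the third derivative with its unit jump at \<open>0\<close> removed.\<close>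

definition ker0 :: "real \<Rightarrow> real" where "ker0 t = (1 + \<bar>t\<bar>) * exp (- \<bar>t\<bar>) / 4"
definition ker1 :: "real \<Rightarrow> real" where "ker1 t = - t * exp (- \<bar>t\<bar>) / 4"
definition ker2 :: "real \<Rightarrow> real" where "ker2 t = (\<bar>t\<bar> - 1) * exp (- \<bar>t\<bar>) / 4"
definition ker3 :: "real \<Rightarrow> real" where
  "ker3 t = (if t \<le> 0 then - ((2 + t) * exp t / 4) else (2 - t) * exp (- t) / 4 - 1)"

lemma ker0_deriv: "(ker0 has_real_derivative ker1 t) (at t)"
  by (rule DERIV_glue_zero[where p = "\<lambda>t. (1 + t) * exp (- t) / 4" and q = "\<lambda>t. (1 - t) * exp t / 4"])
     (auto simp: ker0_def ker1_def intro!: derivative_eq_intros, auto simp: field_simps)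

lemma ker1_deriv: "(ker1 has_real_derivative ker2 t) (at t)"
  by (rule DERIV_glue_zero[where p = "\<lambda>t. - t * exp (- t) / 4" and q = "\<lambda>t. - t * exp t / 4"])
     (auto simp: ker1_def ker2_def intro!: derivative_eq_intros, auto simp: field_simps)

lemma ker2_deriv:
  assumes "t \<noteq> 0"
  shows "(ker2 has_real_derivative ker3 t + (if t > 0 then 1 else 0)) (at t)"
proof (cases "t > 0")
  case True
  have "((\<lambda>t. (t - 1) * exp (- t) / 4) has_real_derivative ker3 t + (if t > 0 then 1 else 0)) (at t)"
    using True by (auto simp: ker3_def field_simps intro!: derivative_eq_intros)
  then show ?thesis
    by (rule has_field_derivative_transform_within_open[of _ _ _ "{0<..}"]) (use True in \<open>auto simp: ker2_def\<close>)
next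
  case False
  have "((\<lambda>t. (- t - 1) * exp t / 4) has_real_derivative ker3 t + (if t > 0 then 1 else 0)) (at t)"
    using False by (auto simp: ker3_def field_simps intro!: derivative_eq_intros)
  then show ?thesis
    by (rule has_field_derivative_transform_within_open[of _ _ _ "{..<0}"]) (use False assms in \<open>auto simp: ker2_def\<close>)
qed

lemma ker3_deriv:
  assumes "t \<noteq> 0"
  shows "(ker3 has_real_derivative 2 * ker2 t - ker0 t) (at t)"
proof (cases "t > 0")
  case True
  have "((\<lambda>t. (2 - t) * exp (- t) / 4 - 1) has_real_derivative 2 * ker2 t - ker0 t) (at t)"
    using True by (auto simp: ker2_def ker0_def field_simps intro!: derivative_eq_intros)
  then show ?thesis
    by (rule has_field_derivative_transform_within_open[of _ _ _ "{0<..}"]) (use True in \<open>auto simp: ker3_def\<close>)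
next
  case False
  have "((\<lambda>t. - ((2 + t) * exp t / 4)) has_real_derivative 2 * ker2 t - ker0 t) (at t)"
    using False by (auto simp: ker2_def ker0_def field_simps intro!: derivative_eq_intros)
  then show ?thesis
    by (rule has_field_derivative_transform_within_open[of _ _ _ "{..<0}"]) (use False assms in \<open>auto simp: ker3_def\<close>)
qed

lemma continuous_ker2: "continuous_on A ker2"
  unfolding ker2_def by (intro continuous_intros) auto

lemma continuous_ker3: "continuous_on A ker3"
proof -
  have "continuous_on ({..0} \<union> {0..}) (\<lambda>t. if t \<le> 0 then - ((2 + t) * exp t / 4) else (2 - t) * exp (- t) / 4 - (1::real))"
    by (rule continuous_on_If) (auto intro!: continuous_intros)
  moreover have "{..0} \<union> {0..} = (UNIV :: real set)" by auto
  ultimately have "continuous_on UNIV ker3"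
    by (simp add: ker3_def[abs_def])
  then show ?thesis by (rule continuous_on_subset) simp
qed

text \<open>The even half of the shear condition at s = L, with cosh L, sinh L, cosh r, sinh r
  replaced by c, s, p, q. The relations that remain are c^2 = s^2 + 1 and the linear equation for x
  = \<open>xe\<close>; once 1/c is named, the identity is polynomial.\<close>

lemma free_edge_even:
  fixes c s L \<kappa> p q r x :: real
  assumes "c > 0" "\<kappa> > 0" "c^2 = s^2 + 1"
    and x: "((4 - \<kappa>) * (s * c) - \<kappa> * L) * x = p + \<kappa> / 2 * (L * s / c * p - r * q)"
    and B: "B = ((c - s) * p / (2 * c) - x) / 2"
    and A: "A = x / \<kappa> - B * L * s / c - (c - s) / 4 * ((1 + L) * p - r * q) / c"
  shows "\<kappa> * (- (c - s) / 4 * (L * p - r * q) + A * s + B * (s + L * c)) = (c - s) * p / 2 + 2 * B * s"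
proof -
  define y where "y = 1 / c"
  have y: "c * y = 1" using assms by (simp add: y_def)
  have x': "2 * ((4 - \<kappa>) * (s * c) - \<kappa> * L) * x = 2 * p + \<kappa> * (L * s * y * p - r * q)"
    using x by (simp add: y_def field_simps)
  have B': "4 * B = (c - s) * p * y - 2 * x"
    using assms by (simp add: y_def field_simps)
  have A': "4 * \<kappa> * A = 4 * x - 4 * \<kappa> * B * L * s * y - \<kappa> * (c - s) * ((1 + L) * p - r * q) * y"
    using assms by (simp add: y_def field_simps)
  \<comment> \<open>In the application this is exp(-L); e (c + s) = 1 is the source of the
    reductions below.\<close>
  define e where "e = c - s"
  have e: "e * (1 + s * y) = y" "c - s * s * y = y" "e * y = 1 - s * y"
    using y \<open>c^2 = s^2 + 1\<close> unfolding e_def by algebra+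
  have "\<kappa> * (- e * (L * p - r * q) + 4 * A * s + 4 * B * (s + L * c)) - 2 * e * p - 8 * B * s
     = s * (4 * \<kappa> * A) + \<kappa> * (- e * (L * p - r * q) + (4 * B) * (s + L * c)) - 2 * e * p - 2 * s * (4 * B)"
    by (simp add: algebra_simps)
  also have "\<dots> = 4 * x * s + \<kappa> * (4 * B) * L * (c - s * s * y) + (\<kappa> - 2) * (4 * B) * s
       - \<kappa> * (e * (1 + s * y)) * (L * p - r * q) - \<kappa> * e * s * y * p - 2 * e * p"
    unfolding A' e_def by (simp add: algebra_simps)
  also have "\<dots> = 8 * x * s - 2 * \<kappa> * x * s - 2 * \<kappa> * L * x * y - 2 * p * e - 2 * p * e * s * y
       + \<kappa> * L * p * y * (e * y) - \<kappa> * y * (L * p - r * q)"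
    unfolding e(1,2) B' e_def[symmetric] by (simp add: algebra_simps)
  also have "\<dots> = 8 * x * s - 2 * \<kappa> * x * s - 2 * \<kappa> * L * x * y - 2 * p * (e * (1 + s * y))
       + \<kappa> * L * p * y * (e * y) - \<kappa> * y * (L * p - r * q)"
    by (simp add: algebra_simps)
  also have "\<dots> = 8 * x * s * (c * y) - 2 * \<kappa> * x * s * (c * y) - 2 * \<kappa> * L * x * y - 2 * p * y
       + \<kappa> * L * p * y * (c * y - s * y) - \<kappa> * y * (L * p - r * q)"
    unfolding e(1) y by (simp add: e(3))
  also have "\<dots> = y * (2 * ((4 - \<kappa>) * (s * c) - \<kappa> * L) * x - 2 * p - \<kappa> * (L * s * y * p - r * q)) + \<kappa> * L * p * y * (c * y - 1)"
    by (simp add: algebra_simps)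
  also have "\<dots> = 0" using x' y by simp
  finally have "\<kappa> * (- (c - s) * (L * p - r * q) + 4 * A * s + 4 * B * (s + L * c)) = 2 * (c - s) * p + 8 * B * s"
    by (simp add: e_def)
  then show ?thesis by (simp add: field_simps)
qed

text \<open>The even computation with cosh and sinh exchanged. The term \<kappa> L changes its sign,
  which is why \<open>Do\<close> carries a plus where \<open>De\<close> carries a minus.\<close>

lemma free_edge_odd:
  fixes c s L \<kappa> p q r x :: real
  assumes "s > 0" "\<kappa> > 0" "c^2 = s^2 + 1"
    and x: "((4 - \<kappa>) * (s * c) + \<kappa> * L) * x = q + \<kappa> / 2 * (L * c / s * q - r * p)"
    and B: "B = ((c - s) * q / (2 * s) - x) / 2"
    and A: "A = x / \<kappa> - B * L * c / s - (c - s) / 4 * ((1 + L) * q - r * p) / s"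
  shows "\<kappa> * (- (c - s) / 4 * (L * q - r * p) + A * c + B * (c + L * s)) = (c - s) * q / 2 + 2 * B * c"
proof -
  define y where "y = 1 / s"
  have y: "s * y = 1" using assms by (simp add: y_def)
  have x': "2 * ((4 - \<kappa>) * (s * c) + \<kappa> * L) * x = 2 * q + \<kappa> * (L * c * y * q - r * p)"
    using x by (simp add: y_def field_simps)
  have B': "4 * B = (c - s) * q * y - 2 * x"
    using assms by (simp add: y_def field_simps)
  have A': "4 * \<kappa> * A = 4 * x - 4 * \<kappa> * B * L * c * y - \<kappa> * (c - s) * ((1 + L) * q - r * p) * y"
    using assms by (simp add: y_def field_simps)
  define e where "e = c - s"
  have e: "e * (1 + c * y) = y" "c * c * y - s = y" "e * y = c * y - 1"
    using y \<open>c^2 = s^2 + 1\<close> unfolding e_def by algebra+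
  have "\<kappa> * (- e * (L * q - r * p) + 4 * A * c + 4 * B * (c + L * s)) - 2 * e * q - 8 * B * c
     = c * (4 * \<kappa> * A) + \<kappa> * (- e * (L * q - r * p) + (4 * B) * (c + L * s)) - 2 * e * q - 2 * c * (4 * B)"
    by (simp add: algebra_simps)
  also have "\<dots> = 4 * x * c - \<kappa> * (4 * B) * L * (c * c * y - s) + (\<kappa> - 2) * (4 * B) * c
       - \<kappa> * (e * (1 + c * y)) * (L * q - r * p) - \<kappa> * e * c * y * q - 2 * e * q"
    unfolding A' e_def by (simp add: algebra_simps)
  also have "\<dots> = 8 * x * c - 2 * \<kappa> * x * c + 2 * \<kappa> * L * x * y - 2 * q * e - 2 * q * e * c * y
       - \<kappa> * L * q * y * (e * y) - \<kappa> * y * (L * q - r * p)"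
    unfolding e(1,2) B' e_def[symmetric] by (simp add: algebra_simps)
  also have "\<dots> = 8 * x * c - 2 * \<kappa> * x * c + 2 * \<kappa> * L * x * y - 2 * q * (e * (1 + c * y))
       - \<kappa> * L * q * y * (e * y) - \<kappa> * y * (L * q - r * p)"
    by (simp add: algebra_simps)
  also have "\<dots> = 8 * x * c * (s * y) - 2 * \<kappa> * x * c * (s * y) + 2 * \<kappa> * L * x * y - 2 * q * y
       - \<kappa> * L * q * y * (c * y - s * y) - \<kappa> * y * (L * q - r * p)"
    unfolding e(1) y by (simp add: e(3))
  also have "\<dots> = y * (2 * ((4 - \<kappa>) * (s * c) + \<kappa> * L) * x - 2 * q - \<kappa> * (L * c * y * q - r * p)) + \<kappa> * L * q * y * (s * y - 1)"
    by (simp add: algebra_simps)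
  also have "\<dots> = 0" using x' y by simp
  finally have "\<kappa> * (- (c - s) * (L * q - r * p) + 4 * A * c + 4 * B * (c + L * s)) = 2 * (c - s) * q + 8 * B * c"
    by (simp add: e_def)
  then show ?thesis by (simp add: field_simps)
qed

text \<open>Prepares the value of F0 + F0'' at the pole, to which the kernel contributes
  \<open>ker0 0 + ker2 0\<close>, that is 0. Eliminating A, B, C, E in favour of x =
  \<open>xe\<close> and z = \<open>xo\<close> leaves an even and an odd summand that can be
  estimated separately.\<close>

lemma diagonal_identity:
  fixes c s L \<kappa> p q r x z :: real
  assumes "c > 0" "s > 0" "\<kappa> > 0" "c^2 = s^2 + 1"
    and B: "B = ((c - s) * p / (2 * c) - x) / 2"
    and A: "A = x / \<kappa> - B * L * s / c - (c - s) / 4 * ((1 + L) * p - r * q) / c"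
    and E: "E = ((c - s) * q / (2 * s) - z) / 2"
    and C: "C = z / \<kappa> - E * L * c / s - (c - s) / 4 * ((1 + L) * q - r * p) / s"
  shows "2 * A * p + B * (2 * p + 2 * r * q) + 2 * C * q + E * (2 * q + 2 * r * p) =
    x / \<kappa> * ((2 - \<kappa>) * p + \<kappa> * (L * s / c * p - r * q)) + z / \<kappa> * ((2 - \<kappa>) * q + \<kappa> * (L * c / s * q - r * p))
     - (p * (L * s / c * p - r * q) + q * (L * c / s * q - r * p)) / (2 * (s * c))"
proof -
  define y where "y = 1 / c"
  define w where "w = 1 / s"
  define k where "k = 1 / \<kappa>"
  have y: "c * y = 1" "s * w = 1" "\<kappa> * k = 1" using assms by (simp_all add: y_def w_def k_def)
  have B': "4 * B = (c - s) * p * y - 2 * x"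
    using assms by (simp add: y_def field_simps)
  have A': "4 * A = 4 * x * k - 4 * B * L * s * y - (c - s) * ((1 + L) * p - r * q) * y"
    using assms by (simp add: y_def k_def field_simps)
  have E': "4 * E = (c - s) * q * w - 2 * z"
    using assms by (simp add: w_def field_simps)
  have C': "4 * C = 4 * z * k - 4 * E * L * c * w - (c - s) * ((1 + L) * q - r * p) * w"
    using assms by (simp add: w_def k_def field_simps)
  define e where "e = c - s"
  have e: "e * (1 + s * y) = y" "e * (1 + c * w) = w"
    using y \<open>c^2 = s^2 + 1\<close> unfolding e_def by algebra+
  \<comment> \<open>Only the cross terms in p q r couple the even and the odd half; their
    coefficients e y and e w merge by e (c + s) = 1.\<close>
  have e3: "e * (y + w) = w * y"
  proof -
    have "e * (y + w) = e * ((c + s) * (w * y))"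
      using y by algebra
    also have "e * (c + s) = 1" unfolding e_def using \<open>c^2 = s^2 + 1\<close> by algebra
    then have "e * ((c + s) * (w * y)) = w * y" by (metis mult.assoc mult_1)
    finally show ?thesis .
  qed
  have p: "4 * A * p + (4 * B) * (p + r * q) = 2 * x * (2 * k * p - p + (L * s * y * p - r * q)) + 2 * e * y * p * r * q - L * p * p * (e * (1 + s * y)) * y"
  proof -
    have "4 * A * p + (4 * B) * (p + r * q) = 4 * x * k * p + (4 * B) * (p + r * q - L * s * y * p) - e * ((1 + L) * p - r * q) * y * p"
      unfolding A' e_def by (simp add: algebra_simps)
    then show ?thesis unfolding B' e_def by (simp add: algebra_simps)
  qed
  have q: "4 * C * q + (4 * E) * (q + r * p) = 2 * z * (2 * k * q - q + (L * c * w * q - r * p)) + 2 * e * w * q * r * p - L * q * q * (e * (1 + c * w)) * w"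
  proof -
    have "4 * C * q + (4 * E) * (q + r * p) = 4 * z * k * q + (4 * E) * (q + r * p - L * c * w * q) - e * ((1 + L) * q - r * p) * w * q"
      unfolding C' e_def by (simp add: algebra_simps)
    then show ?thesis unfolding E' e_def by (simp add: algebra_simps)
  qed
  have half: "2 * X = 2 * Y - Z \<Longrightarrow> X = Y - Z / 2" for X Y Z :: real by simp
  have "2 * (2 * A * p + B * (2 * p + 2 * r * q) + 2 * C * q + E * (2 * q + 2 * r * p)) =
      (4 * A * p + (4 * B) * (p + r * q)) + (4 * C * q + (4 * E) * (q + r * p))"
    by (simp add: algebra_simps)
  also have "\<dots> = 2 * x * (2 * k * p - p + (L * s * y * p - r * q)) + 2 * z * (2 * k * q - q + (L * c * w * q - r * p))
      + 2 * p * q * r * (e * (y + w)) - L * p * p * y * y - L * q * q * w * w"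
    unfolding p q e by (simp add: algebra_simps)
  also have "\<dots> = 2 * (x * (2 * k * p - p + (L * s * y * p - r * q)) + z * (2 * k * q - q + (L * c * w * q - r * p)))
      - (p * (L * s * y * p - r * q) + q * (L * c * w * q - r * p)) * (w * y)"
  proof -
    have "(p * (L * s * y * p - r * q) + q * (L * c * w * q - r * p)) * (w * y)
        = L * p * p * y * y * (s * w) + L * q * q * w * w * (c * y) - 2 * p * q * r * (w * y)"
      by (simp add: algebra_simps)
    then have *: "(p * (L * s * y * p - r * q) + q * (L * c * w * q - r * p)) * (w * y)
        = L * p * p * y * y + L * q * q * w * w - 2 * p * q * r * (w * y)"
      by (simp only: y mult_1_right)
    show ?thesis unfolding e3 * by (simp add: algebra_simps)
  qed
  finally have "2 * A * p + B * (2 * p + 2 * r * q) + 2 * C * q + E * (2 * q + 2 * r * p) =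
      x * (2 * k * p - p + (L * s * y * p - r * q)) + z * (2 * k * q - q + (L * c * w * q - r * p))
      - (p * (L * s * y * p - r * q) + q * (L * c * w * q - r * p)) * (w * y) / 2"
    by (rule half)
  also have "x * (2 * k * p - p + (L * s * y * p - r * q)) = x / \<kappa> * ((2 - \<kappa>) * p + \<kappa> * (L * s / c * p - r * q))"
    using assms(3) by (simp add: k_def y_def field_simps)
  also have "z * (2 * k * q - q + (L * c * w * q - r * p)) = z / \<kappa> * ((2 - \<kappa>) * q + \<kappa> * (L * c / s * q - r * p))"
    using assms(3) by (simp add: k_def w_def field_simps)
  also have "(p * (L * s * y * p - r * q) + q * (L * c * w * q - r * p)) * (w * y) / 2
      = (p * (L * s / c * p - r * q) + q * (L * c / s * q - r * p)) / (2 * (s * c))"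
    by (simp add: y_def w_def)
  finally show ?thesis .
qed

section \<open>The beam with free ends at frequency one\<close>

locale beam =
  fixes L \<kappa> r :: real
  assumes L: "L > 0" and \<kappa>: "\<kappa> > 0" "\<kappa> \<le> 1" and r: "- L \<le> r" "r \<le> L"
begin

text \<open>\<open>F0\<close> is the Green function for \<open>m = 1\<close> on \<open>[-L, L]\<close> with pole \<open>r\<close>, and \<open>\<kappa> = 1 - \<sigma>\<close>. Put
  \<open>v = F0 - F0''\<close>, so that \<open>- v'' + v = \<delta>\<close>. The constants are chosen such that
  \<open>v = \<kappa> F0 = cosh s xe + sinh s xo\<close> at \<open>s = \<plusminus> L\<close>, which gives the first boundary condition;
  the second one, \<open>v' = - \<kappa> F0'\<close>, then fixes \<open>xe\<close> and \<open>xo\<close>, with \<open>De\<close> and \<open>Do\<close> as the coefficients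
  for the even and the odd part.\<close>

definition S where "S = sinh L * cosh L"
definition De where "De = (4 - \<kappa>) * S - \<kappa> * L"
definition Do where "Do = (4 - \<kappa>) * S + \<kappa> * L"
definition \<epsilon> where "\<epsilon> = L * sinh L / cosh L * cosh r - r * sinh r"
definition \<omega> where "\<omega> = L * cosh L / sinh L * sinh r - r * cosh r"
definition xe where "xe = (cosh r + \<kappa> / 2 * \<epsilon>) / De"
definition xo where "xo = (sinh r + \<kappa> / 2 * \<omega>) / Do"
definition cB where "cB = ((cosh L - sinh L) * cosh r / (2 * cosh L) - xe) / 2"
definition cE where "cE = ((cosh L - sinh L) * sinh r / (2 * sinh L) - xo) / 2"
definition cA where
  "cA = xe / \<kappa> - cB * L * sinh L / cosh L - (cosh L - sinh L) / 4 * ((1 + L) * cosh r - r * sinh r) / cosh L"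
definition cC where
  "cC = xo / \<kappa> - cE * L * cosh L / sinh L - (cosh L - sinh L) / 4 * ((1 + L) * sinh r - r * cosh r) / sinh L"

definition F0 where
  "F0 s = ker0 (s - r) + (cA * cosh s + cB * (s * sinh s) + cC * sinh s + cE * (s * cosh s))"
definition F1 where
  "F1 s = ker1 (s - r) + (cA * sinh s + cB * (sinh s + s * cosh s) + cC * cosh s + cE * (cosh s + s * sinh s))"
definition F2 where
  "F2 s = ker2 (s - r) + (cA * cosh s + cB * (2 * cosh s + s * sinh s) + cC * sinh s + cE * (2 * sinh s + s * cosh s))"
definition F3 where
  "F3 s = ker3 (s - r) + (cA * sinh s + cB * (3 * sinh s + s * cosh s) + cC * cosh s + cE * (3 * cosh s + s * sinh s))"

lemma ker_shift:
  "(f has_real_derivative D) (at (s - r)) \<Longrightarrow> ((\<lambda>s. f (s - r)) has_real_derivative D) (at s)"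
  by (rule DERIV_cong[OF DERIV_chain2[where g = "\<lambda>s. s - r"]]) (auto intro!: derivative_eq_intros)

lemma F0_deriv: "(F0 has_real_derivative F1 s) (at s)"
  unfolding F0_def F1_def
  by (rule DERIV_add[OF ker_shift[OF ker0_deriv]]) (auto intro!: derivative_eq_intros simp: algebra_simps)

lemma F1_deriv: "(F1 has_real_derivative F2 s) (at s)"
  unfolding F1_def F2_def
  by (rule DERIV_add[OF ker_shift[OF ker1_deriv]]) (auto intro!: derivative_eq_intros simp: algebra_simps)

lemma F2_deriv:
  assumes "s \<noteq> r" shows "(F2 has_real_derivative F3 s + (if s > r then 1 else 0)) (at s)"
proof -
  have "(F2 has_real_derivative (ker3 (s - r) + (if s - r > 0 then 1 else 0)) + (cA * sinh s + cB * (3 * sinh s + s * cosh s) + cC * cosh s + cE * (3 * cosh s + s * sinh s))) (at s)"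
    unfolding F2_def
    by (rule DERIV_add[OF ker_shift[OF ker2_deriv]]) (use assms in \<open>auto intro!: derivative_eq_intros simp: algebra_simps\<close>)
  then show ?thesis by (rule DERIV_cong) (simp add: F3_def)
qed

lemma F3_deriv:
  assumes "s \<noteq> r" shows "(F3 has_real_derivative 2 * F2 s - F0 s) (at s)"
proof -
  have "(F3 has_real_derivative (2 * ker2 (s - r) - ker0 (s - r)) + (cA * cosh s + cB * (4 * cosh s + s * sinh s) + cC * sinh s + cE * (4 * sinh s + s * cosh s))) (at s)"
    unfolding F3_def
    by (rule DERIV_add[OF ker_shift[OF ker3_deriv]]) (use assms in \<open>auto intro!: derivative_eq_intros simp: algebra_simps\<close>)
  then show ?thesis by (rule DERIV_cong) (simp add: F2_def F0_def algebra_simps)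
qed

lemma F2_continuous: "continuous_on A F2"
  unfolding F2_def by (intro continuous_intros continuous_on_compose2[OF continuous_ker2[of UNIV]]) auto

lemma F3_continuous: "continuous_on A F3"
  unfolding F3_def by (intro continuous_intros continuous_on_compose2[OF continuous_ker3[of UNIV]]) auto

lemma F0_continuous: "continuous_on A F0"
  by (meson DERIV_isCont F0_deriv continuous_at_imp_continuous_on)

lemma F1_continuous: "continuous_on A F1"
  by (meson DERIV_isCont F1_deriv continuous_at_imp_continuous_on)

lemma shL: "sinh L > 0" and chL: "cosh L > 0" and pyth: "(cosh L)^2 = (sinh L)^2 + 1"
  using L by (auto simp: cosh_square_eq)

lemma expL: "exp (- L) = cosh L - sinh L"
  by (simp add: cosh_minus_sinh)

lemma exp_right: "exp (- (L - r)) = (cosh L - sinh L) * (cosh r + sinh r)"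
proof -
  have "exp (- (L - r)) = exp (- L) * exp r" by (simp add: exp_diff exp_minus field_simps)
  then show ?thesis by (simp add: expL cosh_plus_sinh)
qed

lemma exp_left: "exp (- (L + r)) = (cosh L - sinh L) * (cosh r - sinh r)"
proof -
  have "exp (- (L + r)) = exp (- L) * exp (- r)" by (simp add: exp_add[symmetric])
  then show ?thesis by (simp only: expL cosh_minus_sinh[of r])
qed

lemma abs_left: "\<bar>- L - r\<bar> = L + r"
  using r by simp

lemma S_ge: "S \<ge> L"
proof -
  have "L \<le> sinh L" using real_le_x_sinh[of L] L by (simp add: sinh_field_def exp_minus)
  also have "\<dots> \<le> sinh L * cosh L" using shL cosh_real_ge_1[of L] by simp
  finally show ?thesis by (simp add: S_def)
qed

lemma De_ge: "De \<ge> 2 * S"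
proof -
  have "\<kappa> * L \<le> 1 * S" using S_ge \<kappa> L by (intro mult_mono) auto
  moreover have "\<kappa> * S \<le> 1 * S" using S_ge L \<kappa> by (intro mult_right_mono) auto
  ultimately show ?thesis by (simp add: De_def left_diff_distrib)
qed

lemma S_pos: "S > 0" and De_pos: "De > 0" and Do_pos: "Do > 0" and De_le_Do: "De \<le> Do"
proof -
  have "\<kappa> * L > 0" using L \<kappa> by simp
  then show "De \<le> Do" by (simp add: Do_def De_def)
  show "S > 0" using S_ge L by simp
  then show "De > 0" using De_ge by simp
  then show "Do > 0" using \<open>De \<le> Do\<close> by simp
qed

lemma xe_eq: "((4 - \<kappa>) * (sinh L * cosh L) - \<kappa> * L) * xe = cosh r + \<kappa> / 2 * (L * sinh L / cosh L * cosh r - r * sinh r)"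
  using De_pos by (simp add: xe_def De_def S_def \<epsilon>_def)

lemma xo_eq: "((4 - \<kappa>) * (sinh L * cosh L) + \<kappa> * L) * xo = sinh r + \<kappa> / 2 * (L * cosh L / sinh L * sinh r - r * cosh r)"
  using Do_pos by (simp add: xo_def Do_def S_def \<omega>_def)

lemmas even_identity = free_edge_even[OF chL \<kappa>(1) pyth xe_eq cB_def cA_def]
lemmas odd_identity = free_edge_odd[OF shL \<kappa>(1) pyth xo_eq cE_def cC_def]

text \<open>The solution of - w'' + w = 0 with the end values of v. The remainder v -
  \<open>edge\<close> is the Green function of - w'' + w with zero end values, as
  \<open>v_eq_right\<close> and \<open>v_eq_left\<close> show, where 2 S = sinh(2 L).\<close>

definition edge where "edge s = cosh s * xe + sinh s * xo"

lemma cA_mult: "cA * cosh L = xe * cosh L / \<kappa> - cB * L * sinh L - (cosh L - sinh L) / 4 * ((1 + L) * cosh r - r * sinh r)"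
  using chL by (simp add: cA_def field_simps)
lemma cC_mult: "cC * sinh L = xo * sinh L / \<kappa> - cE * L * cosh L - (cosh L - sinh L) / 4 * ((1 + L) * sinh r - r * cosh r)"
  using shL by (simp add: cC_def field_simps)
lemma cB_mult: "2 * (cB * cosh L) = (cosh L - sinh L) * cosh r / 2 - xe * cosh L"
  using chL by (simp add: cB_def field_simps)
lemma cE_mult: "2 * (cE * sinh L) = (cosh L - sinh L) * sinh r / 2 - xo * sinh L"
  using shL by (simp add: cE_def field_simps)

lemma F0_right: "F0 L = edge L / \<kappa>"
proof -
  have "ker0 (L - r) = (1 + (L - r)) * ((cosh L - sinh L) * (cosh r + sinh r)) / 4"
    using r exp_right by (simp add: ker0_def)
  moreover have "F0 L = ker0 (L - r) + (cA * cosh L + cB * L * sinh L + cC * sinh L + cE * L * cosh L)"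
    by (simp add: F0_def)
  ultimately show ?thesis
    unfolding cA_mult cC_mult edge_def by (simp add: algebra_simps add_divide_distrib diff_divide_distrib)
qed

lemma F0_left: "F0 (- L) = edge (- L) / \<kappa>"
proof -
  have "ker0 (- L - r) = (1 + (L + r)) * ((cosh L - sinh L) * (cosh r - sinh r)) / 4"
    using r by (simp only: ker0_def abs_left exp_left)
  moreover have "F0 (- L) = ker0 (- L - r) + (cA * cosh L + cB * L * sinh L - cC * sinh L - cE * L * cosh L)"
    by (simp add: F0_def)
  ultimately show ?thesis
    unfolding cA_mult cC_mult edge_def by (simp add: algebra_simps add_divide_distrib diff_divide_distrib)
qed

definition v where "v s = F0 s - F2 s"

lemma v_eq: "v s = exp (- \<bar>s - r\<bar>) / 2 - 2 * (cB * cosh s) - 2 * (cE * sinh s)"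
  by (simp add: v_def F0_def F2_def ker0_def ker2_def algebra_simps add_divide_distrib diff_divide_distrib)

lemma v_right: "v L = edge L"
proof -
  have "exp (- \<bar>L - r\<bar>) = (cosh L - sinh L) * (cosh r + sinh r)" using r exp_right by simp
  then show ?thesis unfolding v_eq cB_mult cE_mult edge_def by (simp add: algebra_simps add_divide_distrib diff_divide_distrib)
qed

lemma v_left: "v (- L) = edge (- L)"
proof -
  have "exp (- \<bar>- L - r\<bar>) = (cosh L - sinh L) * (cosh r - sinh r)" by (simp only: abs_left exp_left)
  then show ?thesis unfolding v_eq edge_def using cB_mult cE_mult by (simp add: algebra_simps add_divide_distrib diff_divide_distrib)
qed

lemma bending_moment: "F2 L = (1 - \<kappa>) * F0 L" "F2 (- L) = (1 - \<kappa>) * F0 (- L)"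
proof -
  have "F0 L - F2 L = \<kappa> * F0 L" "F0 (- L) - F2 (- L) = \<kappa> * F0 (- L)"
    using v_right v_left F0_right F0_left \<kappa> by (simp_all add: v_def)
  then show "F2 L = (1 - \<kappa>) * F0 L" "F2 (- L) = (1 - \<kappa>) * F0 (- L)" by (simp_all add: left_diff_distrib)
qed

text \<open>The summand 1 restores the jump that was removed from \<open>ker3\<close>: L counts as
  lying to the right of the pole, and - L as lying to the left. With this convention the edge
  conditions keep their form when the pole itself sits on an end point.\<close>

lemma shear_right: "F3 L + 1 = (1 + \<kappa>) * F1 L"
proof -
  have k: "ker1 (L - r) = - (L - r) * ((cosh L - sinh L) * (cosh r + sinh r)) / 4"
    "ker3 (L - r) + 1 = (2 - (L - r)) * ((cosh L - sinh L) * (cosh r + sinh r)) / 4"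
    using r exp_right by (auto simp: ker1_def ker3_def)
  have dist: "a = X + Y \<Longrightarrow> \<kappa> * X = X' \<Longrightarrow> \<kappa> * Y = Y' \<Longrightarrow> \<kappa> * a = X' + Y'" for a X Y X' Y'
    by (simp add: distrib_left)
  have "F1 L = (- (cosh L - sinh L) / 4 * (L * cosh r - r * sinh r) + cA * sinh L + cB * (sinh L + L * cosh L))
     + (- (cosh L - sinh L) / 4 * (L * sinh r - r * cosh r) + cC * cosh L + cE * (cosh L + L * sinh L))"
    unfolding F1_def k by (simp add: algebra_simps add_divide_distrib diff_divide_distrib)
  then have "\<kappa> * F1 L = ((cosh L - sinh L) * cosh r / 2 + 2 * cB * sinh L) + ((cosh L - sinh L) * sinh r / 2 + 2 * cE * cosh L)"
    by (rule dist[OF _ even_identity odd_identity])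
  moreover have "F3 L + 1 - F1 L = (ker3 (L - r) + 1) - ker1 (L - r) + 2 * cB * sinh L + 2 * cE * cosh L"
    unfolding F1_def F3_def by (simp add: algebra_simps)
  moreover have "(ker3 (L - r) + 1) - ker1 (L - r) = (cosh L - sinh L) * cosh r / 2 + (cosh L - sinh L) * sinh r / 2"
    unfolding k by (simp add: algebra_simps add_divide_distrib diff_divide_distrib)
  ultimately show ?thesis by (simp add: algebra_simps)
qed

lemma shear_left: "F3 (- L) = (1 + \<kappa>) * F1 (- L)"
proof -
  have e: "exp (- L - r) = (cosh L - sinh L) * (cosh r - sinh r)" using exp_left by simp
  have k: "ker1 (- L - r) = (L + r) * ((cosh L - sinh L) * (cosh r - sinh r)) / 4"
    "ker3 (- L - r) = - ((2 - (L + r)) * ((cosh L - sinh L) * (cosh r - sinh r)) / 4)"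
    using r e by (auto simp: ker1_def ker3_def abs_left exp_left)
  have dist: "a = - X + Y \<Longrightarrow> \<kappa> * X = X' \<Longrightarrow> \<kappa> * Y = Y' \<Longrightarrow> \<kappa> * a = - X' + Y'" for a X Y X' Y'
    by (simp add: right_diff_distrib)
  have "F1 (- L) = - (- (cosh L - sinh L) / 4 * (L * cosh r - r * sinh r) + cA * sinh L + cB * (sinh L + L * cosh L))
     + (- (cosh L - sinh L) / 4 * (L * sinh r - r * cosh r) + cC * cosh L + cE * (cosh L + L * sinh L))"
    unfolding F1_def k by (simp add: algebra_simps add_divide_distrib diff_divide_distrib)
  then have "\<kappa> * F1 (- L) = - ((cosh L - sinh L) * cosh r / 2 + 2 * cB * sinh L) + ((cosh L - sinh L) * sinh r / 2 + 2 * cE * cosh L)"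
    by (rule dist[OF _ even_identity odd_identity])
  moreover have "F3 (- L) - F1 (- L) = ker3 (- L - r) - ker1 (- L - r) - 2 * cB * sinh L + 2 * cE * cosh L"
    unfolding F1_def F3_def by (simp add: algebra_simps)
  moreover have "ker3 (- L - r) - ker1 (- L - r) = - ((cosh L - sinh L) * cosh r / 2) + (cosh L - sinh L) * sinh r / 2"
    unfolding k by (simp add: algebra_simps add_divide_distrib diff_divide_distrib)
  ultimately show ?thesis by (simp add: algebra_simps)
qed

section \<open>Signs and bounds at frequency one\<close>

definition P where "P = cosh (L + r) + \<kappa> / 2 * ((L - r) * sinh (L + r))"
definition Q where "Q = cosh (L - r) + \<kappa> / 2 * ((L + r) * sinh (L - r))"

lemma P_pos: "P > 0" and Q_pos: "Q > 0"
  unfolding P_def Q_def using r \<kappa> by (auto intro!: add_pos_nonneg mult_nonneg_nonneg)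

text \<open>P and Q are exchanged by r \<mapsto> - r and are sums of nonnegative terms.
  \<open>xe\<close> and \<open>xo\<close> are, up to positive factors, their even and odd
  combination, so that the end values of \<open>edge\<close> become combinations of positive
  quantities.\<close>

lemma cxe: "cosh L * xe = (P + Q) / (2 * De)"
proof -
  have "2 * (cosh L * (cosh r + \<kappa> / 2 * \<epsilon>)) = P + Q"
    using chL by (simp add: P_def Q_def \<epsilon>_def sinh_add sinh_diff cosh_add cosh_diff field_simps)
  then show ?thesis using De_pos by (simp add: xe_def field_simps)
qed

lemma sxo: "sinh L * xo = (P - Q) / (2 * Do)"
proof -
  have "2 * (sinh L * (sinh r + \<kappa> / 2 * \<omega>)) = P - Q"
    using shL by (simp add: P_def Q_def \<omega>_def sinh_add sinh_diff cosh_add cosh_diff field_simps)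
  then show ?thesis using Do_pos by (simp add: xo_def field_simps)
qed

text \<open>The odd part, which enters the two ends with opposite signs, is divided by the larger
  number \<open>Do\<close>. The weights 1/De + 1/Do and 1/De - 1/Do of P and Q are therefore
  nonnegative, the first one strictly positive.\<close>

lemma edge_right: "edge L > 0" and edge_left: "edge (- L) > 0"
proof -
  have D: "1 / Do \<le> 1 / De" "1 / Do > 0" using De_le_Do De_pos Do_pos by (auto intro: divide_left_mono)
  have "2 * edge L = P * (1 / De + 1 / Do) + Q * (1 / De - 1 / Do)"
    unfolding edge_def cxe sxo by (simp add: algebra_simps add_divide_distrib diff_divide_distrib)
  also have "\<dots> > 0" using D P_pos Q_pos De_pos by (intro add_pos_nonneg mult_pos_pos mult_nonneg_nonneg) auto
  finally show "edge L > 0" by simp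
  have "2 * edge (- L) = Q * (1 / De + 1 / Do) + P * (1 / De - 1 / Do)"
    unfolding edge_def using cxe sxo by (simp add: algebra_simps add_divide_distrib diff_divide_distrib)
  also have "\<dots> > 0" using D P_pos Q_pos De_pos by (intro add_pos_nonneg mult_pos_pos mult_nonneg_nonneg) auto
  finally show "edge (- L) > 0" by simp
qed

lemma edge_interp: "edge s * (2 * S) = edge (- L) * sinh (L - s) + edge L * sinh (L + s)"
  by (simp add: edge_def S_def sinh_add sinh_diff algebra_simps)

lemma edge_pos:
  assumes "- L \<le> s" "s \<le> L" shows "edge s > 0"
proof -
  have "edge s * (2 * S) > 0"
  proof (cases "s < L")
    case True
    then show ?thesis unfolding edge_interp using assms edge_right edge_left
      by (intro add_pos_nonneg mult_pos_pos mult_nonneg_nonneg) auto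
  next
    case False
    then show ?thesis unfolding edge_interp using assms edge_right edge_left L
      by (intro add_nonneg_pos mult_pos_pos mult_nonneg_nonneg) auto
  qed
  then show ?thesis using S_pos by (simp add: zero_less_mult_iff)
qed

text \<open>When \<open>edge\<close> is interpolated between its end values, both weights are at
  most 1; in the sum of the two end values the odd parts cancel.\<close>

lemma edge_le:
  assumes "- L \<le> s" "s \<le> L" shows "edge s \<le> 2 * (cosh L * xe)"
proof -
  have S2: "2 * S = sinh (2 * L)" by (simp add: S_def sinh_double)
  have "edge s * (2 * S) \<le> edge (- L) * (2 * S) + edge L * (2 * S)"
    unfolding edge_interp unfolding S2 using assms edge_right edge_left by (intro add_mono mult_left_mono) auto
  then have "edge s \<le> edge (- L) + edge L" using S_pos by (simp flip: distrib_right)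
  then show ?thesis by (simp add: edge_def)
qed

lemma v_eq_right:
  assumes "r \<le> s" shows "v s = sinh (L - s) * sinh (L + r) / (2 * S) + edge s"
proof -
  have "exp (- \<bar>s - r\<bar>) = exp (- s) * exp r" using assms by (simp add: exp_diff exp_minus field_simps)
  then have e: "exp (- \<bar>s - r\<bar>) = (cosh s - sinh s) * (cosh r + sinh r)"
    by (simp only: cosh_minus_sinh cosh_plus_sinh)
  show ?thesis
    unfolding v_eq e edge_def cB_def cE_def S_def sinh_add sinh_diff using shL chL by (simp add: field_simps)
qed

lemma v_eq_left:
  assumes "s \<le> r" shows "v s = sinh (L - r) * sinh (L + s) / (2 * S) + edge s"
proof -
  have "exp (- \<bar>s - r\<bar>) = exp s * exp (- r)" using assms by (simp add: exp_diff exp_minus field_simps)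
  then have e: "exp (- \<bar>s - r\<bar>) = (cosh s + sinh s) * (cosh r - sinh r)"
    by (simp only: cosh_minus_sinh cosh_plus_sinh)
  show ?thesis
    unfolding v_eq e edge_def cB_def cE_def S_def sinh_add sinh_diff using shL chL by (simp add: field_simps)
qed

lemma v_ge:
  assumes "- L \<le> s" "s \<le> L" shows "v s \<ge> edge s"
proof (cases "r \<le> s")
  case True
  then show ?thesis unfolding v_eq_right[OF True] using assms r S_pos by (auto intro!: divide_nonneg_pos mult_nonneg_nonneg)
next
  case False
  then have "s \<le> r" by simp
  then show ?thesis unfolding v_eq_left[OF \<open>s \<le> r\<close>] using assms r S_pos by (auto intro!: divide_nonneg_pos mult_nonneg_nonneg)
qed

lemma v_pos: "- L \<le> s \<Longrightarrow> s \<le> L \<Longrightarrow> v s > 0"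
  using v_ge edge_pos by fastforce

lemma sinh_mult_le:
  assumes "0 \<le> x" "0 \<le> y" "x + y \<le> 2 * L" shows "sinh x * sinh y / (2 * S) \<le> 1 / 2"
proof -
  have "2 * (sinh x * sinh y) \<le> sinh x * cosh y + cosh x * sinh y"
    using assms mult_left_mono[OF sinh_le_cosh_real[of y], of "sinh x"] mult_right_mono[OF sinh_le_cosh_real[of x], of "sinh y"] by simp
  also have "\<dots> = sinh (x + y)" by (simp add: sinh_add)
  also have "\<dots> \<le> sinh (2 * L)" using assms by simp
  also have "\<dots> = 2 * S" by (simp add: S_def sinh_double)
  finally show ?thesis using S_pos by (simp add: field_simps)
qed

lemma v_le:
  assumes "- L \<le> s" "s \<le> L" shows "v s \<le> 1 / 2 + 2 * (cosh L * xe)"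
proof (cases "r \<le> s")
  case True
  then show ?thesis unfolding v_eq_right[OF True] using assms r
    by (intro add_mono sinh_mult_le edge_le) auto
next
  case False
  then have "s \<le> r" by simp
  then show ?thesis unfolding v_eq_left[OF \<open>s \<le> r\<close>] using assms r
    by (intro add_mono sinh_mult_le edge_le) auto
qed

text \<open>Away from the pole \<open>- H'' + H = 2 v > 0\<close>, so positivity of \<open>H\<close> reduces to the end points and the pole.\<close>

definition H where "H s = F0 s + F2 s"

lemma \<epsilon>_nonneg: "\<epsilon> \<ge> 0"
proof -
  have "2 * (cosh L * \<epsilon>) = (L - r) * sinh (L + r) + (L + r) * sinh (L - r)"
    using chL by (simp add: \<epsilon>_def sinh_add sinh_diff field_simps)
  moreover have "(L - r) * sinh (L + r) \<ge> 0" "(L + r) * sinh (L - r) \<ge> 0"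
    using r by (simp_all add: zero_le_mult_iff)
  ultimately have "0 \<le> 2 * (cosh L * \<epsilon>)" by linarith
  then show ?thesis using chL by (simp add: zero_le_mult_iff)
qed

text \<open>\<open>De\<close> is smaller than (4 - \<kappa>) S, which is the favourable direction
  because \<epsilon> \<ge> 0. The cross term of the product, with coefficient \<kappa> (4 -
  \<kappa>) / 2, then matches the right-hand side exactly, and (2 - \<kappa>) p^2 > 0 gives
  strictness.\<close>

lemma even_part: "xe / \<kappa> * ((2 - \<kappa>) * cosh r + \<kappa> * \<epsilon>) > cosh r * \<epsilon> / (2 * S)"
proof -
  define p where "p = cosh r"
  have p: "p > 0" by (simp add: p_def)
  have "cosh r * \<epsilon> / (2 * S) = p * \<epsilon> * (4 - \<kappa>) / (2 * ((4 - \<kappa>) * S))"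
    using \<kappa> S_pos by (simp add: p_def field_simps)
  also have "\<dots> \<le> p * \<epsilon> * (4 - \<kappa>) / (2 * De)"
    using \<epsilon>_nonneg p \<kappa> De_pos S_pos L by (intro divide_left_mono mult_nonneg_nonneg mult_pos_pos) (auto simp: De_def)
  also have "\<dots> < (p + \<kappa> / 2 * \<epsilon>) * ((2 - \<kappa>) * p + \<kappa> * \<epsilon>) / (\<kappa> * De)"
  proof -
    have "(p + \<kappa> / 2 * \<epsilon>) * ((2 - \<kappa>) * p + \<kappa> * \<epsilon>) = (2 - \<kappa>) * p^2 + \<kappa> * (4 - \<kappa>) / 2 * (p * \<epsilon>) + \<kappa>^2 * \<epsilon>^2 / 2"
      by (simp add: field_simps power2_eq_square)
    also have "\<dots> > \<kappa> * (4 - \<kappa>) / 2 * (p * \<epsilon>)"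
      using p \<kappa> by (simp add: add_pos_nonneg)
    finally have "\<kappa> * (4 - \<kappa>) / 2 * (p * \<epsilon>) / (\<kappa> * De) < (p + \<kappa> / 2 * \<epsilon>) * ((2 - \<kappa>) * p + \<kappa> * \<epsilon>) / (\<kappa> * De)"
      using \<kappa> De_pos by (intro divide_strict_right_mono) auto
    moreover have "\<kappa> * (4 - \<kappa>) / 2 * (p * \<epsilon>) / (\<kappa> * De) = p * \<epsilon> * (4 - \<kappa>) / (2 * De)"
      using \<kappa> De_pos by (simp add: field_simps)
    ultimately show ?thesis by simp
  qed
  also have "\<dots> = xe / \<kappa> * ((2 - \<kappa>) * p + \<kappa> * \<epsilon>)" by (simp add: xe_def p_def)
  finally show ?thesis by (simp add: p_def)
qed

text \<open>Here \<open>Do\<close> exceeds (4 - \<kappa>) S. After the cross terms cancel,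
  \<kappa>^2 L q \<omega> has to be absorbed by S (2 (2 - \<kappa>) q^2 + \<kappa>^2 \<omega>^2);
  this follows from \<kappa> \<le> 1, the arithmetic-geometric mean inequality and L \<le>
  S.\<close>

lemma odd_part: "xo / \<kappa> * ((2 - \<kappa>) * sinh r + \<kappa> * \<omega>) \<ge> sinh r * \<omega> / (2 * S)"
proof -
  define q where "q = sinh r"
  have "L * (\<kappa>\<^sup>2 * (q * \<omega>)) \<le> L * (2 * q\<^sup>2 + \<kappa>\<^sup>2 * \<omega>\<^sup>2)"
  proof (rule mult_left_mono)
    have "\<kappa>\<^sup>2 * (q * \<omega>) \<le> \<bar>\<kappa> * (q * (\<kappa> * \<omega>))\<bar>" by (simp add: power2_eq_square mult_ac)
    also have "\<dots> \<le> 1 * \<bar>q * (\<kappa> * \<omega>)\<bar>" unfolding abs_mult[of \<kappa>] using \<kappa> by (intro mult_right_mono) auto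
    also have "\<dots> \<le> q\<^sup>2 + (\<kappa> * \<omega>)\<^sup>2"
    proof -
      have "0 \<le> (\<bar>q\<bar> - \<bar>\<kappa> * \<omega>\<bar>)\<^sup>2" by simp
      then have "2 * \<bar>q * (\<kappa> * \<omega>)\<bar> \<le> q\<^sup>2 + (\<kappa> * \<omega>)\<^sup>2" by (simp add: power2_diff abs_mult power_mult_distrib mult_ac)
      then show ?thesis by simp
    qed
    finally have "\<kappa>\<^sup>2 * (q * \<omega>) \<le> q\<^sup>2 + \<kappa>\<^sup>2 * \<omega>\<^sup>2" by (simp add: power_mult_distrib)
    then show "\<kappa>\<^sup>2 * (q * \<omega>) \<le> 2 * q\<^sup>2 + \<kappa>\<^sup>2 * \<omega>\<^sup>2" using zero_le_power2[of q] by linarith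
  qed (use L in simp)
  also have "\<dots> \<le> S * (2 * (2 - \<kappa>) * q\<^sup>2 + \<kappa>\<^sup>2 * \<omega>\<^sup>2)"
  proof (rule mult_mono)
    have "2 * q\<^sup>2 \<le> 2 * (2 - \<kappa>) * q\<^sup>2" using \<kappa> by (intro mult_right_mono) auto
    then show "2 * q\<^sup>2 + \<kappa>\<^sup>2 * \<omega>\<^sup>2 \<le> 2 * (2 - \<kappa>) * q\<^sup>2 + \<kappa>\<^sup>2 * \<omega>\<^sup>2" by simp
  qed (use S_ge S_pos in auto)
  finally have *: "\<kappa> * (q * \<omega>) * Do \<le> 2 * S * ((q + \<kappa> / 2 * \<omega>) * ((2 - \<kappa>) * q + \<kappa> * \<omega>))"
    by (simp add: Do_def algebra_simps power2_eq_square)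
  have "q * \<omega> / (2 * S) = \<kappa> * (q * \<omega>) * Do / (2 * S * (\<kappa> * Do))"
    using \<kappa> Do_pos by simp
  also have "\<dots> \<le> 2 * S * ((q + \<kappa> / 2 * \<omega>) * ((2 - \<kappa>) * q + \<kappa> * \<omega>)) / (2 * S * (\<kappa> * Do))"
    using * S_pos Do_pos \<kappa> by (intro divide_right_mono) auto
  also have "\<dots> = xo / \<kappa> * ((2 - \<kappa>) * q + \<kappa> * \<omega>)"
    using S_pos by (simp add: xo_def q_def)
  finally show ?thesis by (simp add: q_def)
qed

lemma H_diag: "H r > 0"
proof -
  have "H r = 2 * cA * cosh r + cB * (2 * cosh r + 2 * r * sinh r) + 2 * cC * sinh r + cE * (2 * sinh r + 2 * r * cosh r)"
    by (simp add: H_def F0_def F2_def ker0_def ker2_def algebra_simps)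
  also have "\<dots> = xe / \<kappa> * ((2 - \<kappa>) * cosh r + \<kappa> * \<epsilon>) + xo / \<kappa> * ((2 - \<kappa>) * sinh r + \<kappa> * \<omega>)
     - (cosh r * \<epsilon> + sinh r * \<omega>) / (2 * S)"
    unfolding diagonal_identity[OF chL shL \<kappa>(1) pyth cB_def cA_def cE_def cC_def] \<epsilon>_def \<omega>_def S_def ..
  also have "\<dots> > 0" using even_part odd_part by (simp add: add_divide_distrib)
  finally show ?thesis .
qed

lemma H_ends: "H L > 0" "H (- L) > 0"
proof -
  have "H L = (2 - \<kappa>) * F0 L" "H (- L) = (2 - \<kappa>) * F0 (- L)"
    using bending_moment by (simp_all add: H_def algebra_simps)
  then show "H L > 0" "H (- L) > 0"
    using \<kappa> edge_right edge_left F0_right F0_left by auto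
qed

lemma H_pos:
  assumes s: "- L \<le> s" "s \<le> L" shows "H s > 0"
proof -
  have c: "continuous_on A H" for A unfolding H_def by (intro continuous_intros F0_continuous F2_continuous)
  have "0 < H s" if "s \<in> {r..L}"
  proof (rule minimum_principle[OF r(2) c H_diag H_ends(1) _ _ _ that])
    fix x assume x: "r < x" "x < L"
    show "(H has_real_derivative F1 x + (F3 x + 1)) (at x)"
      unfolding H_def using x by (intro DERIV_add F0_deriv) (rule DERIV_cong[OF F2_deriv], auto)
    show "((\<lambda>x. F1 x + (F3 x + 1)) has_real_derivative F2 x + (2 * F2 x - F0 x + 0)) (at x)"
      using x by (intro DERIV_add F1_deriv F3_deriv DERIV_const) auto
    \<comment> \<open>The expression is H - 2 v, negative wherever H \<le> 0 because v > 0.\<close>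
    show "F2 x + (2 * F2 x - F0 x + 0) < 0" if "H x \<le> 0"
      using v_pos[of x] x r that by (simp add: H_def v_def)
  qed
  moreover have "0 < H s" if "s \<in> {-L..r}"
  proof (rule minimum_principle[OF r(1) c H_ends(2) H_diag _ _ _ that])
    fix x assume x: "- L < x" "x < r"
    show "(H has_real_derivative F1 x + F3 x) (at x)"
      unfolding H_def using x by (intro DERIV_add F0_deriv) (rule DERIV_cong[OF F2_deriv], auto)
    show "((\<lambda>x. F1 x + F3 x) has_real_derivative F2 x + (2 * F2 x - F0 x)) (at x)"
      using x by (intro DERIV_add F1_deriv F3_deriv) auto
    show "F2 x + (2 * F2 x - F0 x) < 0" if "H x \<le> 0"
      using v_pos[of x] x r that by (simp add: H_def v_def)
  qed
  ultimately show ?thesis using s by force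
qed

lemma abs_F2_less:
  assumes "- L \<le> s" "s \<le> L" shows "\<bar>F2 s\<bar> < F0 s"
  using H_pos[OF assms] v_pos[OF assms] by (auto simp: H_def v_def)

lemma sinh_mult_arg_le: "0 \<le> x \<Longrightarrow> 0 \<le> y \<Longrightarrow> x * sinh y \<le> sinh (x + y)" for x y :: real
proof -
  assume a: "0 \<le> x" "0 \<le> y"
  have "x \<le> sinh x" using real_le_x_sinh[of x] a by (simp add: sinh_field_def exp_minus)
  then have "x * sinh y \<le> sinh x * cosh y" using a by (intro mult_mono sinh_le_cosh_real) auto
  also have "\<dots> \<le> sinh (x + y)" using a by (simp add: sinh_add)
  finally show ?thesis .
qed

text \<open>P and Q are at most cosh(2 L) + sinh(2 L) / 2, while \<open>De\<close> is at least 2 S =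
  sinh(2 L). The point is a bound without r and \<kappa> that does not grow with L, since L becomes
  m l later.\<close>

lemma cxe_le: "cosh L * xe \<le> cosh (2 * L) / sinh (2 * L) + 1 / 2"
proof -
  have S2: "2 * S = sinh (2 * L)" by (simp add: S_def sinh_double)
  have k: "\<kappa> / 2 * x \<le> 1 / 2 * sinh (2 * L)" if "x \<le> sinh (2 * L)" "0 \<le> x" for x
    using \<kappa> that L by (intro mult_mono) auto
  have "P \<le> cosh (2 * L) + 1 / 2 * sinh (2 * L)"
    unfolding P_def using r L sinh_mult_arg_le[of "L - r" "L + r"]
    by (intro add_mono k) (auto simp: cosh_real_nonneg_le_iff)
  moreover have "Q \<le> cosh (2 * L) + 1 / 2 * sinh (2 * L)"
    unfolding Q_def using r L sinh_mult_arg_le[of "L + r" "L - r"]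
    by (intro add_mono k) (auto simp: cosh_real_nonneg_le_iff)
  ultimately have "P + Q \<le> 2 * cosh (2 * L) + sinh (2 * L)" by simp
  then have "(P + Q) / (2 * De) \<le> (2 * cosh (2 * L) + sinh (2 * L)) / (2 * (2 * S))"
    using De_ge S_pos L by (intro frac_le) (auto intro!: add_nonneg_nonneg)
  also have "\<dots> = cosh (2 * L) / sinh (2 * L) + 1 / 2"
    unfolding S2 using L by (simp add: add_divide_distrib)
  finally show ?thesis by (simp add: cxe)
qed

text \<open>Where F0 \<ge> M, F0'' = F0 - v > 0, so F0 has no interior maximum at such a level. M
  exceeds v, as the summand 1 leaves slack over the 1/2 in \<open>v_le\<close>, and it exceeds the
  end values, which are \<open>edge\<close> divided by \<kappa>.\<close>

lemma F0_le:
  assumes s: "- L \<le> s" "s \<le> L"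
  shows "F0 s \<le> 1 + (2 * (cosh (2 * L) / sinh (2 * L)) + 1) / \<kappa>"
proof -
  define M where "M = 1 + 2 * (cosh L * xe) / \<kappa>"
  have xe: "cosh L * xe > 0" unfolding cxe using P_pos Q_pos De_pos by simp
  have M: "M \<ge> 1 + 2 * (cosh L * xe)"
  proof -
    have "2 * (cosh L * xe) * \<kappa> \<le> 2 * (cosh L * xe) * 1" using xe \<kappa> by (intro mult_left_mono) auto
    then show ?thesis using \<kappa> by (simp add: M_def field_simps)
  qed
  have e: "F0 L < M" "F0 (- L) < M"
    unfolding F0_right F0_left M_def using edge_le[of L] edge_le[of "- L"] L \<kappa>
    by (auto simp: field_simps)
  have "0 < M - F0 s"
  proof (rule minimum_principle[where a = "- L" and b = L and h = "\<lambda>x. M - F0 x" and x = s])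
    show "continuous_on {- L..L} (\<lambda>x. M - F0 x)" by (intro continuous_intros F0_continuous)
    fix x assume x: "- L < x" "x < L"
    show "((\<lambda>x. M - F0 x) has_real_derivative 0 - F1 x) (at x)"
      by (intro DERIV_diff DERIV_const F0_deriv)
    show "((\<lambda>x. 0 - F1 x) has_real_derivative 0 - F2 x) (at x)"
      by (intro DERIV_diff DERIV_const F1_deriv)
    show "0 - F2 x < 0" if "M - F0 x \<le> 0"
      using that M v_le[of x] x by (simp add: v_def)
  qed (use e s L in auto)
  then have "F0 s \<le> 1 + 2 * (cosh L * xe) / \<kappa>" by (simp add: M_def)
  also have "\<dots> \<le> 1 + 2 * (cosh (2 * L) / sinh (2 * L) + 1 / 2) / \<kappa>"
    using cxe_le \<kappa> by (intro add_left_mono divide_right_mono) auto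
  finally show ?thesis by (simp add: algebra_simps)
qed

end

section \<open>Green functions at frequency m and the reproducing property\<close>

definition bform where
  "bform \<kappa> l m U U1 U2 W W1 W2 = (LINT t:{- l..l}|lborel.
     U2 t * (W2 t - (1 - \<kappa>) * m\<^sup>2 * W t) + 2 * \<kappa> * m\<^sup>2 * (U1 t * W1 t) + U t * (m^4 * W t - (1 - \<kappa>) * m\<^sup>2 * W2 t))"
  for \<kappa> l m :: real and U U1 U2 W W1 W2 :: "real \<Rightarrow> real"

text \<open>The Green function of the frequency \<open>m\<close> and its derivatives, by scaling to \<open>m = 1\<close>. As for
  \<open>ker3\<close>, the unit jump of the third derivative at \<open>y\<close> is removed from \<open>G3\<close>.\<close>

definition G0 where "G0 \<kappa> l m y t = beam.F0 (m * l) \<kappa> (m * y) (m * t) / m^3" for \<kappa> l m y t :: real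
definition G1 where "G1 \<kappa> l m y t = beam.F1 (m * l) \<kappa> (m * y) (m * t) / m^2" for \<kappa> l m y t :: real
definition G2 where "G2 \<kappa> l m y t = beam.F2 (m * l) \<kappa> (m * y) (m * t) / m" for \<kappa> l m y t :: real
definition G3 where "G3 \<kappa> l m y t = beam.F3 (m * l) \<kappa> (m * y) (m * t)" for \<kappa> l m y t :: real

lemma bform_sym: "bform \<kappa> l m U U1 U2 W W1 W2 = bform \<kappa> l m W W1 W2 U U1 U2"
  unfolding bform_def by (rule set_lebesgue_integral_cong) (auto simp: algebra_simps)

locale green_mode =
  fixes \<kappa> l m y :: real
  assumes l: "l > 0" and \<kappa>: "\<kappa> > 0" "\<kappa> \<le> 1" and m: "m > 0" and y: "- l \<le> y" "y \<le> l"
begin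

sublocale beam "m * l" \<kappa> "m * y"
proof
  have "m * (- l) \<le> m * y" "m * y \<le> m * l" using m y by (intro mult_left_mono; simp)+
  then show "- (m * l) \<le> m * y" "m * y \<le> m * l" by simp_all
qed (use l \<kappa> m in auto)

lemma scale_deriv:
  assumes "(f has_real_derivative D) (at (m * t))"
  shows "((\<lambda>t. f (m * t)) has_real_derivative D * m) (at t)"
  by (rule DERIV_chain2[where g = "\<lambda>t. m * t" and x = t]) (use assms in \<open>auto intro!: derivative_eq_intros\<close>)

lemma G0_deriv: "(G0 \<kappa> l m y has_real_derivative G1 \<kappa> l m y t) (at t)"
  unfolding G0_def G1_def
  by (rule DERIV_cong[OF DERIV_cdivide[OF scale_deriv[OF F0_deriv]]]) (use m in \<open>simp add: eval_nat_numeral\<close>)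

lemma G1_deriv: "(G1 \<kappa> l m y has_real_derivative G2 \<kappa> l m y t) (at t)"
  unfolding G1_def G2_def
  by (rule DERIV_cong[OF DERIV_cdivide[OF scale_deriv[OF F1_deriv]]]) (use m in \<open>simp add: eval_nat_numeral\<close>)

lemma G2_deriv:
  assumes "t \<noteq> y"
  shows "(G2 \<kappa> l m y has_real_derivative G3 \<kappa> l m y t + (if t > y then 1 else 0)) (at t)"
  unfolding G2_def G3_def
  by (rule DERIV_cong[OF DERIV_cdivide[OF scale_deriv[OF F2_deriv]]]) (use m assms in simp_all)

lemma G3_deriv:
  assumes "t \<noteq> y"
  shows "(G3 \<kappa> l m y has_real_derivative 2 * m\<^sup>2 * G2 \<kappa> l m y t - m^4 * G0 \<kappa> l m y t) (at t)"
  unfolding G3_def G2_def G0_def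
  by (rule DERIV_cong[OF scale_deriv[OF F3_deriv]]) (use m assms in \<open>simp_all add: eval_nat_numeral field_simps\<close>)

lemma G0_continuous: "continuous_on A (G0 \<kappa> l m y)"
  unfolding G0_def by (intro continuous_intros continuous_on_compose2[OF F0_continuous[of UNIV]]) (use m in auto)
lemma G1_continuous: "continuous_on A (G1 \<kappa> l m y)"
  unfolding G1_def by (intro continuous_intros continuous_on_compose2[OF F1_continuous[of UNIV]]) (use m in auto)
lemma G2_continuous: "continuous_on A (G2 \<kappa> l m y)"
  unfolding G2_def by (intro continuous_intros continuous_on_compose2[OF F2_continuous[of UNIV]]) (use m in auto)
lemma G3_continuous: "continuous_on A (G3 \<kappa> l m y)"
  unfolding G3_def by (intro continuous_intros continuous_on_compose2[OF F3_continuous[of UNIV]]) (use m in auto)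

lemma G_bending:
  "G2 \<kappa> l m y l = (1 - \<kappa>) * m\<^sup>2 * G0 \<kappa> l m y l" "G2 \<kappa> l m y (- l) = (1 - \<kappa>) * m\<^sup>2 * G0 \<kappa> l m y (- l)"
  unfolding G2_def G0_def mult_minus_right bending_moment using m by (simp_all add: eval_nat_numeral)

lemma G_shear:
  "G3 \<kappa> l m y l + 1 = (1 + \<kappa>) * m\<^sup>2 * G1 \<kappa> l m y l" "G3 \<kappa> l m y (- l) = (1 + \<kappa>) * m\<^sup>2 * G1 \<kappa> l m y (- l)"
  using shear_right shear_left m by (simp_all add: G3_def G1_def)

lemma abs_G2_less:
  assumes "- l \<le> t" "t \<le> l" shows "\<bar>G2 \<kappa> l m y t\<bar> < m\<^sup>2 * G0 \<kappa> l m y t"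
proof -
  have "m * (- l) \<le> m * t" "m * t \<le> m * l" using m assms by (intro mult_left_mono; simp)+
  then have "\<bar>F2 (m * t)\<bar> < F0 (m * t)" by (intro abs_F2_less) auto
  then show ?thesis using m by (simp add: G2_def G0_def eval_nat_numeral field_simps abs_mult)
qed

lemma G0_pos: "- l \<le> t \<Longrightarrow> t \<le> l \<Longrightarrow> G0 \<kappa> l m y t > 0"
  using abs_G2_less[of t] m by (smt (verit) mult_nonneg_nonpos zero_le_power2)

text \<open>The hyperbolic cotangent decreases, so for m \<ge> 1 the bound at length m l is
  dominated by the one at length l. Only the explicit factor m^-3 still depends on m.\<close>

lemma G0_le:
  assumes "- l \<le> t" "t \<le> l" "m \<ge> 1"
  shows "G0 \<kappa> l m y t \<le> (1 + (2 * (cosh (2 * l) / sinh (2 * l)) + 1) / \<kappa>) / m^3"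
proof -
  have "m * (- l) \<le> m * t" "m * t \<le> m * l" using m assms by (intro mult_left_mono; simp)+
  then have "F0 (m * t) \<le> 1 + (2 * (cosh (2 * (m * l)) / sinh (2 * (m * l))) + 1) / \<kappa>"
    by (intro F0_le) auto
  also have "cosh (2 * (m * l)) / sinh (2 * (m * l)) \<le> cosh (2 * l) / sinh (2 * l)"
  proof -
    have "sinh (2 * (m * l) - 2 * l) \<ge> 0" using l assms(3) by simp
    then have "cosh (2 * (m * l)) * sinh (2 * l) \<le> cosh (2 * l) * sinh (2 * (m * l))"
      unfolding sinh_diff by (simp add: mult.commute)
    then show ?thesis using l m by (simp add: divide_simps)
  qed
  finally have "F0 (m * t) \<le> 1 + (2 * (cosh (2 * l) / sinh (2 * l)) + 1) / \<kappa>"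
    using \<kappa> by (simp add: divide_right_mono)
  then show ?thesis using m by (simp add: G0_def divide_right_mono)
qed

lemma step_integrable: "set_integrable lborel {-l..l} (\<lambda>t. if t > y then 1 else 0 :: real)"
proof -
  have "integrable lborel (\<lambda>t. indicator {y<..l} t :: real)"
    using y by (intro integrable_real_indicator) auto
  also have "(\<lambda>t. indicator {y<..l} t) = (\<lambda>t. indicator {-l..l} t *\<^sub>R (if t > y then 1 else 0 :: real))"
    using y by (auto simp: indicator_def)
  finally show ?thesis by (simp add: set_integrable_def)
qed

lemma G2_prim: "prim (- l) l (G2 \<kappa> l m y) (\<lambda>t. G3 \<kappa> l m y t + (if t > y then 1 else 0))"
proof (rule prim_FTC[of "{y}"])
  show "set_integrable lborel {- l..l} (\<lambda>t. G3 \<kappa> l m y t + (if t > y then 1 else 0))"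
    by (intro set_integral_add(1) step_integrable borel_integrable_atLeastAtMost' G3_continuous)
qed (use G2_deriv G2_continuous in auto)

text \<open>Integration by parts moves the derivatives from U to the Green function, and its free
  edge conditions dispose of the boundary terms. U may therefore be arbitrary at the edges; the
  value at y comes from the unit jump of the third derivative.\<close>

lemma green_identity:
  assumes U: "prim (- l) l U U1" and U1: "prim (- l) l U1 U2"
  shows "bform \<kappa> l m U U1 U2 (G0 \<kappa> l m y) (G1 \<kappa> l m y) (G2 \<kappa> l m y) = U y"
proof -
  define W where "W = G0 \<kappa> l m y"
  define W1 where "W1 = G1 \<kappa> l m y"
  define W2 where "W2 = G2 \<kappa> l m y"
  define W3 where "W3 = G3 \<kappa> l m y"
  define J where "J = (\<lambda>t. if t > y then 1 else 0 :: real)"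
  define B where "B = (\<lambda>t. W2 t - (1 - \<kappa>) * m\<^sup>2 * W t)"
  define T where "T = (\<lambda>t. W3 t - (1 + \<kappa>) * m\<^sup>2 * W1 t)"
  note W_defs = W_def W1_def W2_def W3_def
  have c: "continuous_on A W" "continuous_on A W1" "continuous_on A W2" "continuous_on A W3" for A
    unfolding W_defs by (rule G0_continuous G1_continuous G2_continuous G3_continuous)+
  have Uc: "continuous_on {-l..l} U" "continuous_on {-l..l} U1"
    using prim_continuous U U1 by blast+
  have ll: "- l \<le> l" using l by simp
  have pW: "prim (- l) l W W1" "prim (- l) l W1 W2"
    unfolding W_defs by (intro prim_C1 G0_deriv G1_deriv G1_continuous G2_continuous)+
  have Ji: "set_integrable lborel {-l..l} J"
    unfolding J_def by (rule step_integrable)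
  have pW2: "prim (- l) l W2 (\<lambda>t. W3 t + J t)"
    unfolding W_defs J_def by (rule G2_prim)
  have pW3: "prim (- l) l W3 (\<lambda>t. 2 * m\<^sup>2 * W2 t - m^4 * W t)"
  proof (rule prim_FTC[of "{y}"])
    show "set_integrable lborel {- l..l} (\<lambda>t. 2 * m\<^sup>2 * W2 t - m^4 * W t)"
      by (intro borel_integrable_atLeastAtMost' continuous_intros c)
    show "(W3 has_real_derivative 2 * m\<^sup>2 * W2 t - m^4 * W t) (at t)" if "t \<in> {- l<..<l} - {y}" for t
      using G3_deriv[of t] that by (simp add: W_defs)
  qed (auto simp: c)
  have pB: "prim (- l) l B (\<lambda>t. W3 t + J t - (1 - \<kappa>) * m\<^sup>2 * W1 t)"
    unfolding B_def by (rule prim_diff[OF pW2 prim_cmult[OF pW(1)]])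
  have pT: "prim (- l) l T (\<lambda>t. 2 * m\<^sup>2 * W2 t - m^4 * W t - (1 + \<kappa>) * m\<^sup>2 * W2 t)"
    unfolding T_def by (rule prim_diff[OF pW3 prim_cmult[OF pW(2)]])
  \<comment> \<open>B and T are the bending and shear expressions of the Green function. T is built
    from \<open>G3\<close>, where the jump is removed, so it misses the shear condition at l by
    exactly 1; the resulting U(l) cancels against the integral of U1 J.\<close>
  have B0: "B l = 0" "B (- l) = 0" and T0: "T l = - 1" "T (- l) = 0"
    using G_bending G_shear by (simp_all add: B_def T_def W_defs)
  define I where "I = (\<lambda>f. LINT t:{-l..l}|lborel. f t :: real)"
  have i1: "set_integrable lborel {-l..l} (\<lambda>t. U2 t * B t)"
    by (rule set_integrable_mult_continuous[OF prim_integrable[OF U1] prim_continuous[OF pB]])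
  have i2: "set_integrable lborel {-l..l} (\<lambda>t. U1 t * T t)"
    by (rule set_integrable_mult_continuous[OF prim_integrable[OF U] prim_continuous[OF pT]])
  have i3: "set_integrable lborel {-l..l} (\<lambda>t. U1 t * J t)"
    using set_integrable_mult_continuous[OF Ji Uc(2)] by (simp add: mult.commute)
  have i4: "set_integrable lborel {-l..l} (\<lambda>t. 2 * \<kappa> * m\<^sup>2 * (U1 t * W1 t))"
    by (intro borel_integrable_atLeastAtMost' continuous_intros c Uc)
  have i5: "set_integrable lborel {-l..l} (\<lambda>t. U t * (m^4 * W t - (1 - \<kappa>) * m\<^sup>2 * W2 t))"
    by (intro borel_integrable_atLeastAtMost' continuous_intros c Uc)
  have "I (\<lambda>t. U2 t * B t) + I (\<lambda>t. U1 t * (W3 t + J t - (1 - \<kappa>) * m\<^sup>2 * W1 t)) = 0"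
    using prim_parts[OF U1 pB ll] B0 by (simp add: I_def)
  also have "(\<lambda>t. U1 t * (W3 t + J t - (1 - \<kappa>) * m\<^sup>2 * W1 t)) = (\<lambda>t. U1 t * T t + U1 t * J t + 2 * \<kappa> * m\<^sup>2 * (U1 t * W1 t))"
    by (auto simp: T_def algebra_simps)
  also have "I \<dots> = I (\<lambda>t. U1 t * T t) + I (\<lambda>t. U1 t * J t) + I (\<lambda>t. 2 * \<kappa> * m\<^sup>2 * (U1 t * W1 t))"
    unfolding I_def using i2 i3 i4 by (simp only: set_integral_add)
  finally have 1: "I (\<lambda>t. U2 t * B t) + (I (\<lambda>t. U1 t * T t) + I (\<lambda>t. U1 t * J t) + I (\<lambda>t. 2 * \<kappa> * m\<^sup>2 * (U1 t * W1 t))) = 0" .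
  have "(\<lambda>t. U t * (2 * m\<^sup>2 * W2 t - m^4 * W t - (1 + \<kappa>) * m\<^sup>2 * W2 t)) = (\<lambda>t. - (U t * (m^4 * W t - (1 - \<kappa>) * m\<^sup>2 * W2 t)))"
    by (auto simp: algebra_simps)
  then have 2: "I (\<lambda>t. U1 t * T t) - I (\<lambda>t. U t * (m^4 * W t - (1 - \<kappa>) * m\<^sup>2 * W2 t)) = - U l"
    using prim_parts[OF U pT ll] T0 set_integral_uminus[OF i5] by (simp add: I_def)
  have 3: "I (\<lambda>t. U1 t * J t) = U l - U y"
  proof -
    have "I (\<lambda>t. U1 t - U1 t * J t) = U y - U (- l)"
      using prim_integral[OF U, of y] y unfolding I_def set_lebesgue_integral_def
      by (subst Bochner_Integration.integral_cong[OF refl, of _ _ "\<lambda>t. indicator {-l..y} t *\<^sub>R U1 t"])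
         (auto simp: J_def indicator_def)
    moreover have "I (\<lambda>t. U1 t - U1 t * J t) = I U1 - I (\<lambda>t. U1 t * J t)"
      unfolding I_def by (rule set_integral_diff(2)[OF prim_integrable[OF U] i3])
    moreover have "I U1 = U l - U (- l)"
      using prim_integral[OF U, of l] l by (simp add: I_def)
    ultimately show ?thesis by simp
  qed
  have "bform \<kappa> l m U U1 U2 W W1 W2 = I (\<lambda>t. U2 t * B t + 2 * \<kappa> * m\<^sup>2 * (U1 t * W1 t) + U t * (m^4 * W t - (1 - \<kappa>) * m\<^sup>2 * W2 t))"
    by (simp add: bform_def I_def B_def)
  also have "\<dots> = I (\<lambda>t. U2 t * B t) + I (\<lambda>t. 2 * \<kappa> * m\<^sup>2 * (U1 t * W1 t)) + I (\<lambda>t. U t * (m^4 * W t - (1 - \<kappa>) * m\<^sup>2 * W2 t))"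
    unfolding I_def using i1 i4 i5 by (simp only: set_integral_add)
  also have "\<dots> = U y" using 1 2 3 by linarith
  finally show ?thesis by (simp add: W_defs)
qed

end

lemma G_prim:
  assumes "l > 0" "0 < \<kappa>" "\<kappa> \<le> 1" "m > 0" "y \<in> {-l..l}"
  shows "prim (- l) l (G0 \<kappa> l m y) (G1 \<kappa> l m y)" "prim (- l) l (G1 \<kappa> l m y) (G2 \<kappa> l m y)"
proof -
  interpret green_mode \<kappa> l m y by unfold_locales (use assms in auto)
  show "prim (- l) l (G0 \<kappa> l m y) (G1 \<kappa> l m y)" "prim (- l) l (G1 \<kappa> l m y) (G2 \<kappa> l m y)"
    by (intro prim_C1 G0_deriv G1_deriv G1_continuous G2_continuous)+
qed

text \<open>Each of the two Green functions reproduces the other at its own pole, and the form is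
  symmetric.\<close>

lemma G0_sym:
  assumes "l > 0" "0 < \<kappa>" "\<kappa> \<le> 1" "m > 0" "y \<in> {-l..l}" "w \<in> {-l..l}"
  shows "G0 \<kappa> l m y w = G0 \<kappa> l m w y"
proof -
  have "green_mode \<kappa> l m y" "green_mode \<kappa> l m w" using assms by (auto simp: green_mode_def)
  from green_mode.green_identity[OF this(1) G_prim[of l \<kappa> m w]] green_mode.green_identity[OF this(2) G_prim[of l \<kappa> m y]]
  show ?thesis using assms bform_sym by metis
qed

text \<open>Testing the form for each of the two frequencies with both Green functions eliminates all
  terms but \<open>\<integral> Y'' W'' - m\<^sup>2 n\<^sup>2 Y W\<close>, which is negative by the pointwise bound \<open>|Y''| < m\<^sup>2 Y\<close>.\<close>

lemma G0_frequency_decreasing: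
  assumes l: "l > 0" and \<kappa>: "0 < \<kappa>" "\<kappa> \<le> 1" and mn: "0 < m" "m < n" and yw: "y \<in> {-l..l}" "w \<in> {-l..l}"
  shows "n\<^sup>2 * G0 \<kappa> l n y w < m\<^sup>2 * G0 \<kappa> l m y w"
proof -
  interpret Y: green_mode \<kappa> l m y by unfold_locales (use assms in auto)
  interpret W: green_mode \<kappa> l n w by unfold_locales (use assms in auto)
  let ?Y = "G0 \<kappa> l m y" and ?Y1 = "G1 \<kappa> l m y" and ?Y2 = "G2 \<kappa> l m y"
  let ?W = "G0 \<kappa> l n w" and ?W1 = "G1 \<kappa> l n w" and ?W2 = "G2 \<kappa> l n w"
  note cont = Y.G0_continuous Y.G1_continuous Y.G2_continuous W.G0_continuous W.G1_continuous W.G2_continuous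
  have 1: "bform \<kappa> l m ?W ?W1 ?W2 ?Y ?Y1 ?Y2 = ?W y"
    by (rule Y.green_identity; rule G_prim) (use assms in auto)
  have 2: "bform \<kappa> l n ?Y ?Y1 ?Y2 ?W ?W1 ?W2 = ?Y w"
    by (rule W.green_identity; rule G_prim) (use assms in auto)
  define D where "D = (\<lambda>t. ?Y2 t * ?W2 t - m\<^sup>2 * n\<^sup>2 * (?Y t * ?W t))"
  have Dc: "continuous_on {-l..l} D" unfolding D_def by (intro continuous_intros cont)
  \<comment> \<open>In n^2 a_m - m^2 a_n the mixed and the gradient terms carry the coefficient m^2
    n^2 on both sides and drop out; the last terms leave n^2 m^4 - m^2 n^4 = - m^2 n^2 (n^2 -
    m^2).\<close>
  have "n\<^sup>2 * ?W y - m\<^sup>2 * ?Y w = (LINT t:{-l..l}|lborel. (n\<^sup>2 - m\<^sup>2) * D t)"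
    unfolding 1[symmetric] 2[symmetric] bform_def set_integral_mult_right[symmetric]
    by (subst set_integral_diff(2)[symmetric])
       (auto intro!: borel_integrable_atLeastAtMost' continuous_intros cont set_lebesgue_integral_cong simp: D_def algebra_simps power2_eq_square power4_eq_xxxx)
  also have "\<dots> = (n\<^sup>2 - m\<^sup>2) * integral {-l..l} D"
    by (simp only: set_integral_mult_right set_borel_integral_eq_integral(2)[OF borel_integrable_atLeastAtMost'[OF Dc]])
  also have "integral {-l..l} D < integral {-l..l} (\<lambda>_. 0)"
  proof (rule integral_less_real)
    show "continuous_on {-l..l} D" by (rule Dc)
    fix t assume t: "t \<in> {-l<..<l}"
    have "\<bar>?Y2 t * ?W2 t\<bar> < (m\<^sup>2 * ?Y t) * (n\<^sup>2 * ?W t)"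
      unfolding abs_mult using Y.abs_G2_less[of t] W.abs_G2_less[of t] t by (intro mult_strict_mono') auto
    then show "D t < 0" by (simp add: D_def algebra_simps)
  qed (use l in auto)
  then have "(n\<^sup>2 - m\<^sup>2) * integral {-l..l} D < 0"
    using mn by (intro mult_pos_neg) (auto simp: power_strict_mono)
  finally have "n\<^sup>2 * ?W y < m\<^sup>2 * ?Y w" by simp
  then show ?thesis using G0_sym[of l \<kappa> n y w] assms by simp
qed

section \<open>Sine series and sine kernels\<close>

lemma sum_cos_formula:
  "2 * sin (x / 2) * (\<Sum>k=1..n. cos (real k * x)) = sin ((real n + 1 / 2) * x) - sin (x / 2)"
proof (induction n)
  case (Suc n)
  have "sin ((real (Suc n) + 1 / 2) * x) - sin ((real n + 1 / 2) * x) = 2 * sin (x / 2) * cos (real (Suc n) * x)"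
  proof -
    have "(real (Suc n) + 1 / 2) * x = real (Suc n) * x + x / 2" "(real n + 1 / 2) * x = real (Suc n) * x - x / 2"
      by (simp_all add: algebra_simps)
    then show ?thesis by (simp only: sin_add sin_diff) simp
  qed
  then show ?case using Suc by (simp add: distrib_left)
qed simp

text \<open>At an interior minimum of the \<open>n\<close>-th sum the last term \<open>sin (n x) / n\<close> is nonnegative,
  so the value there is at least that of the previous sum.\<close>

lemma fejer_jackson:
  assumes "0 \<le> x" "x \<le> pi"
  shows "(\<Sum>k=1..n. sin (real k * x) / real k) \<ge> 0"
  using assms
proof (induction n arbitrary: x)
  case (Suc n)
  define D where "D = (\<lambda>n x. \<Sum>k=1..n. sin (real k * x) / real k)"
  have D': "(D n has_real_derivative (\<Sum>k=1..n. cos (real k * x))) (at x)" for n x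
    unfolding D_def by (auto intro!: derivative_eq_intros sum.cong)
  have "continuous_on {0..pi} (D (Suc n))"
    using D' by (meson DERIV_isCont continuous_at_imp_continuous_on)
  then obtain z where z: "z \<in> {0..pi}" "\<And>y. y \<in> {0..pi} \<Longrightarrow> D (Suc n) z \<le> D (Suc n) y"
    using continuous_attains_inf[of "{0..pi}" "D (Suc n)"] by auto
  have "D (Suc n) z \<ge> 0"
  proof (cases "z = 0 \<or> z = pi")
    case True
    then show ?thesis by (auto simp: D_def intro!: sum_nonneg simp del: sum.cl_ivl_Suc)
  next
    case False
    then have zi: "0 < z" "z < pi" using z(1) by auto
    define m where "m = Suc n"
    have "(\<Sum>k=1..m. cos (real k * z)) = 0"
    proof (rule DERIV_local_min[OF D'])
      show "0 < min z (pi - z)" using zi by simp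
      show "\<forall>y. \<bar>z - y\<bar> < min z (pi - z) \<longrightarrow> D m z \<le> D m y"
        using z(2) by (auto simp: abs_if m_def split: if_splits)
    qed
    \<comment> \<open>At a critical point the sines of (m + 1/2) z and z/2 agree, so the cosines
      agree up to sign. Hence sin(m z) is sin(z/2) times 0 or 2 cos(z/2).\<close>
    then have eq: "sin ((real m + 1 / 2) * z) = sin (z / 2)"
      using sum_cos_formula[of z m] by simp
    have pos: "sin (z / 2) > 0" "cos (z / 2) > 0" using zi by (auto intro!: sin_gt_zero cos_gt_zero)
    have "(cos ((real m + 1 / 2) * z))\<^sup>2 = (cos (z / 2))\<^sup>2"
      by (simp add: cos_squared_eq eq)
    then have c: "cos ((real m + 1 / 2) * z) \<le> cos (z / 2)"
      using pos by (metis abs_ge_self abs_of_pos power2_eq_iff_nonneg abs_ge_zero power2_abs)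
    have "sin (real m * z) = sin ((real m + 1 / 2) * z - z / 2)" by (simp add: algebra_simps)
    also have "\<dots> = sin (z / 2) * (cos (z / 2) - cos ((real m + 1 / 2) * z))"
      unfolding sin_diff eq by (simp add: algebra_simps)
    also have "\<dots> \<ge> 0" using pos c by simp
    finally have "sin (real m * z) / real m \<ge> 0" by simp
    moreover have "D (Suc n) z = D n z + sin (real m * z) / real m" by (simp add: D_def m_def)
    moreover have "D n z \<ge> 0" using Suc.IH[of z] zi by (simp add: D_def)
    ultimately show ?thesis by simp
  qed
  then have "D (Suc n) x \<ge> 0" using z(2)[of x] Suc.prems by force
  then show ?case by (simp only: D_def)
qed simp

text \<open>By the product formula the sum is (h(x - y) - h(x + y)) / 2 for the cosine sum h. It is
  even, has period 2 pi and decreases on [0, pi] by Fejer-Jackson; folded into this interval, x - y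
  lies to the left of x + y.\<close>

lemma sine_kernel_nonneg:
  assumes x: "0 \<le> x" "x \<le> pi" and y: "0 \<le> y" "y \<le> pi"
  shows "(\<Sum>k=1..n. sin (real k * x) * sin (real k * y) / (real k)\<^sup>2) \<ge> 0"
proof -
  define h where "h = (\<lambda>t. \<Sum>k=1..n. cos (real k * t) / (real k)\<^sup>2)"
  have h': "(h has_real_derivative - (\<Sum>k=1..n. sin (real k * t) / real k)) (at t)" for t
    unfolding h_def sum_negf[symmetric]
    by (auto intro!: derivative_eq_intros sum.cong simp: power2_eq_square)
  have mono: "h b \<le> h a" if "0 \<le> a" "a \<le> b" "b \<le> pi" for a b
    by (rule DERIV_nonpos_imp_nonincreasing[OF that(2)])
       (use h' fejer_jackson that in \<open>fastforce\<close>)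
  have even: "h (- t) = h t" and per: "h (2 * pi - t) = h t" for t
  proof -
    show "h (- t) = h t" by (simp add: h_def)
    have "cos (real k * (2 * pi - t)) = cos (real k * t)" for k
    proof -
      have "real k * (2 * pi - t) = 2 * real k * pi - real k * t" by (simp add: algebra_simps)
      then show ?thesis by (simp only: cos_diff cos_2npi sin_2npi)
    qed
    then show "h (2 * pi - t) = h t" by (simp add: h_def)
  qed
  define a where "a = \<bar>x - y\<bar>"
  define b where "b = min (x + y) (2 * pi - (x + y))"
  have ha: "h (x - y) = h a" using even[of "x - y"] by (auto simp: a_def abs_if)
  have hb: "h (x + y) = h b" using per[of "x + y"] by (auto simp: b_def min_def)
  have "h b \<le> h a" by (rule mono) (use x y in \<open>auto simp: a_def b_def\<close>)
  moreover have "(\<Sum>k=1..n. sin (real k * x) * sin (real k * y) / (real k)\<^sup>2) = (h (x - y) - h (x + y)) / 2"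
    unfolding h_def sum_subtractf[symmetric] sum_divide_distrib
    by (intro sum.cong refl) (simp add: distrib_left right_diff_distrib cos_add cos_diff field_simps)
  ultimately show ?thesis using ha hb by simp
qed

text \<open>In the Abel sum every term (c_k - c_(k+1)) S_k with k \<ge> 2, as well as the last one
  c_n S_n, is nonnegative and dropped. The first term survives, as S_1 = e_1, and later supplies
  strict positivity.\<close>

lemma abel_lower_bound:
  fixes c e :: "nat \<Rightarrow> real"
  assumes dec: "\<And>k. k \<ge> 1 \<Longrightarrow> c (Suc k) \<le> c k" and nn: "\<And>k. c k \<ge> 0"
    and S: "\<And>n. (\<Sum>k=1..n. e k) \<ge> 0" and n: "n \<ge> 2"
  shows "(\<Sum>k=1..n. c k * e k) \<ge> (c 1 - c 2) * e 1"
proof -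
  \<comment> \<open>The boundary term c_n S_n has to be kept for the induction: it is what bounds
    the next step.\<close>
  have "(\<Sum>k=1..n. c k * e k) \<ge> (c 1 - c 2) * e 1 + c n * (\<Sum>k=1..n. e k)"
    using n
  proof (induction n rule: dec_induct)
    case base
    have "{1..2::nat} = {1, 2}" by auto
    then show ?case by (simp add: algebra_simps)
  next
    case (step n)
    have "c (Suc n) * (\<Sum>k=1..n. e k) \<le> c n * (\<Sum>k=1..n. e k)"
      by (intro mult_right_mono dec S) (use step in auto)
    with step show ?case by (simp add: algebra_simps)
  qed
  moreover have "c n * (\<Sum>k=1..n. e k) \<ge> 0" by (intro mult_nonneg_nonneg nn S)
  ultimately show ?thesis by linarith
qed

text \<open>Products of sin(m x) with cos x are combinations of neighbouring sines, so h is
  orthogonal to sin x times every polynomial in cos x. Approximating h as a function of t = cos x by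
  such polynomials gives that h^2 sin x has integral 0.\<close>

lemma sine_complete:
  fixes h :: "real \<Rightarrow> real"
  assumes h: "continuous_on {0..pi} h"
    and orth: "\<And>m. integral {0..pi} (\<lambda>x. h x * sin (real m * x)) = 0"
    and x: "x \<in> {0..pi}"
  shows "h x = 0"
proof -
  have pw: "integral {0..pi} (\<lambda>x. h x * (sin (real m * x) * cos x ^ k)) = 0" for m k
  proof (induction k arbitrary: m)
    case (Suc k)
    show ?case
    proof (cases m)
      case (Suc j)
      have eq: "h x * (sin (real m * x) * cos x ^ Suc k) =
         1 / 2 * (h x * (sin (real (Suc m) * x) * cos x ^ k)) + 1 / 2 * (h x * (sin (real j * x) * cos x ^ k))" for x
      proof -
        have "real (Suc m) * x = real m * x + x" "real j * x = real m * x - x"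
          by (simp_all add: Suc algebra_simps)
        then show ?thesis by (simp only: sin_add sin_diff) (simp add: algebra_simps)
      qed
      have i: "(\<lambda>x. 1 / 2 * (h x * (sin (real m * x) * cos x ^ k))) integrable_on {0..pi}" for m
        by (intro integrable_continuous_interval continuous_intros h)
      show ?thesis
        unfolding eq integral_add[OF i i] integral_mult_right using Suc.IH by (simp del: of_nat_Suc)
    qed simp
  qed (use orth in simp)
  define Q where "Q = (\<lambda>x. h x * h x * sin x)"
  have Qc: "continuous_on {0..pi} Q" unfolding Q_def by (intro continuous_intros h)
  define C where "C = integral {0..pi} (\<lambda>x. \<bar>h x\<bar> * sin x)"
  have ai: "(\<lambda>x. \<bar>h x\<bar> * sin x) integrable_on {0..pi}"
    by (intro integrable_continuous_interval continuous_intros h)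
  have C: "C \<ge> 0" unfolding C_def by (intro integral_nonneg ai) (auto intro!: mult_nonneg_nonneg sin_ge_zero)
  have Qle: "integral {0..pi} Q \<le> e * C" if e: "e > 0" for e
  proof -
    have "continuous_on {-1..1} (\<lambda>t. h (arccos t))"
      by (rule continuous_on_compose2[OF h continuous_on_arccos']) (auto simp: arccos_lbound arccos_ubound)
    then obtain g where g: "real_polynomial_function g" "\<And>t. t \<in> {-1..1} \<Longrightarrow> \<bar>h (arccos t) - g t\<bar> < e"
      using Stone_Weierstrass_real_polynomial_function[OF compact_Icc _ e, of "-1" 1 "\<lambda>t. h (arccos t)"] by metis
    obtain a n where gs: "g = (\<lambda>t. \<Sum>i\<le>n. a i * t ^ i)"
      using g(1) unfolding real_polynomial_function_iff_sum by auto
    have gc: "continuous_on A (\<lambda>x. g (cos x))" for A unfolding gs by (intro continuous_intros)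
    have "integral {0..pi} (\<lambda>x. h x * sin x * g (cos x)) = integral {0..pi} (\<lambda>x. \<Sum>i\<le>n. a i * (h x * (sin (real 1 * x) * cos x ^ i)))"
      by (rule arg_cong[where f = "integral {0..pi}"]) (auto simp: gs sum_distrib_left mult_ac)
    also have "\<dots> = (\<Sum>i\<le>n. integral {0..pi} (\<lambda>x. a i * (h x * (sin (real 1 * x) * cos x ^ i))))"
      by (intro integral_sum integrable_continuous_interval continuous_intros h) auto
    also have "\<dots> = 0" unfolding integral_mult_right pw by simp
    finally have g0: "integral {0..pi} (\<lambda>x. h x * sin x * g (cos x)) = 0" .
    have "integral {0..pi} Q = integral {0..pi} Q - integral {0..pi} (\<lambda>x. h x * sin x * g (cos x))" using g0 by simp
    also have "\<dots> = integral {0..pi} (\<lambda>x. Q x - h x * sin x * g (cos x))"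
      by (intro integral_diff[symmetric] integrable_continuous_interval continuous_intros Qc h gc)
    also have "\<dots> \<le> integral {0..pi} (\<lambda>x. e * (\<bar>h x\<bar> * sin x))"
    proof (rule integral_le)
      fix x assume x: "x \<in> {0..pi}"
      have "Q x - h x * sin x * g (cos x) = h x * sin x * (h x - g (cos x))" by (simp add: Q_def algebra_simps)
      also have "\<dots> \<le> \<bar>h x\<bar> * sin x * \<bar>h x - g (cos x)\<bar>"
        using sin_ge_zero[of x] x abs_ge_self[of "h x * sin x * (h x - g (cos x))"] by (simp add: abs_mult)
      also have "\<bar>h x - g (cos x)\<bar> \<le> e" using g(2)[of "cos x"] x by (auto simp: arccos_cos)
      then have "\<bar>h x\<bar> * sin x * \<bar>h x - g (cos x)\<bar> \<le> \<bar>h x\<bar> * sin x * e"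
        using sin_ge_zero[of x] x by (intro mult_left_mono) auto
      finally show "Q x - h x * sin x * g (cos x) \<le> e * (\<bar>h x\<bar> * sin x)" by (simp add: mult_ac)
    qed (intro integrable_continuous_interval continuous_intros Qc h gc)+
    also have "\<dots> = e * C" by (simp add: C_def)
    finally show ?thesis .
  qed
  have "integral {0..pi} Q \<le> 0"
  proof (rule field_le_epsilon)
    fix d :: real assume d: "d > 0"
    have "integral {0..pi} Q \<le> d / (C + 1) * C" by (rule Qle) (use C d in auto)
    also have "\<dots> \<le> d" using C d by (simp add: field_simps)
    finally show "integral {0..pi} Q \<le> 0 + d" by simp
  qed
  moreover have Qn: "Q x \<ge> 0" if "x \<in> {0..pi}" for x using that sin_ge_zero[of x] by (simp add: Q_def zero_le_mult_iff)
  then have "integral {0..pi} Q \<ge> 0" by (intro integral_nonneg integrable_continuous_interval Qc) auto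
  ultimately have "(Q has_integral 0) {0..pi}"
    using integrable_integral[OF integrable_continuous_interval[OF Qc]] by simp
  then have Q0: "Q x = 0" if "x \<in> {0..pi}" for x
    using has_integral_0_cbox_imp_0[of 0 pi Q x] Qc Qn that pi_gt_zero
    by (auto simp del: pi_gt_zero simp: not_le[symmetric])
  have cl: "closure {0<..<pi} = {0..pi}" by simp
  have "h x = 0" if "x \<in> {0<..<pi}" for x
    using Q0[of x] that sin_gt_zero[of x] by (auto simp: Q_def)
  then show ?thesis
    using continuous_constant_on_closure[of "{0<..<pi}" h 0 x] h x unfolding cl by blast
qed

lemma sine_orthogonal:
  "integral {0..pi} (\<lambda>x. sin (real j * x) * sin (real m * x)) = (if j = m \<and> m \<noteq> 0 then pi / 2 else 0)"
proof -
  have c: "integral {0..pi} (\<lambda>x. cos (a * x)) = sin (a * pi) / a" if "a \<noteq> 0" for a :: real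
  proof -
    have "((\<lambda>x. cos (a * x)) has_integral (sin (a * pi) / a - sin (a * 0) / a)) {0..pi}"
      by (rule fundamental_theorem_of_calculus)
         (use that in \<open>auto intro!: derivative_eq_intros simp flip: has_real_derivative_iff_has_vector_derivative\<close>)
    then show ?thesis by (simp add: integral_unique)
  qed
  have c': "integral {0..pi} (\<lambda>x. cos (of_int a * x)) = (if a = 0 then pi else 0)" for a :: int
    using c[of "of_int a"] by (auto simp: sin_int_times_real mult.commute)
  have i: "(\<lambda>x. cos (a * x)) integrable_on {0..pi}" for a :: real
    by (intro integrable_continuous_interval continuous_intros)
  have "(\<lambda>x. sin (real j * x) * sin (real m * x)) =
      (\<lambda>x. (cos (of_int (int j - int m) * x) - cos (of_int (int j + int m) * x)) / 2)"
    by (auto simp: sin_times_sin algebra_simps)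
  then have "integral {0..pi} (\<lambda>x. sin (real j * x) * sin (real m * x)) =
      (integral {0..pi} (\<lambda>x. cos (of_int (int j - int m) * x)) - integral {0..pi} (\<lambda>x. cos (of_int (int j + int m) * x))) / 2"
    using integral_diff[OF i i] by simp
  then show ?thesis unfolding c' by auto
qed

text \<open>Cubic decay of the coefficients keeps the differentiated series below a multiple of the
  sum of 1/k^2, so it converges uniformly. The sum G lives on the whole line and has two-sided
  derivatives at 0 and pi; it equals h on [0, pi] because both have the same sine
  coefficients.\<close>

lemma sine_series:
  fixes h :: "real \<Rightarrow> real"
  assumes h: "continuous_on {0..pi} h"
    and B: "\<And>m. m \<ge> 1 \<Longrightarrow> \<bar>integral {0..pi} (\<lambda>x. h x * sin (real m * x))\<bar> \<le> C / real m ^ 3"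
  obtains G G' where "\<And>x. (G has_real_derivative G' x) (at x)" "\<And>x. x \<in> {0..pi} \<Longrightarrow> h x = G x"
    "\<And>x. (\<lambda>k. 2 / pi * integral {0..pi} (\<lambda>x. h x * sin (real (Suc k) * x)) * sin (real (Suc k) * x)) sums G x"
proof -
  define b where "b = (\<lambda>k. 2 / pi * integral {0..pi} (\<lambda>x. h x * sin (real (Suc k) * x)))"
  define f where "f = (\<lambda>k x. b k * sin (real (Suc k) * x))"
  define f' where "f' = (\<lambda>k x. b k * real (Suc k) * cos (real (Suc k) * x))"
  define M where "M = (\<lambda>k. 2 / pi * (C / real (Suc k) ^ 2))"
  have M: "summable M"
    unfolding M_def using inverse_power_summable[of 2, where 'a=real]
    by (intro summable_mult) (simp add: divide_inverse summable_mult del: of_nat_Suc power_Suc, subst summable_Suc_iff, auto)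
  have bM: "\<bar>b k\<bar> * real (Suc k) \<le> M k" for k
  proof -
    have "\<bar>b k\<bar> \<le> 2 / pi * (C / real (Suc k) ^ 3)"
      unfolding b_def abs_mult using B[of "Suc k"] by (intro mult_mono) auto
    then have "\<bar>b k\<bar> * real (Suc k) \<le> 2 / pi * (C / real (Suc k) ^ 3) * real (Suc k)"
      by (rule mult_right_mono) simp
    also have "\<dots> = M k" by (simp add: M_def power3_eq_cube power2_eq_square del: of_nat_Suc)
    finally show ?thesis .
  qed
  have fM: "\<bar>f k x\<bar> \<le> M k" for k x
  proof -
    have "\<bar>f k x\<bar> \<le> \<bar>b k\<bar> * 1" unfolding f_def abs_mult by (intro mult_left_mono) auto
    also have "\<dots> \<le> \<bar>b k\<bar> * real (Suc k)" by (intro mult_left_mono) auto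
    finally show ?thesis using bM[of k] by simp
  qed
  have f'M: "\<bar>f' k x\<bar> \<le> M k" for k x
  proof -
    have "\<bar>f' k x\<bar> \<le> \<bar>b k\<bar> * real (Suc k) * 1" unfolding f'_def abs_mult by (intro mult_mono) auto
    then show ?thesis using bM[of k] by simp
  qed
  define G where "G = (\<lambda>x. \<Sum>k. f k x)"
  define G' where "G' = (\<lambda>x. \<Sum>k. f' k x)"
  have sf: "summable (\<lambda>k. f k x)" for x
    by (rule summable_comparison_test'[OF M]) (use fM in simp)
  have "(G has_real_derivative G' x) (at x)" for x
    unfolding G_def G'_def
  proof (rule has_field_derivative_series'(2)[of UNIV])
    show "(f n has_real_derivative f' n x) (at x within UNIV)" for n x
      unfolding f_def f'_def by (auto intro!: derivative_eq_intros)
    show "uniformly_convergent_on UNIV (\<lambda>n x. \<Sum>i<n. f' i x)"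
      by (rule Weierstrass_m_test'[OF _ M]) (use f'M in simp)
  qed (use sf in auto)
  moreover have sums: "(\<lambda>k. f k x) sums G x" for x
    unfolding G_def using sf by (rule summable_sums)
  moreover have "h x = G x" if x: "x \<in> {0..pi}" for x
  proof -
    have Gc: "continuous_on A G" for A
      using calculation(1) by (meson DERIV_isCont continuous_at_imp_continuous_on)
    have ul: "uniform_limit {0..pi} (\<lambda>n x. \<Sum>i<n. f i x) G sequentially"
      unfolding G_def by (rule Weierstrass_m_test[OF _ M]) (use fM in simp)
    have "integral {0..pi} (\<lambda>x. G x * sin (real m * x)) = integral {0..pi} (\<lambda>x. h x * sin (real m * x))" for m
    proof -
      have ul2: "uniform_limit {0..pi} (\<lambda>n x. (\<Sum>i<n. f i x) * sin (real m * x)) (\<lambda>x. G x * sin (real m * x)) sequentially"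
        by (rule uniform_lim_mult[OF ul uniform_limit_const]) (auto intro!: compact_imp_bounded compact_continuous_image Gc continuous_intros)
      have lim: "(\<lambda>n. integral {0..pi} (\<lambda>x. (\<Sum>i<n. f i x) * sin (real m * x))) \<longlonglongrightarrow> integral {0..pi} (\<lambda>x. G x * sin (real m * x))"
      proof -
        have "continuous_on (cbox 0 pi) (\<lambda>x. (\<Sum>i<n. f i x) * sin (real m * x))" for n
          unfolding f_def by (intro continuous_intros)
        then obtain I J where IJ: "\<And>n. ((\<lambda>x. (\<Sum>i<n. f i x) * sin (real m * x)) has_integral I n) {0..pi}"
          "((\<lambda>x. G x * sin (real m * x)) has_integral J) {0..pi}" "I \<longlonglongrightarrow> J"
          using uniform_limit_integral[OF ul2] by auto
        then show ?thesis by (simp add: integral_unique[OF IJ(1)] integral_unique[OF IJ(2)])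
      qed
      have fin: "integral {0..pi} (\<lambda>x. (\<Sum>i<n. f i x) * sin (real m * x)) = (\<Sum>i<n. b i * (if Suc i = m then pi / 2 else 0))" for n
      proof -
        have "(\<lambda>x. (\<Sum>i<n. f i x) * sin (real m * x)) = (\<lambda>x. \<Sum>i<n. b i * (sin (real (Suc i) * x) * sin (real m * x)))"
          unfolding f_def sum_distrib_right mult.assoc ..
        moreover have "integral {0..pi} (\<lambda>x. \<Sum>i<n. b i * (sin (real (Suc i) * x) * sin (real m * x))) =
           (\<Sum>i<n. integral {0..pi} (\<lambda>x. b i * (sin (real (Suc i) * x) * sin (real m * x))))"
          by (intro integral_sum integrable_continuous_interval continuous_intros) auto
        moreover have "(if Suc i = m \<and> m \<noteq> 0 then pi / 2 else 0) = (if Suc i = m then pi / 2 else 0)" for i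
          by auto
        ultimately show ?thesis by (simp only: integral_mult_right sine_orthogonal)
      qed
      have "\<forall>\<^sub>F n in sequentially. integral {0..pi} (\<lambda>x. (\<Sum>i<n. f i x) * sin (real m * x)) = integral {0..pi} (\<lambda>x. h x * sin (real m * x))"
        using eventually_ge_at_top[of m]
      proof eventually_elim
        case (elim n)
        show ?case
        proof (cases m)
          case (Suc j)
          have "(\<Sum>i<n. b i * (if Suc i = m then pi / 2 else 0)) = (\<Sum>i<n. if i = j then b i * (pi / 2) else 0)"
            by (rule sum.cong) (auto simp: Suc)
          also have "\<dots> = b j * (pi / 2)" using elim Suc by (simp add: sum.delta)
          finally show ?thesis unfolding fin by (simp add: b_def Suc)
        qed (simp add: fin)
      qed
      from LIMSEQ_unique[OF lim tendsto_eventually[OF this]] show ?thesis .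
    qed
    moreover have "integral {0..pi} (\<lambda>x. (h x - G x) * sin (real m * x)) =
        integral {0..pi} (\<lambda>x. h x * sin (real m * x)) - integral {0..pi} (\<lambda>x. G x * sin (real m * x))" for m
      unfolding left_diff_distrib
      by (intro integral_diff integrable_continuous_interval continuous_intros h Gc)
    ultimately have "h x - G x = 0"
      by (intro sine_complete[of "\<lambda>x. h x - G x"] continuous_intros h Gc x) simp
    then show ?thesis by simp
  qed
  ultimately show ?thesis using that[of G G'] by (auto simp: f_def b_def)
qed

text \<open>Otherwise G - K sin would vanish at 0 with negative slope and be negative just to the
  right.\<close>

lemma boundary_slope_left:
  fixes G :: "real \<Rightarrow> real"
  assumes G: "(G has_real_derivative d) (at 0)" and G0: "G 0 = 0"
    and low: "\<And>x. 0 < x \<Longrightarrow> x < pi \<Longrightarrow> G x \<ge> K * sin x"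
  shows "d \<ge> K"
proof (rule ccontr)
  assume "\<not> d \<ge> K"
  have "((\<lambda>x. G x - K * sin x) has_real_derivative d - K * cos 0) (at 0)"
    by (intro DERIV_diff G DERIV_cmult DERIV_sin)
  then obtain e where e: "e > 0" "\<And>t. 0 < t \<Longrightarrow> t < e \<Longrightarrow> G t - K * sin t < 0"
    using DERIV_neg_dec_right[of "\<lambda>x. G x - K * sin x" "d - K * cos 0" 0] \<open>\<not> d \<ge> K\<close> G0 by auto
  define t where "t = min e pi / 2"
  have "0 < t" "t < e" "t < pi" using e pi_gt_zero by (auto simp: t_def min_def)
  then show False using e(2)[of t] low[of t] by simp
qed

lemma boundary_slope_right:
  fixes G :: "real \<Rightarrow> real"
  assumes G: "(G has_real_derivative d) (at pi)" and G0: "G pi = 0"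
    and low: "\<And>x. 0 < x \<Longrightarrow> x < pi \<Longrightarrow> G x \<ge> K * sin x"
  shows "d \<le> - K"
proof -
  have "((\<lambda>x. G (pi - x)) has_real_derivative - d) (at 0)"
    by (rule DERIV_cong[OF DERIV_chain2[where g = "\<lambda>x. pi - x"]]) (use G in \<open>auto intro!: derivative_eq_intros\<close>)
  from boundary_slope_left[OF this _, of K] show ?thesis
    using G0 low[of "pi - x" for x] by (simp add: sin_diff) 
qed

section \<open>Integration over the plate\<close>

lemma plate_eq_box: "plate l = box (0, - l) (pi, l)"
  by (auto simp: plate_def box_def Basis_prod_def)

lemma plate_closure:
  assumes "l > 0" shows "closure (plate l) = {0..pi} \<times> {-l..l}"
  using assms by (simp add: plate_def closure_Times)

lemma plate_sets[measurable]: "plate l \<in> sets borel" "plate l \<in> sets lborel" "plate l \<in> sets lebesgue"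
proof -
  show *: "plate l \<in> sets borel" by (simp add: plate_eq_box)
  then show "plate l \<in> sets lborel" by simp
  then show "plate l \<in> sets lebesgue" by (rule sets_completionI_sets)
qed

lemma AE_closed_plate: "AE z in lborel. z \<in> {0..pi} \<times> {-l..l} \<longrightarrow> z \<in> plate l"
proof -
  let ?R = "cbox (0, - l) (pi, l)"
  have R: "?R = {0..pi} \<times> {-l..l}" by (simp add: cbox_Pair_eq)
  have sub: "plate l \<subseteq> ?R" by (auto simp: R plate_def)
  have "emeasure lborel (?R - plate l) = emeasure lborel ?R - emeasure lborel (plate l)"
  proof (rule emeasure_Diff)
    show "emeasure lborel (plate l) \<noteq> \<infinity>" unfolding plate_eq_box by (simp add: emeasure_lborel_box_eq)
  qed (use sub plate_sets in auto)
  also have "\<dots> = 0"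
    unfolding plate_eq_box by (simp add: emeasure_lborel_box_eq emeasure_lborel_cbox_eq)
  finally have "?R - plate l \<in> null_sets lborel" by (auto simp: plate_eq_box)
  from AE_not_in[OF this] show ?thesis unfolding R by eventually_elim auto
qed

text \<open>The given functions are measurable for the completed measure on the open plate, while
  Fubini is applied on \<open>lborel\<close>. Hence a Borel function h on the whole plane stands in,
  set to 0 outside the closed rectangle; the edges form a null set.\<close>

definition plate_rep :: "real \<Rightarrow> (real \<times> real \<Rightarrow> real) \<Rightarrow> (real \<times> real \<Rightarrow> real) \<Rightarrow> bool" where
  "plate_rep l g h \<longleftrightarrow> g \<in> borel_measurable (lebesgue_on (plate l)) \<and> h \<in> borel_measurable borel \<and>
     integrable lborel h \<and> (\<forall>z. z \<notin> {0..pi} \<times> {-l..l} \<longrightarrow> h z = 0) \<and> (AE z in lborel. z \<in> plate l \<longrightarrow> g z = h z)"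

lemma plate_rep_integral:
  assumes rep: "plate_rep l g h" and p: "p \<in> borel_measurable borel"
  shows "(\<integral>z. g z * p z \<partial>(lebesgue_on (plate l))) = (\<integral>z. h z * p z \<partial>lborel)"
proof -
  have hm: "h \<in> borel_measurable borel" and gm: "g \<in> borel_measurable (lebesgue_on (plate l))"
    and ae: "AE z in lborel. z \<in> plate l \<longrightarrow> g z = h z" and zero: "\<And>z. z \<notin> {0..pi} \<times> {-l..l} \<Longrightarrow> h z = 0"
    using rep unfolding plate_rep_def by blast+
  have hl: "f \<in> borel_measurable lebesgue" if "f \<in> borel_measurable borel" for f :: "real \<times> real \<Rightarrow> real"
    by (rule measurable_completion) (use that in simp)
  have "(\<integral>z. g z * p z \<partial>(lebesgue_on (plate l))) = (\<integral>z. indicator (plate l) z *\<^sub>R (g z * p z) \<partial>lebesgue)"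
    by (rule integral_restrict_space) (simp add: plate_sets)
  also have "\<dots> = (\<integral>z. h z * p z \<partial>lebesgue)"
  proof (rule integral_cong_AE)
    have "(\<lambda>z. indicator (plate l) z *\<^sub>R g z) \<in> borel_measurable lebesgue"
      using gm by (subst (asm) borel_measurable_restrict_space_iff) (auto simp: plate_sets)
    then have "(\<lambda>z. (indicator (plate l) z *\<^sub>R g z) * p z) \<in> borel_measurable lebesgue"
      using hl[OF p] by (rule borel_measurable_times)
    then show "(\<lambda>z. indicator (plate l) z *\<^sub>R (g z * p z)) \<in> borel_measurable lebesgue"
      by (simp add: mult.assoc)
    show "(\<lambda>z. h z * p z) \<in> borel_measurable lebesgue"
      by (intro borel_measurable_times hl hm p)
    show "AE z in lebesgue. indicator (plate l) z *\<^sub>R (g z * p z) = h z * p z"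
    proof (rule AE_completion)
      show "AE z in lborel. indicator (plate l) z *\<^sub>R (g z * p z) = h z * p z"
        using ae AE_closed_plate[of l]
        by eventually_elim (use zero in \<open>auto simp: indicator_def\<close>)
    qed
  qed
  also have "\<dots> = (\<integral>z. h z * p z \<partial>lborel)"
    by (rule integral_completion) (use hm p in \<open>simp add: borel_measurable_times\<close>)
  finally show ?thesis .
qed

lemma plate_rep_exists:
  assumes "g \<in> L2 (plate l)"
  obtains h where "plate_rep l g h"
proof -
  have gm: "g \<in> borel_measurable (lebesgue_on (plate l))" and g2: "integrable (lebesgue_on (plate l)) (\<lambda>z. (g z)\<^sup>2)"
    using assms by (auto simp: L2_def)
  have "(\<lambda>z. indicator (plate l) z *\<^sub>R g z) \<in> borel_measurable lebesgue"
    using gm by (subst (asm) borel_measurable_restrict_space_iff) (auto simp: plate_sets)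
  then obtain k where k: "k \<in> borel_measurable lborel" "AE z in lborel. indicator (plate l) z *\<^sub>R g z = k z"
    using completion_ex_borel_measurable_real by blast
  define h where "h = (\<lambda>z. indicator (plate l) z * k z)"
  have hm: "h \<in> borel_measurable borel" using k(1) plate_sets(1) unfolding h_def by simp
  have fin: "emeasure lebesgue (plate l) < \<infinity>"
    unfolding plate_eq_box by (simp add: emeasure_lborel_box_eq)
  \<comment> \<open>On a set of finite measure square integrability implies integrability, by |g|
    \<le> 1 + g^2.\<close>
  have "integrable (lebesgue_on (plate l)) g"
  proof (rule Bochner_Integration.integrable_bound)
    show "integrable (lebesgue_on (plate l)) (\<lambda>z. 1 + (g z)\<^sup>2)"
    proof (rule Bochner_Integration.integrable_add[OF _ g2])
      have "finite_measure (lebesgue_on (plate l))"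
        by (rule finite_measureI) (use fin plate_sets(3)[of l] in \<open>simp add: emeasure_restrict_space space_restrict_space\<close>)
      then show "integrable (lebesgue_on (plate l)) (\<lambda>z. 1 :: real)"
        by (rule finite_measure.integrable_const)
    qed
    show "AE z in lebesgue_on (plate l). norm (g z) \<le> norm (1 + (g z)\<^sup>2)"
    proof (rule AE_I2)
      fix z
      have "0 \<le> (\<bar>g z\<bar> - 1 / 2)\<^sup>2" by simp
      then have "\<bar>g z\<bar> \<le> 1 / 4 + (g z)\<^sup>2" by (simp add: power2_diff power_divide)
      then show "norm (g z) \<le> norm (1 + (g z)\<^sup>2)" by simp
    qed
  qed (rule gm)
  then have "integrable lebesgue (\<lambda>z. indicator (plate l) z *\<^sub>R g z)"
    by (subst (asm) integrable_restrict_space) (auto simp: plate_sets)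
  moreover have ae: "AE z in lborel. indicator (plate l) z *\<^sub>R g z = h z"
    using k(2) by eventually_elim (auto simp: h_def indicator_def)
  moreover have hl: "h \<in> borel_measurable lebesgue"
    by (rule measurable_completion) (use hm in simp)
  ultimately have "integrable lebesgue h"
    using integrable_cong_AE_imp[OF _ hl AE_completion] by (auto simp: eq_commute)
  then have hi: "integrable lborel h" using integrable_completion[of h lborel] hm by simp
  have "plate_rep l g h"
    unfolding plate_rep_def
  proof (intro conjI gm hm hi)
    show "AE z in lborel. z \<in> plate l \<longrightarrow> g z = h z" using ae by eventually_elim auto
    show "\<forall>z. z \<notin> {0..pi} \<times> {-l..l} \<longrightarrow> h z = 0" by (auto simp: h_def plate_def indicator_def)
  qed
  then show ?thesis by (rule that)
qed

lemma plate_rep_continuous: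
  assumes f: "continuous_on ({0..pi} \<times> {-l..l}) f"
  shows "plate_rep l f (\<lambda>z. indicator ({0..pi} \<times> {-l..l}) z *\<^sub>R f z)" and "f \<in> L2 (plate l)"
proof -
  let ?R = "{0..pi} \<times> {-l..l}"
  have R: "?R = cbox (0, - l) (pi, l)" by (simp add: cbox_Pair_eq)
  have Rs: "?R \<in> sets borel" unfolding R by simp
  have hl: "f \<in> borel_measurable lebesgue" if "f \<in> borel_measurable borel" for f :: "real \<times> real \<Rightarrow> real"
    by (rule measurable_completion) (use that in simp)
  have m: "(\<lambda>z. indicator ?R z *\<^sub>R f z) \<in> borel_measurable borel"
    by (rule borel_measurable_continuous_on_indicator[OF Rs f])
  have sub: "plate l \<subseteq> ?R" by (auto simp: plate_def)
  have eq: "indicator (plate l) z *\<^sub>R f z = indicator (plate l) z *\<^sub>R (indicator ?R z *\<^sub>R f z)" for z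
    using sub by (auto simp: indicator_def)
  have "(\<lambda>z. indicator (plate l) z *\<^sub>R (indicator ?R z *\<^sub>R f z)) \<in> borel_measurable lebesgue"
    by (intro borel_measurable_scaleR borel_measurable_indicator plate_sets hl m)
  then have "(\<lambda>z. indicator (plate l) z *\<^sub>R f z) \<in> borel_measurable lebesgue"
    by (simp only: eq[symmetric])
  then have gm: "f \<in> borel_measurable (lebesgue_on (plate l))"
    by (subst borel_measurable_restrict_space_iff) (auto simp: plate_sets)
  have int: "integrable lborel (\<lambda>z. indicator ?R z *\<^sub>R g z)" if "continuous_on ?R g" for g :: "real \<times> real \<Rightarrow> real"
    unfolding R by (rule borel_integrable_compact) (use that R in auto)
  show "plate_rep l f (\<lambda>z. indicator ({0..pi} \<times> {-l..l}) z *\<^sub>R f z)"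
    unfolding plate_rep_def
  proof (intro conjI gm m int[OF f])
    show "AE z in lborel. z \<in> plate l \<longrightarrow> f z = indicator ?R z *\<^sub>R f z"
      by (rule AE_I2) (use sub in \<open>auto simp: indicator_def\<close>)
  qed auto
  have "integrable lborel (\<lambda>z. indicator (plate l) z *\<^sub>R (indicator ?R z *\<^sub>R (f z)\<^sup>2))"
    by (rule integrable_mult_indicator) (use plate_sets int continuous_on_power[OF f] in auto)
  also have "(\<lambda>z. indicator (plate l) z *\<^sub>R (indicator ?R z *\<^sub>R (f z)\<^sup>2)) = (\<lambda>z. indicator (plate l) z *\<^sub>R (f z)\<^sup>2)"
    by (rule ext) (use sub in \<open>auto simp: indicator_def\<close>)
  finally have i: "integrable lborel (\<lambda>z. indicator (plate l) z *\<^sub>R (f z)\<^sup>2)" .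
  then have "integrable lebesgue (\<lambda>z. indicator (plate l) z *\<^sub>R (f z)\<^sup>2)"
    using integrable_completion borel_measurable_integrable by blast
  then have "integrable (lebesgue_on (plate l)) (\<lambda>z. (f z)\<^sup>2)"
    by (subst integrable_restrict_space) (auto simp: plate_sets)
  then show "f \<in> L2 (plate l)" using gm by (simp add: L2_def)
qed

section \<open>Marginals and the fundamental lemma on the plate\<close>

locale plate_fun =
  fixes l :: real and h :: "real \<times> real \<Rightarrow> real"
  assumes l: "l > 0" and hm: "h \<in> borel_measurable borel" and hi: "integrable lborel h"
    and hz: "\<And>z. z \<notin> {0..pi} \<times> {-l..l} \<Longrightarrow> h z = 0"
begin

lemma h_mult_integrable:
  assumes p: "continuous_on ({0..pi} \<times> {-l..l}) p"
  shows "integrable lborel (\<lambda>z. h z * p z)"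
proof -
  let ?R = "{0..pi} \<times> {-l..l}"
  have R: "?R = cbox (0, - l) (pi, l)" by (simp add: cbox_Pair_eq)
  have "compact (p ` ?R)" by (rule compact_continuous_image[OF p]) (simp add: R)
  then obtain K where K: "\<And>z. z \<in> ?R \<Longrightarrow> \<bar>p z\<bar> \<le> K"
    by (force dest!: compact_imp_bounded simp: bounded_iff)
  have m: "(\<lambda>z. indicator ?R z *\<^sub>R p z) \<in> borel_measurable borel"
    by (rule borel_measurable_continuous_on_indicator[OF _ p]) (simp add: R)
  have eq: "h z * p z = h z * (indicator ?R z *\<^sub>R p z)" for z
    using hz[of z] by (cases "z \<in> ?R") auto
  show ?thesis
    unfolding eq
  proof (rule Bochner_Integration.integrable_bound[OF integrable_mult_right[OF hi, of K]])
    show "(\<lambda>z. h z * (indicator ?R z *\<^sub>R p z)) \<in> borel_measurable lborel"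
      using borel_measurable_times[OF hm m] by simp
    show "AE z in lborel. norm (h z * (indicator ?R z *\<^sub>R p z)) \<le> norm (K * h z)"
    proof (rule AE_I2)
      fix z
      show "norm (h z * (indicator ?R z *\<^sub>R p z)) \<le> norm (K * h z)"
      proof (cases "z \<in> ?R")
        case True
        have "\<bar>h z\<bar> * \<bar>p z\<bar> \<le> \<bar>h z\<bar> * \<bar>K\<bar>" using K[OF True] by (intro mult_left_mono) auto
        then show ?thesis using True by (simp add: abs_mult mult.commute)
      qed simp
    qed
  qed
qed

lemma tensor_integrable:
  assumes "continuous_on {0..pi} p" "continuous_on {-l..l} q"
  shows "integrable (lborel \<Otimes>\<^sub>M lborel) (\<lambda>(x, y). h (x, y) * (p x * q y))"
proof -
  have "continuous_on ({0..pi} \<times> {-l..l}) (\<lambda>z. p (fst z) * q (snd z))"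
    by (intro continuous_intros continuous_on_compose2[OF assms(1)] continuous_on_compose2[OF assms(2)]) auto
  from h_mult_integrable[OF this] show ?thesis by (simp add: lborel_prod case_prod_unfold)
qed

definition margy where "margy p y = (\<integral>x. h (x, y) * p x \<partial>lborel)"
definition margx where "margx q x = (\<integral>y. h (x, y) * q y \<partial>lborel)"

lemma margy_integrable:
  assumes "continuous_on {0..pi} p"
  shows "set_integrable lborel {-l..l} (margy p)"
proof -
  have "integrable lborel (\<lambda>y. \<integral>x. h (x, y) * (p x * 1) \<partial>lborel)"
    by (rule lborel_pair.integrable_snd) (rule tensor_integrable[OF assms continuous_on_const])
  then show ?thesis unfolding set_integrable_def margy_def
    by (intro integrable_mult_indicator) auto
qed

lemma margx_integrable:
  assumes "continuous_on {-l..l} q"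
  shows "set_integrable lborel {0..pi} (margx q)"
proof -
  have "integrable lborel (\<lambda>x. \<integral>y. h (x, y) * (1 * q y) \<partial>lborel)"
    by (rule lborel_pair.integrable_fst) (rule tensor_integrable[OF continuous_on_const assms])
  then show ?thesis unfolding set_integrable_def margx_def
    by (intro integrable_mult_indicator) auto
qed

lemma tensor_margy:
  assumes "continuous_on {0..pi} p" "continuous_on {-l..l} q"
  shows "(\<integral>z. h z * (p (fst z) * q (snd z)) \<partial>lborel) = (LINT y:{-l..l}|lborel. margy p y * q y)"
proof -
  have "(\<integral>z. h z * (p (fst z) * q (snd z)) \<partial>lborel) = (\<integral>y. (\<integral>x. h (x, y) * (p x * q y) \<partial>lborel) \<partial>lborel)"
    using lborel_pair.integral_snd[OF tensor_integrable[OF assms]] by (simp add: lborel_prod case_prod_unfold)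
  also have "\<dots> = (\<integral>y. indicator {-l..l} y *\<^sub>R (margy p y * q y) \<partial>lborel)"
  proof (rule Bochner_Integration.integral_cong[OF refl])
    fix y
    show "(\<integral>x. h (x, y) * (p x * q y) \<partial>lborel) = indicator {-l..l} y *\<^sub>R (margy p y * q y)"
    proof (cases "y \<in> {-l..l}")
      case True
      have "(\<integral>x. h (x, y) * (p x * q y) \<partial>lborel) = (\<integral>x. h (x, y) * p x * q y \<partial>lborel)" by (simp add: mult.assoc)
      then show ?thesis using True by (simp add: margy_def)
    next
      case False
      then have "h (x, y) = 0" for x by (intro hz) auto
      then show ?thesis using False by simp
    qed
  qed
  finally show ?thesis by (simp add: set_lebesgue_integral_def)
qed

lemma tensor_margx:
  assumes "continuous_on {0..pi} p" "continuous_on {-l..l} q"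
  shows "(\<integral>z. h z * (p (fst z) * q (snd z)) \<partial>lborel) = (LINT x:{0..pi}|lborel. margx q x * p x)"
proof -
  have "(\<integral>z. h z * (p (fst z) * q (snd z)) \<partial>lborel) = (\<integral>x. (\<integral>y. h (x, y) * (p x * q y) \<partial>lborel) \<partial>lborel)"
    using lborel_pair.integral_fst[OF tensor_integrable[OF assms]] by (simp add: lborel_prod case_prod_unfold)
  also have "\<dots> = (\<integral>x. indicator {0..pi} x *\<^sub>R (margx q x * p x) \<partial>lborel)"
  proof (rule Bochner_Integration.integral_cong[OF refl])
    fix x
    show "(\<integral>y. h (x, y) * (p x * q y) \<partial>lborel) = indicator {0..pi} x *\<^sub>R (margx q x * p x)"
    proof (cases "x \<in> {0..pi}")
      case True
      have "(\<integral>y. h (x, y) * (p x * q y) \<partial>lborel) = (\<integral>y. h (x, y) * q y * p x \<partial>lborel)" by (simp add: mult_ac)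
      then show ?thesis using True by (simp add: margx_def)
    next
      case False
      then have "h (x, y) = 0" for y by (intro hz) auto
      then show ?thesis using False by simp
    qed
  qed
  finally show ?thesis by (simp add: set_lebesgue_integral_def)
qed

text \<open>Testing against tensor products determines the integral over every lower-left rectangle,
  and these rectangles generate the Borel sets.\<close>

lemma AE_zero:
  assumes test: "\<And>A B. test_seq 0 pi A \<Longrightarrow> test_seq (-l) l B \<Longrightarrow> (\<integral>z. h z * (A 0 (fst z) * B 0 (snd z)) \<partial>lborel) = 0"
  shows "AE z in lborel. h z = 0"
proof -
  have c: "continuous_on S (A n)" if "test_seq a b A" for a b A n S
    using deriv_seq_continuous test_seq_deriv_seq[OF that] by blast
  have ll: "- l < l" "(0::real) < pi" using l by auto
  \<comment> \<open>The variables are freed one at a time. For fixed B the x-marginal of h is weakly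
    zero, so its integral over [0, a] vanishes; this says that the y-marginal of the truncation k of
    h is weakly zero in turn.\<close>
  have quadrant: "(\<integral>z. h z * indicator ({..a} \<times> {..b}) z \<partial>lborel) = 0" if ab: "a \<in> {0..pi}" "b \<in> {-l..l}" for a b
  proof -
    define k where "k = (\<lambda>z. h z * indicator {..a} (fst z))"
    interpret k: plate_fun l k
    proof
      have im: "(\<lambda>z::real\<times>real. indicator {..a} (fst z) :: real) \<in> borel_measurable borel"
        by (rule measurable_compose[of fst borel borel "indicator {..a}" borel])
           (auto intro!: borel_measurable_continuous_onI continuous_intros borel_measurable_indicator)
      then show "k \<in> borel_measurable borel" unfolding k_def using hm by simp
      then show "integrable lborel k"
        by (intro Bochner_Integration.integrable_bound[OF hi]) (auto simp: k_def indicator_def)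
      show "z \<notin> {0..pi} \<times> {- l..l} \<Longrightarrow> k z = 0" for z using hz[of z] by (simp add: k_def)
    qed (rule l)
    have 1: "(LINT x:{0..a}|lborel. margx (B 0) x) = 0" if B: "test_seq (-l) l B" for B
    proof -
      have "prim 0 pi (\<lambda>_. 0) (margx (B 0))"
        by (rule weak_zero[OF ll(2) margx_integrable[OF c[OF B]]])
           (use test[OF _ B] tensor_margx[OF c c[OF B]] in auto)
      from prim_integral[OF this ab(1)] show ?thesis by simp
    qed
    have 2: "(LINT y:{-l..l}|lborel. k.margy (\<lambda>_. 1) y * B 0 y) = 0" if B: "test_seq (-l) l B" for B
    proof -
      have "(LINT y:{-l..l}|lborel. k.margy (\<lambda>_. 1) y * B 0 y) = (\<integral>z. k z * (1 * B 0 (snd z)) \<partial>lborel)"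
        using k.tensor_margy[OF continuous_on_const c[OF B], of 1 0] by simp
      also have "\<dots> = (LINT x:{0..pi}|lborel. k.margx (B 0) x * 1)"
        using k.tensor_margx[OF continuous_on_const c[OF B], of 1 0] by simp
      also have "\<dots> = (LINT x:{0..a}|lborel. margx (B 0) x)"
        unfolding set_lebesgue_integral_def
      proof (rule Bochner_Integration.integral_cong[OF refl])
        fix x
        show "indicator {0..pi} x *\<^sub>R (k.margx (B 0) x * 1) = indicator {0..a} x *\<^sub>R margx (B 0) x"
          unfolding k.margx_def margx_def unfolding k_def using ab by (auto simp: indicator_def)
      qed
      finally show ?thesis using 1[OF B] by simp
    qed
    have "prim (-l) l (\<lambda>_. 0) (k.margy (\<lambda>_. 1))"
      by (rule weak_zero[OF ll(1) k.margy_integrable[OF continuous_on_const]]) (rule 2)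
    from prim_integral[OF this ab(2)] have "(LINT y:{-l..b}|lborel. k.margy (\<lambda>_. 1) y) = 0" by simp
    moreover have "(\<integral>z. h z * indicator ({..a} \<times> {..b}) z \<partial>lborel) = (LINT y:{-l..b}|lborel. k.margy (\<lambda>_. 1) y)"
    proof -
      have "integrable (lborel \<Otimes>\<^sub>M lborel) (\<lambda>(x, y). h (x, y) * indicator ({..a} \<times> {..b}) (x, y))"
        unfolding lborel_prod case_prod_beta prod.collapse
      proof (rule Bochner_Integration.integrable_bound[OF hi])
        have "({..a} \<times> {..b}) \<in> sets (borel :: (real \<times> real) measure)"
          by (simp add: borel_closed closed_Times)
        then show "(\<lambda>z. h z * indicator ({..a} \<times> {..b}) z) \<in> borel_measurable lborel" using hm by simp
      qed (auto simp: indicator_def)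
      from lborel_pair.integral_snd[OF this]
      have "(\<integral>z. h z * indicator ({..a} \<times> {..b}) z \<partial>lborel) = (\<integral>y. (\<integral>x. h (x, y) * indicator ({..a} \<times> {..b}) (x, y) \<partial>lborel) \<partial>lborel)"
        by (simp add: lborel_prod case_prod_unfold)
      also have "\<dots> = (\<integral>y. indicator {-l..b} y *\<^sub>R k.margy (\<lambda>_. 1) y \<partial>lborel)"
      proof (rule Bochner_Integration.integral_cong[OF refl])
        fix y
        have z: "h (x, y) = 0" if "y < - l" for x using that by (intro hz) auto
        show "(\<integral>x. h (x, y) * indicator ({..a} \<times> {..b}) (x, y) \<partial>lborel) = indicator {-l..b} y *\<^sub>R k.margy (\<lambda>_. 1) y"
        proof (cases "y < - l")
          case False
          then have "indicator {-l..b} y = (indicator {..b} y :: real)" by (auto simp: indicator_def)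
          moreover have "(\<integral>x. h (x, y) * indicator ({..a} \<times> {..b}) (x, y) \<partial>lborel) = (\<integral>x. h (x, y) * indicator {..a} x * indicator {..b} y \<partial>lborel)"
            by (simp only: indicator_times fst_conv snd_conv mult.assoc)
          ultimately show ?thesis unfolding k.margy_def unfolding k_def by (simp add: mult.commute)
        qed (simp add: z)
      qed
      finally show ?thesis by (simp add: set_lebesgue_integral_def)
    qed
    ultimately show ?thesis by simp
  qed
  \<comment> \<open>As h vanishes outside the closed rectangle, the corner may be moved into it, or
    else the integrand is 0.\<close>
  have quadrant': "(\<integral>z. h z * indicator ({..a} \<times> {..b}) z \<partial>lborel) = 0" for a b
  proof (cases "a < 0 \<or> b < - l")
    case True
    then have "(\<lambda>z. h z * indicator ({..a} \<times> {..b}) z) = (\<lambda>z. 0)" using hz by (fastforce simp: indicator_def)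
    then show ?thesis by simp
  next
    case False
    then have "(\<lambda>z. h z * indicator ({..a} \<times> {..b}) z) = (\<lambda>z. h z * indicator ({..min a pi} \<times> {..min b l}) z)"
      using hz by (fastforce simp: indicator_def)
    then show ?thesis using quadrant[of "min a pi" "min b l"] False l by (auto simp: min_def)
  qed
  define Gen where "Gen = range (\<lambda>p :: real \<times> real. {..fst p} \<times> {..snd p})"
  have gen: "sets (borel :: (real \<times> real) measure) = sigma_sets UNIV Gen"
  proof -
    have "Gen = range (\<lambda>p. {..p})"
      unfolding Gen_def by (rule arg_cong[where f = range]) (auto simp: less_eq_prod_def)
    then show ?thesis by (subst borel_eq_atMost) simp
  qed
  have tot: "(\<integral>z. h z \<partial>lborel) = 0"
  proof -
    have "(\<lambda>z. h z * indicator ({..pi} \<times> {..l}) z) = h" using hz by (fastforce simp: indicator_def)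
    then show ?thesis using quadrant'[of pi l] by simp
  qed
  have i: "integrable lborel (\<lambda>z. indicator S z * h z)" if "S \<in> sets borel" for S
    using integrable_mult_indicator[of S lborel h] that hi by simp
  have all: "(\<integral>z. indicator S z * h z \<partial>lborel) = 0" if "S \<in> sigma_sets UNIV Gen" for S
  proof (rule sigma_sets_induct_disjoint[OF _ _ that])
    show "Int_stable Gen"
    proof (rule Int_stableI)
      fix a b assume "a \<in> Gen" "b \<in> Gen"
      then obtain p q :: "real \<times> real" where "a = {..fst p} \<times> {..snd p}" "b = {..fst q} \<times> {..snd q}" by (auto simp: Gen_def)
      then have "a \<inter> b = {..fst (min (fst p) (fst q), min (snd p) (snd q))} \<times> {..snd (min (fst p) (fst q), min (snd p) (snd q))}"
        by auto
      then show "a \<inter> b \<in> Gen" unfolding Gen_def by blast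
    qed
    show "Gen \<subseteq> Pow UNIV" by simp
    show "(\<integral>z. indicator S z * h z \<partial>lborel) = 0" if "S \<in> Gen" for S
      using quadrant' that by (auto simp: Gen_def mult.commute)
    show "(\<integral>z. indicator (UNIV - S) z * h z \<partial>lborel) = 0"
      if "S \<in> sigma_sets UNIV Gen" "(\<integral>z. indicator S z * h z \<partial>lborel) = 0" for S
    proof -
      have "(\<lambda>z. indicator (UNIV - S) z * h z) = (\<lambda>z. h z - indicator S z * h z)" by (auto simp: indicator_def)
      then show ?thesis using hi i[of S] that tot by (simp add: gen)
    qed
    show "(\<integral>z. indicator (\<Union>i. S i) z * h z \<partial>lborel) = 0"
      if dj: "disjoint_family S" and S: "range S \<subseteq> sigma_sets UNIV Gen" and z: "\<And>i. (\<integral>z. indicator (S i) z * h z \<partial>lborel) = 0"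
      for S :: "nat \<Rightarrow> _"
    proof -
      have "set_lebesgue_integral lborel (\<Union>i. S i) h = (\<Sum>i. set_lebesgue_integral lborel (S i) h)"
      proof (rule lebesgue_integral_countable_add)
        show "S i \<in> sets lborel" for i using S gen by auto
        show "S i \<inter> S j = {}" if "i \<noteq> j" for i j using dj that by (auto simp: disjoint_family_on_def)
        have "(\<Union>i. S i) \<in> sets borel"
          using S unfolding gen[symmetric] by (rule sets.countable_UN)
        from i[OF this] show "set_integrable lborel (\<Union>i. S i) h" by (simp add: set_integrable_def)
      qed
      then show ?thesis using z by (simp add: set_lebesgue_integral_def)
    qed
  qed simp
  show ?thesis
  proof (rule density_unique_real[OF hi])
    fix S :: "(real \<times> real) set" assume "S \<in> sets lborel"
    then show "set_lebesgue_integral lborel S h = set_lebesgue_integral lborel S (\<lambda>_. 0)"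
      using all[of S] gen by (simp add: set_lebesgue_integral_def)
  qed simp
qed

end

section \<open>Test functions and weak derivatives on the plate\<close>

lemma C_k_lincomb:
  "C_k k f \<Longrightarrow> C_k k g \<Longrightarrow> C_k k (\<lambda>z. a * f z + b * g z)"
proof (induction k arbitrary: f g)
  case (Suc k)
  have d: "((\<lambda>z. a * f z + b * g z) has_derivative (\<lambda>v. a * frechet_derivative f (at z) v + b * frechet_derivative g (at z) v)) (at z)" for z
    using Suc.prems by (intro has_derivative_add has_derivative_mult_right) (auto simp: frechet_derivative_works)
  show ?case
    unfolding C_k.simps
  proof (intro conjI allI)
    show "(\<lambda>z. a * f z + b * g z) differentiable at z" for z
      using d differentiable_def by blast
    show "C_k k (\<lambda>z. frechet_derivative (\<lambda>z. a * f z + b * g z) (at z) v)" for v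
      unfolding frechet_derivative_at[OF d, symmetric] using Suc by auto
  qed
qed (auto intro!: continuous_intros)

definition tensor :: "(real \<Rightarrow> real) \<Rightarrow> (real \<Rightarrow> real) \<Rightarrow> real \<times> real \<Rightarrow> real" where
  "tensor a b z = a (fst z) * b (snd z)"

lemma tensor_has_derivative:
  assumes "(a has_real_derivative a') (at (fst z))" "(b has_real_derivative b') (at (snd z))"
  shows "(tensor a b has_derivative (\<lambda>v. fst v * (a' * b (snd z)) + snd v * (a (fst z) * b'))) (at z)"
proof -
  have a: "((\<lambda>z. a (fst z)) has_derivative (\<lambda>v. a' * fst v)) (at z)"
    by (rule has_derivative_compose[OF has_derivative_fst[OF has_derivative_ident]])
       (use assms(1) in \<open>simp add: has_field_derivative_def\<close>)
  have b: "((\<lambda>z. b (snd z)) has_derivative (\<lambda>v. b' * snd v)) (at z)"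
    by (rule has_derivative_compose[OF has_derivative_snd[OF has_derivative_ident]])
       (use assms(2) in \<open>simp add: has_field_derivative_def\<close>)
  show ?thesis
    using has_derivative_mult[OF a b] unfolding tensor_def[abs_def]
    by (rule has_derivative_eq_rhs) (auto simp: algebra_simps)
qed

lemma tensor_continuous:
  assumes "continuous_on UNIV a" "continuous_on UNIV b" shows "continuous_on S (tensor a b)"
  unfolding tensor_def[abs_def]
  by (intro continuous_intros continuous_on_compose2[OF assms(1)] continuous_on_compose2[OF assms(2)]) auto

text \<open>A directional derivative of a tensor is a combination of two tensors with one index
  raised, so the induction runs over all index pairs at once.\<close>

lemma tensor_C_k:
  assumes A: "deriv_seq A" and B: "deriv_seq B"
  shows "C_k k (tensor (A i) (B j))"
proof (induction k arbitrary: i j)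
  case (Suc k)
  have d: "(tensor (A i) (B j) has_derivative
      (\<lambda>v. fst v * (A (Suc i) (fst z) * B j (snd z)) + snd v * (A i (fst z) * B (Suc j) (snd z)))) (at z)" for z
    by (intro tensor_has_derivative deriv_seqD A B)
  show ?case
    unfolding C_k.simps
  proof (intro conjI allI)
    show "tensor (A i) (B j) differentiable at z" for z
      using d differentiable_def by blast
    show "C_k k (\<lambda>z. frechet_derivative (tensor (A i) (B j)) (at z) v)" for v
      unfolding frechet_derivative_at[OF d, symmetric]
      using C_k_lincomb[OF Suc.IH[of "Suc i" j] Suc.IH[of i "Suc j"], of "fst v" "snd v"]
      by (simp add: tensor_def)
  qed
qed (simp add: tensor_continuous deriv_seq_continuous A B)

lemma tensor_test_function:
  assumes A: "test_seq 0 pi A" and B: "test_seq (-l) l B"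
  shows "tensor (A i) (B j) \<in> test_functions (plate l)"
proof -
  obtain c d where cd: "0 < c" "d < pi" "\<And>n x. x \<notin> {c..d} \<Longrightarrow> A n x = 0" using A by (auto elim!: test_seqE)
  obtain e f where ef: "- l < e" "f < l" "\<And>n x. x \<notin> {e..f} \<Longrightarrow> B n x = 0" using B by (auto elim!: test_seqE)
  let ?K = "cbox (c, e) (d, f)"
  have "{z. tensor (A i) (B j) z \<noteq> 0} \<subseteq> ?K"
    using cd(3) ef(3) by (force simp: tensor_def cbox_Pair_eq)
  then have K: "closure {z. tensor (A i) (B j) z \<noteq> 0} \<subseteq> ?K"
    by (rule closure_minimal) (rule closed_cbox)
  have "compact (closure {z. tensor (A i) (B j) z \<noteq> 0})"
    using compact_Int_closed[OF compact_cbox closed_closure] K by (metis inf.absorb_iff2)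
  moreover have "?K \<subseteq> plate l"
    using cd ef by (auto simp: cbox_Pair_eq plate_def)
  ultimately show ?thesis
    using K tensor_C_k[OF test_seq_deriv_seq[OF A] test_seq_deriv_seq[OF B]] by (auto simp: test_functions_def)
qed

lemma tensor_partial_y:
  assumes "deriv_seq B" shows "(partial_y ^^ j) (tensor a (B 0)) = tensor a (B j)"
proof (induction j)
  case (Suc j)
  have "partial_y (tensor a (B j)) = tensor a (B (Suc j))"
  proof
    fix z :: "real \<times> real"
    have "((\<lambda>t. a (fst z) * B j t) has_real_derivative a (fst z) * B (Suc j) (snd z)) (at (snd z))"
      by (intro DERIV_cmult deriv_seqD assms)
    from DERIV_imp_deriv[OF this] show "partial_y (tensor a (B j)) z = tensor a (B (Suc j)) z"
      by (cases z) (simp add: partial_y_def tensor_def)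
  qed
  then show ?case using Suc by simp
qed simp

lemma tensor_partial_x:
  assumes "deriv_seq A" shows "(partial_x ^^ i) (tensor (A 0) b) = tensor (A i) b"
proof (induction i)
  case (Suc i)
  have "partial_x (tensor (A i) b) = tensor (A (Suc i)) b"
  proof
    fix z :: "real \<times> real"
    have "((\<lambda>t. A i t * b (snd z)) has_real_derivative A (Suc i) (fst z) * b (snd z)) (at (fst z))"
      by (intro DERIV_cmult_right deriv_seqD assms)
    from DERIV_imp_deriv[OF this] show "partial_x (tensor (A i) b) z = tensor (A (Suc i)) b z"
      by (cases z) (simp add: partial_x_def tensor_def)
  qed
  then show ?case using Suc by simp
qed simp

lemma weak_derivative_tensor:
  assumes "has_weak_derivative (plate l) i j u g" "test_seq 0 pi A" "test_seq (-l) l B"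
  shows "(\<integral>z. u z * tensor (A i) (B j) z \<partial>(lebesgue_on (plate l))) =
    (-1) ^ (i + j) * (\<integral>z. g z * tensor (A 0) (B 0) z \<partial>(lebesgue_on (plate l)))"
proof -
  have "(\<integral>z. u z * (partial_x ^^ i) ((partial_y ^^ j) (tensor (A 0) (B 0))) z \<partial>(lebesgue_on (plate l))) =
    (-1) ^ (i + j) * (\<integral>z. g z * tensor (A 0) (B 0) z \<partial>(lebesgue_on (plate l)))"
    using assms(1) tensor_test_function[OF assms(2,3), of 0 0] unfolding has_weak_derivative_def by blast
  then show ?thesis
    by (simp only: tensor_partial_y[OF test_seq_deriv_seq[OF assms(3)]] tensor_partial_x[OF test_seq_deriv_seq[OF assms(2)]])
qed

lemma plate_rep_plate_fun:
  assumes "l > 0" "plate_rep l g h" shows "plate_fun l h"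
  using assms unfolding plate_rep_def plate_fun_def by blast

lemma plate_rep_diff:
  assumes "plate_rep l g h" "plate_rep l g' h'"
  shows "plate_rep l (\<lambda>z. g z - g' z) (\<lambda>z. h z - h' z)"
  unfolding plate_rep_def
proof (intro conjI)
  show "AE z in lborel. z \<in> plate l \<longrightarrow> g z - g' z = h z - h' z"
    using assms unfolding plate_rep_def by (auto elim: eventually_elim2)
qed (use assms in \<open>auto simp: plate_rep_def\<close>)

lemma tensor_measurable:
  assumes "continuous_on UNIV a" "continuous_on UNIV b" shows "tensor a b \<in> borel_measurable borel"
  by (rule borel_measurable_continuous_onI) (rule tensor_continuous[OF assms])

lemma test_seq_continuous: "test_seq a b A \<Longrightarrow> continuous_on S (A n)"
  using deriv_seq_continuous test_seq_deriv_seq by blast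

text \<open>Tensor products already separate integrable functions, by \<open>AE_zero\<close>. This
  ties the arbitrary choice made in \<open>weak_derivative\<close> to derivatives that can be
  computed.\<close>

lemma weak_derivative_unique:
  assumes l: "l > 0" and g: "plate_rep l g h" and g': "plate_rep l g' h'"
    and w: "has_weak_derivative (plate l) i j u g" and w': "has_weak_derivative (plate l) i j u g'"
  shows "AE z in lborel. h z = h' z"
proof -
  interpret plate_fun l "\<lambda>z. h z - h' z"
    by (rule plate_rep_plate_fun[OF l plate_rep_diff[OF g g']])
  interpret h: plate_fun l h by (rule plate_rep_plate_fun[OF l g])
  interpret h': plate_fun l h' by (rule plate_rep_plate_fun[OF l g'])
  have "AE z in lborel. h z - h' z = 0"
  proof (rule AE_zero)
    fix A B assume A: "test_seq 0 pi A" and B: "test_seq (-l) l B"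
    note c = test_seq_continuous[OF A] test_seq_continuous[OF B]
    have t: "tensor (A 0) (B 0) \<in> borel_measurable borel" by (intro tensor_measurable c)
    have "(\<integral>z. g z * tensor (A 0) (B 0) z \<partial>(lebesgue_on (plate l))) = (\<integral>z. g' z * tensor (A 0) (B 0) z \<partial>(lebesgue_on (plate l)))"
      using weak_derivative_tensor[OF w A B] weak_derivative_tensor[OF w' A B] by simp
    then have "(\<integral>z. h z * tensor (A 0) (B 0) z \<partial>lborel) = (\<integral>z. h' z * tensor (A 0) (B 0) z \<partial>lborel)"
      by (simp only: plate_rep_integral[OF g t] plate_rep_integral[OF g' t])
    moreover have "(\<integral>z. (h z - h' z) * tensor (A 0) (B 0) z \<partial>lborel) =
       (\<integral>z. h z * tensor (A 0) (B 0) z \<partial>lborel) - (\<integral>z. h' z * tensor (A 0) (B 0) z \<partial>lborel)"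
      unfolding left_diff_distrib
      by (intro Bochner_Integration.integral_diff h.h_mult_integrable h'.h_mult_integrable tensor_continuous c)
    ultimately show "(\<integral>z. (h z - h' z) * (A 0 (fst z) * B 0 (snd z)) \<partial>lborel) = 0" by (simp add: tensor_def)
  qed
  then show ?thesis by simp
qed

section \<open>Integration by parts against test functions\<close>

lemma test_function_facts:
  assumes \<tau>: "\<tau> \<in> test_functions (plate l)"
  shows "continuous_on UNIV \<tau>" "(\<tau> has_derivative frechet_derivative \<tau> (at z)) (at z)" "z \<notin> plate l \<Longrightarrow> \<tau> z = 0"
proof -
  have "C_k 0 \<tau>" "C_k (Suc 0) \<tau>" using \<tau> unfolding test_functions_def by blast+
  then have "continuous_on UNIV \<tau>" "\<tau> differentiable (at z)" unfolding C_k.simps by blast+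
  then show "continuous_on UNIV \<tau>" "(\<tau> has_derivative frechet_derivative \<tau> (at z)) (at z)"
    by (simp_all only: frechet_derivative_works)
  show "z \<notin> plate l \<Longrightarrow> \<tau> z = 0" using \<tau> closure_subset[of "{z. \<tau> z \<noteq> 0}"] by (auto simp: test_functions_def)
qed

text \<open>The axis-wise \<open>deriv\<close> of the definitions is a directional Frechet
  derivative. The latter stays smooth by the recursion in \<open>C_k\<close>, and its support does
  not grow.\<close>

lemma test_function_partial:
  assumes \<tau>: "\<tau> \<in> test_functions (plate l)"
  shows "((\<lambda>s. \<tau> (s, y)) has_real_derivative partial_x \<tau> (x, y)) (at x)"
    "((\<lambda>t. \<tau> (x, t)) has_real_derivative partial_y \<tau> (x, y)) (at y)"
    "partial_x \<tau> \<in> test_functions (plate l)" "partial_y \<tau> \<in> test_functions (plate l)"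
proof -
  note D = test_function_facts(2)[OF \<tau>]
  have dir: "(\<lambda>z. frechet_derivative \<tau> (at z) v) \<in> test_functions (plate l)" for v
  proof -
    have k: "C_k k (\<lambda>z. frechet_derivative \<tau> (at z) v)" for k
    proof -
      have "C_k (Suc k) \<tau>" using \<tau> unfolding test_functions_def by blast
      then show ?thesis unfolding C_k.simps by blast
    qed
    have z: "frechet_derivative \<tau> (at z) v = 0" if "z \<notin> closure {z. \<tau> z \<noteq> 0}" for z
    proof -
      have "open (- closure {z. \<tau> z \<noteq> 0})" by auto
      then have "(\<tau> has_derivative (\<lambda>_. 0)) (at z)"
        by (rule has_derivative_transform_within_open[OF has_derivative_const[of 0]])
           (use that closure_subset[of "{z. \<tau> z \<noteq> 0}"] in auto)
      then have "frechet_derivative \<tau> (at z) = (\<lambda>_. 0)" using D has_derivative_unique by blast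
      then show ?thesis by simp
    qed
    have sub: "closure {z. frechet_derivative \<tau> (at z) v \<noteq> 0} \<subseteq> closure {z. \<tau> z \<noteq> 0}"
      by (rule closure_minimal) (use z in auto)
    moreover have "compact (closure {z. frechet_derivative \<tau> (at z) v \<noteq> 0})"
      using compact_Int_closed[OF _ closed_closure, of "closure {z. \<tau> z \<noteq> 0}" "{z. frechet_derivative \<tau> (at z) v \<noteq> 0}"] sub \<tau>
      by (auto simp: test_functions_def Int_absorb1)
    ultimately show ?thesis using k \<tau> by (auto simp: test_functions_def)
  qed
  have dx: "((\<lambda>s. \<tau> (s, y)) has_real_derivative frechet_derivative \<tau> (at (x, y)) (1, 0)) (at x)" for x y
  proof -
    have lin: "linear (frechet_derivative \<tau> (at (x, y)))" using D has_derivative_linear by blast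
    have "((\<lambda>s. (s, y)) has_derivative (\<lambda>h. (h, 0))) (at x)" by (auto intro!: derivative_eq_intros)
    from has_derivative_compose[OF this, of \<tau>] D
    have "((\<lambda>s. \<tau> (s, y)) has_derivative (\<lambda>h. frechet_derivative \<tau> (at (x, y)) (h, 0))) (at x)" by blast
    also have "(\<lambda>h. frechet_derivative \<tau> (at (x, y)) (h, 0)) = (*) (frechet_derivative \<tau> (at (x, y)) (1, 0))"
    proof
      show "frechet_derivative \<tau> (at (x, y)) (h, 0) = frechet_derivative \<tau> (at (x, y)) (1, 0) * h" for h
        using linear_scale[OF lin, of h "(1, 0)"] by simp
    qed
    finally show ?thesis by (simp only: has_field_derivative_def)
  qed
  have dy: "((\<lambda>t. \<tau> (x, t)) has_real_derivative frechet_derivative \<tau> (at (x, y)) (0, 1)) (at y)" for x y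
  proof -
    have lin: "linear (frechet_derivative \<tau> (at (x, y)))" using D has_derivative_linear by blast
    have "((\<lambda>t. (x, t)) has_derivative (\<lambda>h. (0, h))) (at y)" by (auto intro!: derivative_eq_intros)
    from has_derivative_compose[OF this, of \<tau>] D
    have "((\<lambda>t. \<tau> (x, t)) has_derivative (\<lambda>h. frechet_derivative \<tau> (at (x, y)) (0, h))) (at y)" by blast
    also have "(\<lambda>h. frechet_derivative \<tau> (at (x, y)) (0, h)) = (*) (frechet_derivative \<tau> (at (x, y)) (0, 1))"
    proof
      show "frechet_derivative \<tau> (at (x, y)) (0, h) = frechet_derivative \<tau> (at (x, y)) (0, 1) * h" for h
        using linear_scale[OF lin, of h "(0, 1)"] by simp
    qed
    finally show ?thesis by (simp only: has_field_derivative_def)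
  qed
  have px: "partial_x \<tau> = (\<lambda>z. frechet_derivative \<tau> (at z) (1, 0))"
    using DERIV_imp_deriv[OF dx] by (auto simp: partial_x_def)
  have py: "partial_y \<tau> = (\<lambda>z. frechet_derivative \<tau> (at z) (0, 1))"
    using DERIV_imp_deriv[OF dy] by (auto simp: partial_y_def)
  show "((\<lambda>s. \<tau> (s, y)) has_real_derivative partial_x \<tau> (x, y)) (at x)" using dx by (simp add: px)
  show "((\<lambda>t. \<tau> (x, t)) has_real_derivative partial_y \<tau> (x, y)) (at y)" using dy by (simp add: py)
  show "partial_x \<tau> \<in> test_functions (plate l)" "partial_y \<tau> \<in> test_functions (plate l)"
    unfolding px py by (rule dir)+
qed

lemma test_function_pow:
  assumes "\<tau> \<in> test_functions (plate l)"
  shows "(partial_x ^^ i) \<tau> \<in> test_functions (plate l)" "(partial_y ^^ i) \<tau> \<in> test_functions (plate l)"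
  using assms by (induction i) (auto intro: test_function_partial)

lemma plate_integral_continuous:
  fixes f :: "real \<times> real \<Rightarrow> real"
  assumes f: "continuous_on UNIV f"
  shows "(\<integral>z. f z \<partial>(lebesgue_on (plate l))) = (\<integral>z. indicator ({0..pi} \<times> {-l..l}) z *\<^sub>R f z \<partial>lborel)"
  using plate_rep_integral[OF plate_rep_continuous(1)[OF continuous_on_subset[OF f subset_UNIV]], of "\<lambda>_. 1"] by simp

lemma plate_integral_iterated:
  fixes f :: "real \<times> real \<Rightarrow> real"
  assumes f: "continuous_on UNIV f"
  shows "(\<integral>z. f z \<partial>(lebesgue_on (plate l))) = (LINT y:{-l..l}|lborel. LINT x:{0..pi}|lborel. f (x, y))"
    "(\<integral>z. f z \<partial>(lebesgue_on (plate l))) = (LINT x:{0..pi}|lborel. LINT y:{-l..l}|lborel. f (x, y))"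
proof -
  let ?g = "\<lambda>(x, y). indicator {0..pi} x * indicator {-l..l} y * f (x, y)"
  have R: "{0..pi} \<times> {-l..l} = cbox (0, - l) (pi, l)" by (simp add: cbox_Pair_eq)
  have "integrable lborel (\<lambda>z. indicator ({0..pi} \<times> {-l..l}) z *\<^sub>R f z)"
    unfolding R by (intro borel_integrable_compact compact_cbox continuous_on_subset[OF f]) auto
  also have eq: "(\<lambda>z. indicator ({0..pi} \<times> {-l..l}) z *\<^sub>R f z) = ?g"
    by (auto simp: indicator_times)
  finally have i: "integrable (lborel \<Otimes>\<^sub>M lborel) ?g" by (simp only: lborel_prod)
  have "(\<integral>z. f z \<partial>(lebesgue_on (plate l))) = integral\<^sup>L (lborel \<Otimes>\<^sub>M lborel) ?g"
    unfolding plate_integral_continuous[OF f] eq lborel_prod ..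
  moreover have "(\<integral>x. ?g (x, y) \<partial>lborel) = indicator {-l..l} y * (\<integral>x. indicator {0..pi} x * f (x, y) \<partial>lborel)" for y
    by (subst integral_mult_right_zero[symmetric]) (simp add: mult_ac)
  moreover have "(\<integral>y. ?g (x, y) \<partial>lborel) = indicator {0..pi} x * (\<integral>y. indicator {-l..l} y * f (x, y) \<partial>lborel)" for x
    by (subst integral_mult_right_zero[symmetric]) (simp add: mult_ac)
  ultimately show "(\<integral>z. f z \<partial>(lebesgue_on (plate l))) = (LINT y:{-l..l}|lborel. LINT x:{0..pi}|lborel. f (x, y))"
    "(\<integral>z. f z \<partial>(lebesgue_on (plate l))) = (LINT x:{0..pi}|lborel. LINT y:{-l..l}|lborel. f (x, y))"
    using lborel_pair.integral_snd[OF i] lborel_pair.integral_fst[OF i]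
    unfolding set_lebesgue_integral_def by simp_all
qed

text \<open>The integration by parts is carried out on each line separately. The boundary terms
  vanish through \<tau>, so the factors a and b are free at the edges, as the Green functions
  require.\<close>

lemma tensor_parts:
  assumes l: "l > 0" and \<tau>: "\<tau> \<in> test_functions (plate l)"
    and c: "continuous_on UNIV a" "continuous_on UNIV b"
  shows "(\<And>x. (a has_real_derivative a' x) (at x)) \<Longrightarrow> continuous_on UNIV a' \<Longrightarrow>
      (\<integral>z. tensor a b z * partial_x \<tau> z \<partial>(lebesgue_on (plate l))) = - (\<integral>z. tensor a' b z * \<tau> z \<partial>(lebesgue_on (plate l)))"
    and "(\<And>y. (b has_real_derivative b' y) (at y)) \<Longrightarrow> continuous_on UNIV b' \<Longrightarrow>
      (\<integral>z. tensor a b z * partial_y \<tau> z \<partial>(lebesgue_on (plate l))) = - (\<integral>z. tensor a b' z * \<tau> z \<partial>(lebesgue_on (plate l)))"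
proof -
  note px = test_function_partial[OF \<tau>]
  note \<tau>c = test_function_facts(1)[OF \<tau>] test_function_facts(1)[OF px(3)] test_function_facts(1)[OF px(4)]
  note \<tau>0 = test_function_facts(3)[OF \<tau>]
  { assume a: "\<And>x. (a has_real_derivative a' x) (at x)" "continuous_on UNIV a'"
    have "(LINT x:{0..pi}|lborel. tensor a b (x, y) * partial_x \<tau> (x, y)) = - (LINT x:{0..pi}|lborel. tensor a' b (x, y) * \<tau> (x, y))" for y
    proof -
      have 1: "prim 0 pi a a'" by (intro prim_C1 a continuous_on_subset[OF a(2)]) auto
      have 2: "prim 0 pi (\<lambda>x. b y * \<tau> (x, y)) (\<lambda>x. b y * partial_x \<tau> (x, y))"
        by (intro prim_cmult prim_C1 px(1) continuous_on_compose2[OF \<tau>c(2)] continuous_intros) auto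
      have "\<tau> (0, y) = 0" "\<tau> (pi, y) = 0" by (auto intro!: \<tau>0 simp: plate_def)
      then show ?thesis using prim_parts[OF 1 2] by (simp add: tensor_def mult_ac)
    qed
    then have "(LINT y:{-l..l}|lborel. LINT x:{0..pi}|lborel. tensor a b (x, y) * partial_x \<tau> (x, y)) =
       - (LINT y:{-l..l}|lborel. LINT x:{0..pi}|lborel. tensor a' b (x, y) * \<tau> (x, y))"
      by (simp add: set_lebesgue_integral_def)
    then show "(\<integral>z. tensor a b z * partial_x \<tau> z \<partial>(lebesgue_on (plate l))) = - (\<integral>z. tensor a' b z * \<tau> z \<partial>(lebesgue_on (plate l)))"
      by (subst (1 2) plate_integral_iterated(1)) (intro continuous_intros tensor_continuous c a \<tau>c | assumption)+ }
  { assume b: "\<And>x. (b has_real_derivative b' x) (at x)" "continuous_on UNIV b'"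
    have "(LINT y:{-l..l}|lborel. tensor a b (x, y) * partial_y \<tau> (x, y)) = - (LINT y:{-l..l}|lborel. tensor a b' (x, y) * \<tau> (x, y))" for x
    proof -
      have 1: "prim (-l) l b b'" by (intro prim_C1 b continuous_on_subset[OF b(2)]) auto
      have 2: "prim (-l) l (\<lambda>y. a x * \<tau> (x, y)) (\<lambda>y. a x * partial_y \<tau> (x, y))"
        by (intro prim_cmult prim_C1 px(2) continuous_on_compose2[OF \<tau>c(3)] continuous_intros) auto
      have "\<tau> (x, - l) = 0" "\<tau> (x, l) = 0" by (auto intro!: \<tau>0 simp: plate_def)
      then show ?thesis using prim_parts[OF 1 2] l by (simp add: tensor_def mult_ac)
    qed
    then have "(LINT x:{0..pi}|lborel. LINT y:{-l..l}|lborel. tensor a b (x, y) * partial_y \<tau> (x, y)) =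
       - (LINT x:{0..pi}|lborel. LINT y:{-l..l}|lborel. tensor a b' (x, y) * \<tau> (x, y))"
      by (simp add: set_lebesgue_integral_def)
    then show "(\<integral>z. tensor a b z * partial_y \<tau> z \<partial>(lebesgue_on (plate l))) = - (\<integral>z. tensor a b' z * \<tau> z \<partial>(lebesgue_on (plate l)))"
      by (subst (1 2) plate_integral_iterated(2)) (intro continuous_intros tensor_continuous c b \<tau>c | assumption)+ }
qed

text \<open>Green functions are only twice continuously differentiable, their third derivative
  jumping at the pole, so \<open>deriv_seq\<close> would be too strong; only the entries 0, 1, 2 are
  constrained.\<close>

definition C2_seq :: "(nat \<Rightarrow> real \<Rightarrow> real) \<Rightarrow> bool" where
  "C2_seq a \<longleftrightarrow> (\<forall>i<2. \<forall>x. (a i has_real_derivative a (Suc i) x) (at x)) \<and> (\<forall>i\<le>2. continuous_on UNIV (a i))"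

lemma C2_seqD: "C2_seq a \<Longrightarrow> i < 2 \<Longrightarrow> (a i has_real_derivative a (Suc i) x) (at x)"
  and C2_seq_cont: "C2_seq a \<Longrightarrow> i \<le> 2 \<Longrightarrow> continuous_on UNIV (a i)"
  by (auto simp: C2_seq_def)

lemma tensor_weak_derivative:
  assumes l: "l > 0" and a: "C2_seq a" and b: "C2_seq b" and ij: "i \<le> 2" "j \<le> 2"
  shows "has_weak_derivative (plate l) i j (tensor (a 0) (b 0)) (tensor (a i) (b j))"
  unfolding has_weak_derivative_def
proof
  fix \<tau> assume \<tau>: "\<tau> \<in> test_functions (plate l)"
  have X: "(\<integral>z. tensor (a p) (b q) z * (partial_x ^^ i) \<sigma> z \<partial>(lebesgue_on (plate l))) =
      (-1) ^ i * (\<integral>z. tensor (a (p + i)) (b q) z * \<sigma> z \<partial>(lebesgue_on (plate l)))"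
    if "p + i \<le> 2" "q \<le> 2" "\<sigma> \<in> test_functions (plate l)" for p q i \<sigma>
    using that
  proof (induction i arbitrary: p)
    case (Suc i)
    have "(\<integral>z. tensor (a p) (b q) z * (partial_x ^^ Suc i) \<sigma> z \<partial>(lebesgue_on (plate l))) =
        - (\<integral>z. tensor (a (Suc p)) (b q) z * (partial_x ^^ i) \<sigma> z \<partial>(lebesgue_on (plate l)))"
      using tensor_parts(1)[OF l test_function_pow(1)[OF Suc.prems(3), of i], of "a p" "b q" "a (Suc p)"]
        C2_seqD[OF a, of p] C2_seq_cont[OF a] C2_seq_cont[OF b] Suc.prems by simp
    then show ?case using Suc.IH[of "Suc p"] Suc.prems by simp
  qed simp
  have Y: "(\<integral>z. tensor (a p) (b q) z * (partial_y ^^ i) \<sigma> z \<partial>(lebesgue_on (plate l))) =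
      (-1) ^ i * (\<integral>z. tensor (a p) (b (q + i)) z * \<sigma> z \<partial>(lebesgue_on (plate l)))"
    if "q + i \<le> 2" "p \<le> 2" "\<sigma> \<in> test_functions (plate l)" for p q i \<sigma>
    using that
  proof (induction i arbitrary: q)
    case (Suc i)
    have "(\<integral>z. tensor (a p) (b q) z * (partial_y ^^ Suc i) \<sigma> z \<partial>(lebesgue_on (plate l))) =
        - (\<integral>z. tensor (a p) (b (Suc q)) z * (partial_y ^^ i) \<sigma> z \<partial>(lebesgue_on (plate l)))"
      using tensor_parts(2)[OF l test_function_pow(2)[OF Suc.prems(3), of i], of "a p" "b q" "b (Suc q)"]
        C2_seqD[OF b, of q] C2_seq_cont[OF a] C2_seq_cont[OF b] Suc.prems by simp
    then show ?case using Suc.IH[of "Suc q"] Suc.prems by simp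
  qed simp
  show "(\<integral>z. tensor (a 0) (b 0) z * (partial_x ^^ i) ((partial_y ^^ j) \<tau>) z \<partial>(lebesgue_on (plate l))) =
      (-1) ^ (i + j) * (\<integral>z. tensor (a i) (b j) z * \<tau> z \<partial>(lebesgue_on (plate l)))"
    using X[of 0 i 0 "(partial_y ^^ j) \<tau>"] Y[of 0 j i \<tau>] ij \<tau> test_function_pow(2)[OF \<tau>] by (simp add: power_add)
qed

lemma tensor_H2_star:
  assumes l: "l > 0" and a: "C2_seq a" and b: "C2_seq b" and z: "a 0 0 = 0" "a 0 pi = 0"
  shows "tensor (a 0) (b 0) \<in> H2_star l"
proof -
  have L2: "tensor (a i) (b j) \<in> L2 (plate l)" if "i \<le> 2" "j \<le> 2" for i j
    by (intro plate_rep_continuous(2) tensor_continuous C2_seq_cont[OF a] C2_seq_cont[OF b] that)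
  have "tensor (a 0) (b 0) \<in> H2 (plate l)"
    unfolding H2_def
  proof (intro CollectI conjI allI impI)
    show "tensor (a 0) (b 0) \<in> L2 (plate l)" by (rule L2) auto
    fix i j :: nat assume "i + j \<le> 2"
    then show "\<exists>g\<in>L2 (plate l). has_weak_derivative (plate l) i j (tensor (a 0) (b 0)) g"
      using tensor_weak_derivative[OF l a b, of i j] L2[of i j] by auto
  qed
  moreover have "continuous_on (closure (plate l)) (tensor (a 0) (b 0))"
    by (intro tensor_continuous C2_seq_cont[OF a] C2_seq_cont[OF b]) auto
  ultimately show ?thesis using z by (auto simp: H2_star_def tensor_def)
qed

lemma weak_derivative_works:
  assumes "u \<in> H2 S" "i + j \<le> 2"
  shows "weak_derivative S i j u \<in> L2 S" "has_weak_derivative S i j u (weak_derivative S i j u)"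
proof -
  have "\<exists>g. g \<in> L2 S \<and> has_weak_derivative S i j u g" using assms by (auto simp: H2_def)
  from someI_ex[OF this] show "weak_derivative S i j u \<in> L2 S" "has_weak_derivative S i j u (weak_derivative S i j u)"
    by (auto simp: weak_derivative_def)
qed

text \<open>\<open>weak_derivative\<close> picks some representative, so agreement with the
  classical derivative holds almost everywhere only; this suffices under the integral of the scalar
  product.\<close>

lemma tensor_weak_derivative_AE:
  assumes l: "l > 0" and a: "C2_seq a" and b: "C2_seq b" and z: "a 0 0 = 0" "a 0 pi = 0" and ij: "i + j \<le> 2"
  shows "AE z in lborel. z \<in> plate l \<longrightarrow> weak_derivative (plate l) i j (tensor (a 0) (b 0)) z = tensor (a i) (b j) z"
proof -
  let ?D = "weak_derivative (plate l) i j (tensor (a 0) (b 0))"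
  have H2: "tensor (a 0) (b 0) \<in> H2 (plate l)" using tensor_H2_star[OF l a b z] by (simp add: H2_star_def)
  obtain h where h: "plate_rep l ?D h" using plate_rep_exists weak_derivative_works(1)[OF H2 ij] by blast
  have c: "continuous_on ({0..pi} \<times> {-l..l}) (tensor (a i) (b j))"
    using ij by (intro tensor_continuous C2_seq_cont[OF a] C2_seq_cont[OF b]) auto
  have w: "has_weak_derivative (plate l) i j (tensor (a 0) (b 0)) (tensor (a i) (b j))"
    by (rule tensor_weak_derivative[OF l a b]) (use ij in auto)
  have "AE z in lborel. h z = indicator ({0..pi} \<times> {-l..l}) z *\<^sub>R tensor (a i) (b j) z"
    by (rule weak_derivative_unique[OF l h plate_rep_continuous(1)[OF c] weak_derivative_works(2)[OF H2 ij] w])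
  moreover have "AE z in lborel. z \<in> plate l \<longrightarrow> ?D z = h z" using h by (simp add: plate_rep_def)
  ultimately show ?thesis
    by eventually_elim (auto simp: plate_def indicator_def)
qed

section \<open>Reduction to the modes\<close>

lemma plate_rep_mult:
  assumes "l > 0" "plate_rep l g h" and p: "continuous_on UNIV p"
  shows "plate_rep l (\<lambda>z. g z * p z) (\<lambda>z. h z * p z)"
proof -
  interpret plate_fun l h by (rule plate_rep_plate_fun[OF assms(1,2)])
  have "p \<in> L2 (plate l)" by (intro plate_rep_continuous(2) continuous_on_subset[OF p]) auto
  then have pl: "p \<in> borel_measurable (lebesgue_on (plate l))" by (simp add: L2_def)
  show ?thesis
    unfolding plate_rep_def
  proof (intro conjI)
    show "(\<lambda>z. g z * p z) \<in> borel_measurable (lebesgue_on (plate l))"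
      using assms(2) pl by (intro borel_measurable_times) (auto simp: plate_rep_def)
    show "(\<lambda>z. h z * p z) \<in> borel_measurable borel"
      by (intro borel_measurable_times hm borel_measurable_continuous_onI p)
    show "integrable lborel (\<lambda>z. h z * p z)"
      by (intro h_mult_integrable continuous_on_subset[OF p]) auto
    show "AE z in lborel. z \<in> plate l \<longrightarrow> g z * p z = h z * p z"
      using assms(2) unfolding plate_rep_def by (auto elim: eventually_mono)
  qed (use hz in auto)
qed

lemma plate_rep_add:
  assumes "plate_rep l g h" "plate_rep l g' h'"
  shows "plate_rep l (\<lambda>z. g z + g' z) (\<lambda>z. h z + h' z)"
  unfolding plate_rep_def
proof (intro conjI)
  show "AE z in lborel. z \<in> plate l \<longrightarrow> g z + g' z = h z + h' z"
    using assms unfolding plate_rep_def by (auto elim: eventually_elim2)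
qed (use assms in \<open>auto simp: plate_rep_def\<close>)

lemma plate_rep_test:
  assumes "plate_rep l g h" "plate_rep l u u'" "has_weak_derivative (plate l) i j u g"
    and A: "test_seq 0 pi A" and B: "test_seq (-l) l B"
  shows "(\<integral>z. u' z * (A i (fst z) * B j (snd z)) \<partial>lborel) = (-1) ^ (i + j) * (\<integral>z. h z * (A 0 (fst z) * B 0 (snd z)) \<partial>lborel)"
proof -
  have t: "tensor (A i) (B j) \<in> borel_measurable borel" for i j
    by (intro tensor_measurable test_seq_continuous[OF A] test_seq_continuous[OF B])
  have "(\<integral>z. u' z * tensor (A i) (B j) z \<partial>lborel) = (-1) ^ (i + j) * (\<integral>z. h z * tensor (A 0) (B 0) z \<partial>lborel)"
    using weak_derivative_tensor[OF assms(3) A B]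
    unfolding plate_rep_integral[OF assms(1) t] plate_rep_integral[OF assms(2) t] .
  then show ?thesis by (simp add: tensor_def)
qed

lemma H2_star_facts:
  assumes l: "l > 0" and u: "u \<in> H2_star l"
  shows "u \<in> H2 (plate l)" "continuous_on ({0..pi} \<times> {-l..l}) u" "y \<in> {-l..l} \<Longrightarrow> u (0, y) = 0" "y \<in> {-l..l} \<Longrightarrow> u (pi, y) = 0"
proof -
  show "u \<in> H2 (plate l)" using u by (simp add: H2_star_def)
  show c: "continuous_on ({0..pi} \<times> {-l..l}) u" using u plate_closure[OF l] by (simp add: H2_star_def)
  have "u (x, y) = 0" if "x \<in> {0, pi}" "y \<in> {-l..l}" for x y
  proof -
    have cl: "closure {-l<..<l} = {-l..l}" using l by simp
    have "continuous_on (closure {-l<..<l}) (\<lambda>y. u (x, y))"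
      unfolding cl by (rule continuous_on_compose2[OF c]) (use that in \<open>auto intro!: continuous_intros\<close>)
    from continuous_constant_on_closure[OF this, of 0 y] show ?thesis
      using u that unfolding cl by (auto simp: H2_star_def)
  qed
  then show "y \<in> {-l..l} \<Longrightarrow> u (0, y) = 0" "y \<in> {-l..l} \<Longrightarrow> u (pi, y) = 0" by auto
qed

lemma continuous_marginal:
  fixes u :: "real \<times> real \<Rightarrow> real"
  assumes u: "continuous_on ({0..pi} \<times> {-l..l}) u" 
  shows "continuous_on {-l..l} q \<Longrightarrow> continuous_on {0..pi} (\<lambda>x. LINT y:{-l..l}|lborel. u (x, y) * q y)"
    "continuous_on {0..pi} p \<Longrightarrow> continuous_on {-l..l} (\<lambda>y. LINT x:{0..pi}|lborel. u (x, y) * p x)"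
proof -
  assume q: "continuous_on {-l..l} q"
  have "continuous_on ({0..pi} \<times> cbox (-l) l) (\<lambda>(x, y). u (x, y) * q y)"
    unfolding case_prod_unfold
    by (intro continuous_intros continuous_on_compose2[OF u] continuous_on_compose2[OF q]) auto
  from integral_continuous_on_param[OF this]
  have "continuous_on {0..pi} (\<lambda>x. integral {-l..l} (\<lambda>y. u (x, y) * q y))" by simp
  moreover have "integral {-l..l} (\<lambda>y. u (x, y) * q y) = (LINT y:{-l..l}|lborel. u (x, y) * q y)" if "x \<in> {0..pi}" for x
    by (intro set_borel_integral_eq_integral(2)[symmetric] borel_integrable_atLeastAtMost' continuous_intros q continuous_on_compose2[OF u])
       (use that in auto)
  ultimately show "continuous_on {0..pi} (\<lambda>x. LINT y:{-l..l}|lborel. u (x, y) * q y)"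
    by (rule continuous_on_eq)
next
  assume p: "continuous_on {0..pi} p"
  have "continuous_on ({-l..l} \<times> cbox 0 pi) (\<lambda>(y, x). u (x, y) * p x)"
    unfolding case_prod_unfold
    by (intro continuous_intros continuous_on_compose2[OF u] continuous_on_compose2[OF p]) auto
  from integral_continuous_on_param[OF this]
  have "continuous_on {-l..l} (\<lambda>y. integral {0..pi} (\<lambda>x. u (x, y) * p x))" by simp
  moreover have "integral {0..pi} (\<lambda>x. u (x, y) * p x) = (LINT x:{0..pi}|lborel. u (x, y) * p x)" if "y \<in> {-l..l}" for y
    by (intro set_borel_integral_eq_integral(2)[symmetric] borel_integrable_atLeastAtMost' continuous_intros p continuous_on_compose2[OF u])
       (use that in auto)
  ultimately show "continuous_on {-l..l} (\<lambda>y. LINT x:{0..pi}|lborel. u (x, y) * p x)"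
    by (rule continuous_on_eq)
qed

lemma C2_seq_sine: "C2_seq (\<lambda>i x. if i = 0 then sin (m * x) else if i = 1 then m * cos (m * x) else - (m\<^sup>2 * sin (m * x)))"
  unfolding C2_seq_def
proof (intro conjI allI impI)
  fix i :: nat and x :: real assume "i < 2"
  then consider "i = 0" | "i = 1" by linarith
  then show "((\<lambda>x. if i = 0 then sin (m * x) else if i = 1 then m * cos (m * x) else - (m\<^sup>2 * sin (m * x))) has_real_derivative
      (if Suc i = 0 then sin (m * x) else if Suc i = 1 then m * cos (m * x) else - (m\<^sup>2 * sin (m * x)))) (at x)"
    by cases (auto intro!: derivative_eq_intros simp: power2_eq_square)
next
  fix i :: nat
  show "continuous_on UNIV (\<lambda>x. if i = 0 then sin (m * x) else if i = 1 then m * cos (m * x) else - (m\<^sup>2 * sin (m * x)))"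
    by (cases "i = 0"; cases "i = 1") (simp_all add: continuous_intros)
qed

lemma (in green_mode) C2_seq_green:
  "C2_seq (\<lambda>i. if i = 0 then G0 \<kappa> l m y else if i = 1 then G1 \<kappa> l m y else G2 \<kappa> l m y)"
  unfolding C2_seq_def
proof (intro conjI allI impI)
  fix i :: nat and x :: real assume "i < 2"
  then consider "i = 0" | "i = 1" by linarith
  then show "((if i = 0 then G0 \<kappa> l m y else if i = 1 then G1 \<kappa> l m y else G2 \<kappa> l m y) has_real_derivative
      (if Suc i = 0 then G0 \<kappa> l m y else if Suc i = 1 then G1 \<kappa> l m y else G2 \<kappa> l m y) x) (at x)"
    by cases (auto intro: G0_deriv G1_deriv)
qed (auto intro: G0_continuous G1_continuous G2_continuous)

lemma set_integral_zero_prim: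
  assumes "prim a b (\<lambda>_. 0) R" "prim a b C D" "a \<le> b"
  shows "(LINT x:{a..b}|lborel. R x * C x) = 0"
  using prim_parts[OF assms] by simp

text \<open>Test functions have compact support, sines do not. With the factor B in y fixed first,
  the x-marginals satisfy one-dimensional weak equations that may be paired with sin(m x) or cos(m
  x), the boundary terms vanishing because u or the sine does. The outcome is that u_yy, u_xx and
  u_xy project to U'', - m^2 U and m U'.\<close>

lemma mode_equations:
  fixes m :: nat
  assumes l: "l > 0" and u: "u \<in> H2_star l"
    and h20: "plate_rep l (weak_derivative (plate l) 2 0 u) h20"
    and h11: "plate_rep l (weak_derivative (plate l) 1 1 u) h11"
    and h02: "plate_rep l (weak_derivative (plate l) 0 2 u) h02"
  defines "U \<equiv> \<lambda>y. LINT x:{0..pi}|lborel. u (x, y) * sin (real m * x)"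
  obtains U1 where "prim (-l) l U U1" "prim (-l) l U1 (plate_fun.margy h02 (\<lambda>x. sin (real m * x)))"
    "prim (-l) l (\<lambda>_. 0) (\<lambda>y. plate_fun.margy h20 (\<lambda>x. sin (real m * x)) y + (real m)\<^sup>2 * U y)"
    "prim (-l) l (\<lambda>_. 0) (\<lambda>y. plate_fun.margy h11 (\<lambda>x. cos (real m * x)) y - real m * U1 y)"
proof -
  define s where "s = (\<lambda>x. sin (real m * x))"
  define c where "c = (\<lambda>x. cos (real m * x))"
  have cont: "continuous_on S s" "continuous_on S c" for S
    unfolding s_def c_def by (intro continuous_intros)+
  have ps: "prim 0 pi s (\<lambda>x. real m * c x)"
    unfolding s_def c_def by (rule prim_C1) (auto intro!: derivative_eq_intros continuous_intros)
  have pc: "prim 0 pi c (\<lambda>x. - real m * s x)"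
    unfolding s_def c_def by (rule prim_C1) (auto intro!: derivative_eq_intros continuous_intros)
  have s0: "s 0 = 0" "s pi = 0" by (auto simp: s_def)
  have ll: "- l < l" "- l \<le> l" "(0::real) < pi" "(0::real) \<le> pi" using l by auto
  note uf = H2_star_facts[OF l u]
  note w = weak_derivative_works(2)[OF uf(1)]
  define u' where "u' = (\<lambda>z. indicator ({0..pi} \<times> {-l..l}) z *\<^sub>R u z)"
  have ru: "plate_rep l u u'" unfolding u'_def by (rule plate_rep_continuous(1)[OF uf(2)])
  interpret u: plate_fun l u' by (rule plate_rep_plate_fun[OF l ru])
  interpret h20: plate_fun l h20 by (rule plate_rep_plate_fun[OF l h20])
  interpret h11: plate_fun l h11 by (rule plate_rep_plate_fun[OF l h11])
  interpret h02: plate_fun l h02 by (rule plate_rep_plate_fun[OF l h02])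
  have mx: "u.margx q x = (LINT y:{-l..l}|lborel. u (x, y) * q y)" if "x \<in> {0..pi}" for q x
    unfolding u.margx_def set_lebesgue_integral_def
    by (rule Bochner_Integration.integral_cong) (use that in \<open>auto simp: u'_def indicator_times\<close>)
  have my: "u.margy p y = (LINT x:{0..pi}|lborel. u (x, y) * p x)" if "y \<in> {-l..l}" for p y
    unfolding u.margy_def set_lebesgue_integral_def
    by (rule Bochner_Integration.integral_cong) (use that in \<open>auto simp: u'_def indicator_times\<close>)
  have mxc: "continuous_on {0..pi} (u.margx q)" if "continuous_on {-l..l} q" for q
    by (rule continuous_on_eq[OF continuous_marginal(1)[OF uf(2) that]]) (use mx in auto)
  have myc: "continuous_on {-l..l} (u.margy s)"
    by (rule continuous_on_eq[OF continuous_marginal(2)[OF uf(2) cont(1)]]) (use my in auto)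
  have mx0: "u.margx q 0 = 0" "u.margx q pi = 0" for q
  proof -
    have "u' (0, y) = 0" "u' (pi, y) = 0" for y
      using uf(3,4)[of y] by (auto simp: u'_def indicator_def)
    then show "u.margx q 0 = 0" "u.margx q pi = 0" by (simp_all add: u.margx_def)
  qed
  have U: "u.margy s y = U y" if "y \<in> {-l..l}" for y
    using my[OF that] by (simp add: U_def s_def)
  have Uc: "continuous_on {-l..l} U"
    by (rule continuous_on_eq[OF myc]) (use U in auto)
  have Ucong: "(LINT y:{-l..l}|lborel. u.margy s y * q y) = (LINT y:{-l..l}|lborel. U y * q y)" for q
    by (rule set_lebesgue_integral_cong) (use U in auto)

  \<comment> \<open>No x-derivative occurs here, so the difference of the two x-marginals is weakly
    zero and can be paired with the sine directly.\<close>
  have E02: "(LINT y:{-l..l}|lborel. h02.margy s y * B 0 y) = (LINT y:{-l..l}|lborel. U y * B 2 y)"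
    if B: "test_seq (-l) l B" for B
  proof -
    note Bc = test_seq_continuous[OF B]
    have i: "set_integrable lborel {0..pi} (h02.margx (B 0))" "set_integrable lborel {0..pi} (u.margx (B 2))"
      by (rule h02.margx_integrable u.margx_integrable; rule Bc)+
    have "prim 0 pi (\<lambda>_. 0) (\<lambda>x. h02.margx (B 0) x - u.margx (B 2) x)"
    proof (rule weak_zero[OF ll(3) set_integral_diff(1)[OF i]])
      fix A assume A: "test_seq 0 pi A"
      note Ac = test_seq_continuous[OF A]
      have "(LINT x:{0..pi}|lborel. h02.margx (B 0) x * A 0 x) = (LINT x:{0..pi}|lborel. u.margx (B 2) x * A 0 x)"
        using plate_rep_test[OF h02 ru w A B] h02.tensor_margx[OF Ac Bc, of 0 0] u.tensor_margx[OF Ac Bc, of 0 2] by simp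
      then show "(LINT x:{0..pi}|lborel. (h02.margx (B 0) x - u.margx (B 2) x) * A 0 x) = 0"
        unfolding left_diff_distrib
        by (subst set_integral_diff(2)) (simp_all add: set_integrable_mult_continuous i Ac)
    qed
    from set_integral_zero_prim[OF this ps ll(4)]
    have "(LINT x:{0..pi}|lborel. h02.margx (B 0) x * s x) = (LINT x:{0..pi}|lborel. u.margx (B 2) x * s x)"
      unfolding left_diff_distrib
      by (subst (asm) set_integral_diff(2)) (simp_all add: set_integrable_mult_continuous i cont)
    then show ?thesis
      using h02.tensor_margx[OF cont(1) Bc, of 0] u.tensor_margx[OF cont(1) Bc, of 2]
        h02.tensor_margy[OF cont(1) Bc, of 0] u.tensor_margy[OF cont(1) Bc, of 2] Ucong by simp
  qed
  obtain U1 where U1: "prim (-l) l U U1" "prim (-l) l U1 (h02.margy s)"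
    by (rule weak_second_derivative[OF ll(1) Uc h02.margy_integrable[OF cont(1)] E02])

  \<comment> \<open>Two integrations by parts in x: the first boundary term vanishes through the
    sine, the second through u = 0 on the vertical edges.\<close>
  have E20: "(LINT y:{-l..l}|lborel. h20.margy s y * B 0 y) = - (real m)\<^sup>2 * (LINT y:{-l..l}|lborel. U y * B 0 y)"
    if B: "test_seq (-l) l B" for B
  proof -
    note Bc = test_seq_continuous[OF B]
    have E: "(LINT x:{0..pi}|lborel. h20.margx (B 0) x * A 0 x) = (LINT x:{0..pi}|lborel. u.margx (B 0) x * A 2 x)"
      if A: "test_seq 0 pi A" for A
    proof -
      note Ac = test_seq_continuous[OF A]
      show ?thesis
        using plate_rep_test[OF h20 ru w A B] h20.tensor_margx[OF Ac Bc, of 0 0] u.tensor_margx[OF Ac Bc, of 2 0] by simp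
    qed
    obtain P' where P': "prim 0 pi (u.margx (B 0)) P'" "prim 0 pi P' (h20.margx (B 0))"
      by (rule weak_second_derivative[OF ll(3) mxc[OF Bc] h20.margx_integrable[OF Bc] E])
    have "(LINT x:{0..pi}|lborel. h20.margx (B 0) x * s x) + real m * (LINT x:{0..pi}|lborel. P' x * c x) = 0"
      using prim_parts[OF P'(2) ps ll(4)] s0 by (simp add: mult.left_commute[of _ "real m"])
    moreover have "(LINT x:{0..pi}|lborel. P' x * c x) - real m * (LINT x:{0..pi}|lborel. u.margx (B 0) x * s x) = 0"
      using prim_parts[OF P'(1) pc ll(4)] mx0 by (simp add: mult.left_commute[of _ "real m"] set_lebesgue_integral_def)
    ultimately have "(LINT x:{0..pi}|lborel. h20.margx (B 0) x * s x) = - (real m)\<^sup>2 * (LINT x:{0..pi}|lborel. u.margx (B 0) x * s x)"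
      by (simp add: power2_eq_square)
    then show ?thesis
      using h20.tensor_margx[OF cont(1) Bc, of 0] u.tensor_margx[OF cont(1) Bc, of 0]
        h20.tensor_margy[OF cont(1) Bc, of 0] u.tensor_margy[OF cont(1) Bc, of 0] Ucong by simp
  qed
  have i20: "set_integrable lborel {-l..l} (h20.margy s)" "set_integrable lborel {-l..l} (\<lambda>y. (real m)\<^sup>2 * U y)"
    by (intro h20.margy_integrable cont borel_integrable_atLeastAtMost' continuous_intros Uc)+
  have R20: "prim (-l) l (\<lambda>_. 0) (\<lambda>y. h20.margy s y + (real m)\<^sup>2 * U y)"
  proof (rule weak_zero[OF ll(1) set_integral_add(1)[OF i20]])
    fix B assume B: "test_seq (-l) l B"
    note Bc = test_seq_continuous[OF B]
    show "(LINT y:{-l..l}|lborel. (h20.margy s y + (real m)\<^sup>2 * U y) * B 0 y) = 0"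
      using E20[OF B] set_integral_add(2)[OF set_integrable_mult_continuous[OF i20(1) Bc] set_integrable_mult_continuous[OF i20(2) Bc], of 0 0]
      by (simp add: distrib_right mult.assoc)
  qed

  \<comment> \<open>With the y-derivative resting on B, \<open>- u.margx (B 1)\<close> has the
    x-derivative \<open>h11.margx (B 0)\<close>. The cosine does not vanish at the ends, but u
    does.\<close>
  have E11: "(LINT y:{-l..l}|lborel. h11.margy c y * B 0 y) = real m * (LINT y:{-l..l}|lborel. U1 y * B 0 y)"
    if B: "test_seq (-l) l B" for B
  proof -
    note Bc = test_seq_continuous[OF B]
    have "prim 0 pi (\<lambda>x. - u.margx (B 1) x) (h11.margx (B 0))"
    proof (rule weak_first_derivative[OF ll(3) _ h11.margx_integrable[OF Bc]])
      show "continuous_on {0..pi} (\<lambda>x. - u.margx (B 1) x)" by (intro continuous_intros mxc Bc)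
      fix A assume A: "test_seq 0 pi A"
      note Ac = test_seq_continuous[OF A]
      have "(LINT x:{0..pi}|lborel. h11.margx (B 0) x * A 0 x) = (LINT x:{0..pi}|lborel. u.margx (B 1) x * A 1 x)"
        using plate_rep_test[OF h11 ru w A B] h11.tensor_margx[OF Ac Bc, of 0 0] u.tensor_margx[OF Ac Bc, of 1 1] by simp
      then show "(LINT x:{0..pi}|lborel. h11.margx (B 0) x * A 0 x) = - (LINT x:{0..pi}|lborel. - u.margx (B 1) x * A 1 x)"
        by (simp add: set_lebesgue_integral_def)
    qed
    from prim_parts[OF this pc ll(4)]
    have "(LINT x:{0..pi}|lborel. h11.margx (B 0) x * c x) = - real m * (LINT x:{0..pi}|lborel. u.margx (B 1) x * s x)"
      using mx0 by (simp add: mult.left_commute[of _ "real m"])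
    then have "(LINT y:{-l..l}|lborel. h11.margy c y * B 0 y) = - real m * (LINT y:{-l..l}|lborel. U y * B 1 y)"
      using h11.tensor_margx[OF cont(2) Bc, of 0] u.tensor_margx[OF cont(1) Bc, of 1]
        h11.tensor_margy[OF cont(2) Bc, of 0] u.tensor_margy[OF cont(1) Bc, of 1] Ucong by simp
    then show ?thesis using prim_test_seq[OF U1(1) B ll(2), of 0] by simp
  qed
  have i11: "set_integrable lborel {-l..l} (h11.margy c)" "set_integrable lborel {-l..l} (\<lambda>y. real m * U1 y)"
    by (intro h11.margy_integrable cont borel_integrable_atLeastAtMost' continuous_intros prim_continuous[OF U1(2)])+
  have R11: "prim (-l) l (\<lambda>_. 0) (\<lambda>y. h11.margy c y - real m * U1 y)"
  proof (rule weak_zero[OF ll(1) set_integral_diff(1)[OF i11]])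
    fix B assume B: "test_seq (-l) l B"
    note Bc = test_seq_continuous[OF B]
    show "(LINT y:{-l..l}|lborel. (h11.margy c y - real m * U1 y) * B 0 y) = 0"
      using E11[OF B] set_integral_diff(2)[OF set_integrable_mult_continuous[OF i11(1) Bc] set_integrable_mult_continuous[OF i11(2) Bc], of 0 0]
      by (simp add: left_diff_distrib mult.assoc)
  qed
  show ?thesis
    using that[OF U1(1)] U1(2) R20 R11 unfolding s_def c_def by blast
qed

text \<open>Against sin(m x) g_m(y, t) the plate form collapses to \<open>bform\<close> of the mode
  U and the Green function, and the reproducing property returns U(y). The test function is
  admissible since g_m is C^2 and the sine vanishes on the vertical edges.\<close>

lemma mode_representation:
  fixes m :: nat
  assumes l: "l > 0" and \<sigma>: "0 \<le> \<sigma>" "\<sigma> < 1" and sol: "weak_solution l \<sigma> f u"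
    and F: "plate_rep l f F" and m: "m \<ge> 1" and y: "y \<in> {-l..l}"
  shows "(LINT x:{0..pi}|lborel. u (x, y) * sin (real m * x)) =
    (\<integral>z. F z * (sin (real m * fst z) * G0 (1 - \<sigma>) l (real m) y (snd z)) \<partial>lborel)"
proof -
  define \<kappa> where "\<kappa> = 1 - \<sigma>"
  have \<kappa>: "0 < \<kappa>" "\<kappa> \<le> 1" using \<sigma> by (auto simp: \<kappa>_def)
  interpret green_mode \<kappa> l "real m" y by unfold_locales (use l \<kappa> m y in auto)
  have u: "u \<in> H2_star l" using sol by (simp add: weak_solution_def)
  have uH: "u \<in> H2 (plate l)" using H2_star_facts(1)[OF l u] .
  define D where "D = weak_derivative (plate l)"
  have DL: "D i j v \<in> L2 (plate l)" if "v \<in> H2 (plate l)" "i + j \<le> 2" for i j v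
    unfolding D_def by (rule weak_derivative_works(1)[OF that])
  have Du: "D 2 0 u \<in> L2 (plate l)" "D 1 1 u \<in> L2 (plate l)" "D 0 2 u \<in> L2 (plate l)"
    by (rule DL[OF uH]; simp)+
  obtain h20 where h20: "plate_rep l (D 2 0 u) h20" using plate_rep_exists[OF Du(1)] .
  obtain h11 where h11: "plate_rep l (D 1 1 u) h11" using plate_rep_exists[OF Du(2)] .
  obtain h02 where h02: "plate_rep l (D 0 2 u) h02" using plate_rep_exists[OF Du(3)] .
  interpret h20: plate_fun l h20 by (rule plate_rep_plate_fun[OF l h20])
  interpret h11: plate_fun l h11 by (rule plate_rep_plate_fun[OF l h11])
  interpret h02: plate_fun l h02 by (rule plate_rep_plate_fun[OF l h02])
  define s where "s = (\<lambda>x. sin (real m * x))"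
  define c where "c = (\<lambda>x. cos (real m * x))"
  have cs: "continuous_on S s" "continuous_on S c" for S
    unfolding s_def c_def by (intro continuous_intros)+
  define U where "U = (\<lambda>y. LINT x:{0..pi}|lborel. u (x, y) * s x)"
  obtain U1 where U1: "prim (-l) l U U1" "prim (-l) l U1 (h02.margy s)"
    and R20: "prim (-l) l (\<lambda>_. 0) (\<lambda>y. h20.margy s y + (real m)\<^sup>2 * U y)"
    and R11: "prim (-l) l (\<lambda>_. 0) (\<lambda>y. h11.margy c y - real m * U1 y)"
    using mode_equations[OF l u h20[unfolded D_def] h11[unfolded D_def] h02[unfolded D_def], of m]
    unfolding U_def s_def c_def by blast
  define w0 where "w0 = G0 \<kappa> l (real m) y"
  define w1 where "w1 = G1 \<kappa> l (real m) y"
  define w2 where "w2 = G2 \<kappa> l (real m) y"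
  have cw: "continuous_on S w0" "continuous_on S w1" "continuous_on S w2" for S
    unfolding w0_def w1_def w2_def by (rule G0_continuous G1_continuous G2_continuous)+
  have pw: "prim (-l) l w0 w1" "prim (-l) l w1 w2"
    unfolding w0_def w1_def w2_def by (intro prim_C1 G0_deriv G1_deriv G1_continuous G2_continuous)+
  obtain w3 where pw2: "prim (-l) l w2 w3" using G2_prim unfolding w2_def by blast
  define \<phi> where "\<phi> = tensor s w0"
  define A where "A = (\<lambda>(i::nat) x. if i = 0 then sin (real m * x) else if i = 1 then real m * cos (real m * x) else - ((real m)\<^sup>2 * sin (real m * x)))"
  define B where "B = (\<lambda>i::nat. if i = 0 then w0 else if i = 1 then w1 else w2)"
  have A: "C2_seq A" unfolding A_def by (rule C2_seq_sine)
  have B: "C2_seq B" unfolding B_def w0_def w1_def w2_def using C2_seq_green by simp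
  have \<phi>_eq: "\<phi> = tensor (A 0) (B 0)" by (simp add: \<phi>_def A_def B_def s_def)
  have A0: "A 0 0 = 0" "A 0 pi = 0" by (auto simp: A_def)
  have \<phi>: "\<phi> \<in> H2_star l" unfolding \<phi>_eq by (rule tensor_H2_star[OF l A B A0])
  have \<phi>H: "\<phi> \<in> H2 (plate l)" using H2_star_facts(1)[OF l \<phi>] .
  note ae = tensor_weak_derivative_AE[OF l A B A0, folded \<phi>_eq D_def]
  \<comment> \<open>Collecting the integrand by the derivatives of u leaves \<phi>_xx + \<sigma>
    \<phi>_yy, \<phi>_yy + \<sigma> \<phi>_xx and 2 \<kappa> \<phi>_xy as the factors of u_xx, u_yy
    and u_xy.\<close>
  define p20 where "p20 = tensor s (\<lambda>t. \<sigma> * w2 t - (real m)\<^sup>2 * w0 t)"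
  define p02 where "p02 = tensor s (\<lambda>t. w2 t - \<sigma> * (real m)\<^sup>2 * w0 t)"
  define p11 where "p11 = tensor c (\<lambda>t. 2 * \<kappa> * real m * w1 t)"
  have cp: "continuous_on S p20" "continuous_on S p02" "continuous_on S p11" for S
    unfolding p20_def p02_def p11_def by (intro tensor_continuous continuous_intros cs cw)+
  define E where "E = (\<lambda>z. (D 2 0 u z + D 0 2 u z) * (D 2 0 \<phi> z + D 0 2 \<phi> z)
         + (1 - \<sigma>) * (2 * D 1 1 u z * D 1 1 \<phi> z - D 2 0 u z * D 0 2 \<phi> z - D 0 2 u z * D 2 0 \<phi> z))"
  define E' where "E' = (\<lambda>z. h20 z * p20 z + h02 z * p02 z + h11 z * p11 z)"
  have "plate_rep l (\<lambda>z. D 2 0 u z * p20 z + D 0 2 u z * p02 z + D 1 1 u z * p11 z) E'"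
    unfolding E'_def by (intro plate_rep_add plate_rep_mult[OF l] h20 h02 h11 cp)
  then have E': "E' \<in> borel_measurable borel" "integrable lborel E'" "\<forall>z. z \<notin> {0..pi} \<times> {-l..l} \<longrightarrow> E' z = 0"
    "AE z in lborel. z \<in> plate l \<longrightarrow> D 2 0 u z * p20 z + D 0 2 u z * p02 z + D 1 1 u z * p11 z = E' z"
    unfolding plate_rep_def by blast+
  have "plate_rep l E E'"
    unfolding plate_rep_def
  proof (intro conjI E'(1-3))
    have meas: "D i j v \<in> borel_measurable (lebesgue_on (plate l))" if "v \<in> H2 (plate l)" "i + j \<le> 2" for i j v
      using DL[OF that] by (simp add: L2_def)
    show "E \<in> borel_measurable (lebesgue_on (plate l))"
      unfolding E_def
      by (intro borel_measurable_add borel_measurable_times borel_measurable_diff borel_measurable_const meas uH \<phi>H) auto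
    have "AE z in lborel. z \<in> plate l \<longrightarrow> D 2 0 \<phi> z = tensor (A 2) (B 0) z"
      "AE z in lborel. z \<in> plate l \<longrightarrow> D 0 2 \<phi> z = tensor (A 0) (B 2) z"
      "AE z in lborel. z \<in> plate l \<longrightarrow> D 1 1 \<phi> z = tensor (A 1) (B 1) z"
      by (rule ae; simp)+
    with E'(4) show "AE z in lborel. z \<in> plate l \<longrightarrow> E z = E' z"
    proof eventually_elim
      case (elim z)
      show ?case
      proof
        assume z: "z \<in> plate l"
        have "tensor (A 2) (B 0) z = - ((real m)\<^sup>2 * s (fst z) * w0 (snd z))" "tensor (A 0) (B 2) z = s (fst z) * w2 (snd z)"
          "tensor (A 1) (B 1) z = real m * c (fst z) * w1 (snd z)"
          by (simp_all add: tensor_def A_def B_def s_def c_def)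
        with elim z show "E z = E' z"
          by (simp add: E_def p20_def p02_def p11_def tensor_def \<kappa>_def algebra_simps)
      qed
    qed
  qed
  from plate_rep_integral[OF this, of "\<lambda>_. 1"] have "H2_star_inner l \<sigma> u \<phi> = (\<integral>z. E' z \<partial>lborel)"
    by (simp add: H2_star_inner_def Let_def E_def D_def)
  also have "\<dots> = (\<integral>z. h20 z * p20 z \<partial>lborel) + (\<integral>z. h02 z * p02 z \<partial>lborel) + (\<integral>z. h11 z * p11 z \<partial>lborel)"
    unfolding E'_def
    by (simp add: h20.h_mult_integrable h02.h_mult_integrable h11.h_mult_integrable cp)
  also have "(\<integral>z. h20 z * p20 z \<partial>lborel) = (LINT t:{-l..l}|lborel. h20.margy s t * (\<sigma> * w2 t - (real m)\<^sup>2 * w0 t))"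
    unfolding p20_def tensor_def by (rule h20.tensor_margy) (intro continuous_intros cs cw)+
  also have "(\<integral>z. h02 z * p02 z \<partial>lborel) = (LINT t:{-l..l}|lborel. h02.margy s t * (w2 t - \<sigma> * (real m)\<^sup>2 * w0 t))"
    unfolding p02_def tensor_def by (rule h02.tensor_margy) (intro continuous_intros cs cw)+
  also have "(\<integral>z. h11 z * p11 z \<partial>lborel) = (LINT t:{-l..l}|lborel. h11.margy c t * (2 * \<kappa> * real m * w1 t))"
    unfolding p11_def tensor_def by (rule h11.tensor_margy) (intro continuous_intros cs cw)+
  finally have inner: "H2_star_inner l \<sigma> u \<phi> =
      (LINT t:{-l..l}|lborel. h20.margy s t * (\<sigma> * w2 t - (real m)\<^sup>2 * w0 t)) +
      (LINT t:{-l..l}|lborel. h02.margy s t * (w2 t - \<sigma> * (real m)\<^sup>2 * w0 t)) +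
      (LINT t:{-l..l}|lborel. h11.margy c t * (2 * \<kappa> * real m * w1 t))" .
  have ll: "- l \<le> l" using l by simp
  note Uc = prim_continuous[OF U1(1)] prim_continuous[OF U1(2)]
  have i20: "set_integrable lborel {-l..l} (\<lambda>t. h20.margy s t * (\<sigma> * w2 t - (real m)\<^sup>2 * w0 t))"
    by (intro set_integrable_mult_continuous h20.margy_integrable cs continuous_intros cw)
  have i02: "set_integrable lborel {-l..l} (\<lambda>t. h02.margy s t * (w2 t - \<sigma> * (real m)\<^sup>2 * w0 t))"
    by (intro set_integrable_mult_continuous h02.margy_integrable cs continuous_intros cw)
  have i11: "set_integrable lborel {-l..l} (\<lambda>t. h11.margy c t * (2 * \<kappa> * real m * w1 t))"
    by (intro set_integrable_mult_continuous h11.margy_integrable cs continuous_intros cw)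
  have j20: "set_integrable lborel {-l..l} (\<lambda>t. U t * ((real m)^4 * w0 t - \<sigma> * (real m)\<^sup>2 * w2 t))"
    by (intro borel_integrable_atLeastAtMost' continuous_intros Uc cw)
  have j11: "set_integrable lborel {-l..l} (\<lambda>t. 2 * \<kappa> * (real m)\<^sup>2 * (U1 t * w1 t))"
    by (intro borel_integrable_atLeastAtMost' continuous_intros Uc cw)
  \<comment> \<open>The sine marginal of u_xx equals - m^2 U almost everywhere, which
    \<open>R20\<close> states as a vanishing primitive; integration by parts against an absolutely
    continuous factor makes the replacement.\<close>
  have z20: "(LINT t:{-l..l}|lborel. h20.margy s t * (\<sigma> * w2 t - (real m)\<^sup>2 * w0 t)) =
      (LINT t:{-l..l}|lborel. U t * ((real m)^4 * w0 t - \<sigma> * (real m)\<^sup>2 * w2 t))"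
  proof -
    have "prim (-l) l (\<lambda>t. \<sigma> * w2 t - (real m)\<^sup>2 * w0 t) (\<lambda>t. \<sigma> * w3 t - (real m)\<^sup>2 * w1 t)"
      by (intro prim_diff prim_cmult pw pw2)
    from set_integral_zero_prim[OF R20 this ll]
    have "(LINT t:{-l..l}|lborel. (h20.margy s t + (real m)\<^sup>2 * U t) * (\<sigma> * w2 t - (real m)\<^sup>2 * w0 t)) = 0" .
    also have "(\<lambda>t. (h20.margy s t + (real m)\<^sup>2 * U t) * (\<sigma> * w2 t - (real m)\<^sup>2 * w0 t)) =
      (\<lambda>t. h20.margy s t * (\<sigma> * w2 t - (real m)\<^sup>2 * w0 t) - U t * ((real m)^4 * w0 t - \<sigma> * (real m)\<^sup>2 * w2 t))"
      by (rule ext) (simp add: algebra_simps power4_eq_xxxx power2_eq_square)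
    finally show ?thesis by (simp only: set_integral_diff(2)[OF i20 j20] right_minus_eq)
  qed
  have z11: "(LINT t:{-l..l}|lborel. h11.margy c t * (2 * \<kappa> * real m * w1 t)) = (LINT t:{-l..l}|lborel. 2 * \<kappa> * (real m)\<^sup>2 * (U1 t * w1 t))"
  proof -
    have "prim (-l) l (\<lambda>t. 2 * \<kappa> * real m * w1 t) (\<lambda>t. 2 * \<kappa> * real m * w2 t)"
      by (intro prim_cmult pw)
    from set_integral_zero_prim[OF R11 this ll]
    have "(LINT t:{-l..l}|lborel. (h11.margy c t - real m * U1 t) * (2 * \<kappa> * real m * w1 t)) = 0" .
    also have "(\<lambda>t. (h11.margy c t - real m * U1 t) * (2 * \<kappa> * real m * w1 t)) =
      (\<lambda>t. h11.margy c t * (2 * \<kappa> * real m * w1 t) - 2 * \<kappa> * (real m)\<^sup>2 * (U1 t * w1 t))"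
      by (rule ext) (simp add: algebra_simps power2_eq_square)
    finally show ?thesis by (simp only: set_integral_diff(2)[OF i11 j11] right_minus_eq)
  qed
  have "bform \<kappa> l (real m) U U1 (h02.margy s) w0 w1 w2 =
      (LINT t:{-l..l}|lborel. h02.margy s t * (w2 t - \<sigma> * (real m)\<^sup>2 * w0 t) + 2 * \<kappa> * (real m)\<^sup>2 * (U1 t * w1 t)
        + U t * ((real m)^4 * w0 t - \<sigma> * (real m)\<^sup>2 * w2 t))"
    by (simp add: bform_def \<kappa>_def)
  also have "\<dots> = (LINT t:{-l..l}|lborel. h02.margy s t * (w2 t - \<sigma> * (real m)\<^sup>2 * w0 t))
      + (LINT t:{-l..l}|lborel. 2 * \<kappa> * (real m)\<^sup>2 * (U1 t * w1 t))
      + (LINT t:{-l..l}|lborel. U t * ((real m)^4 * w0 t - \<sigma> * (real m)\<^sup>2 * w2 t))"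
    using i02 j11 j20 by (simp only: set_integral_add)
  also have "\<dots> = H2_star_inner l \<sigma> u \<phi>" unfolding inner z20 z11 by simp
  also have "\<dots> = (\<integral>z. f z * \<phi> z \<partial>(lebesgue_on (plate l)))" using sol \<phi> by (simp add: weak_solution_def)
  also have "\<dots> = (\<integral>z. F z * \<phi> z \<partial>lborel)"
    unfolding \<phi>_def by (rule plate_rep_integral[OF F]) (intro tensor_measurable cs cw)
  finally have "bform \<kappa> l (real m) U U1 (h02.margy s) w0 w1 w2 = (\<integral>z. F z * \<phi> z \<partial>lborel)" .
  moreover have "bform \<kappa> l (real m) U U1 (h02.margy s) w0 w1 w2 = U y"
    unfolding w0_def w1_def w2_def by (rule green_identity[OF U1])
  ultimately show ?thesis by (simp add: U_def s_def \<phi>_def tensor_def w0_def \<kappa>_def)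
qed

section \<open>Positivity\<close>

text \<open>On the line at height y the partial sums of the sine series of u are integrals of f
  against partial sums of the plate kernel, which are bounded below before passing to the limit. K
  depends on y, which is enough because all claims are made for each y separately.\<close>

lemma edge_profile:
  assumes l: "l > 0" and \<sigma>: "0 \<le> \<sigma>" "\<sigma> < 1" and f: "f \<in> L2 (plate l)"
    and sol: "weak_solution l \<sigma> f u"
    and nonneg: "AE z in lebesgue_on (plate l). f z \<ge> 0"
    and nonzero: "\<not> (AE z in lebesgue_on (plate l). f z = 0)"
    and y: "y \<in> {-l..l}"
  obtains G G' K where "\<And>x. (G has_real_derivative G' x) (at x)" "\<And>x. x \<in> {0..pi} \<Longrightarrow> u (x, y) = G x"
    "G 0 = 0" "G pi = 0" "K > 0" "\<And>x. 0 < x \<Longrightarrow> x < pi \<Longrightarrow> G x \<ge> K * sin x"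
proof -
  define \<kappa> where "\<kappa> = 1 - \<sigma>"
  have \<kappa>: "0 < \<kappa>" "\<kappa> \<le> 1" using \<sigma> by (auto simp: \<kappa>_def)
  have u: "u \<in> H2_star l" using sol by (simp add: weak_solution_def)
  note uf = H2_star_facts[OF l u]
  obtain F where F: "plate_rep l f F" using plate_rep_exists[OF f] .
  interpret F: plate_fun l F by (rule plate_rep_plate_fun[OF l F])
  have AE_plate: "(AE z in lebesgue_on (plate l). P z) \<longleftrightarrow> (AE z in lborel. z \<in> plate l \<longrightarrow> P z)" for P
    by (subst AE_restrict_space_iff) (auto simp: plate_sets AE_completion_iff)
  have fF: "AE z in lborel. z \<in> plate l \<longrightarrow> f z = F z" using F by (simp add: plate_rep_def)
  have F0: "AE z in lborel. F z \<ge> 0"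
    using nonneg[unfolded AE_plate] fF AE_closed_plate[of l]
  proof eventually_elim
    case (elim z)
    then show ?case using F.hz[of z] by (cases "z \<in> {0..pi} \<times> {-l..l}") auto
  qed
  have Fn: "\<not> (AE z in lborel. F z = 0)"
  proof
    assume "AE z in lborel. F z = 0"
    with fF have "AE z in lborel. z \<in> plate l \<longrightarrow> f z = 0" by eventually_elim auto
    with nonzero show False by (simp add: AE_plate)
  qed
  define g where "g = (\<lambda>k::nat. G0 \<kappa> l (real k) y)"
  have gm: "green_mode \<kappa> l (real k) y" if "k \<ge> 1" for k
    using that l \<kappa> y by (auto simp: green_mode_def)
  have gc: "continuous_on S (g k)" if "k \<ge> 1" for k S
    unfolding g_def by (rule green_mode.G0_continuous[OF gm[OF that]])
  have gpos: "g k w > 0" if "k \<ge> 1" "w \<in> {-l..l}" for k w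
    unfolding g_def using green_mode.G0_pos[OF gm[OF that(1)], of w] that by auto
  define C where "C = 1 + (2 * (cosh (2 * l) / sinh (2 * l)) + 1) / \<kappa>"
  have gle: "g k w \<le> C / real k ^ 3" if "k \<ge> 1" "w \<in> {-l..l}" for k w
    unfolding g_def C_def using green_mode.G0_le[OF gm[OF that(1)], of w] that by auto
  define W where "W = (\<lambda>k z. sin (real k * fst z) * g k (snd z))"
  have Wc: "continuous_on S (W k)" if "k \<ge> 1" for k S
    unfolding W_def by (intro continuous_intros continuous_on_compose2[OF gc[OF that, of UNIV]]) auto
  have Wi: "integrable lborel (\<lambda>z. F z * W k z)" if "k \<ge> 1" for k
    by (rule F.h_mult_integrable[OF Wc[OF that]])
  define b where "b = (\<lambda>k. \<integral>z. F z * W k z \<partial>lborel)"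
  have uc: "continuous_on {0..pi} (\<lambda>x. u (x, y))"
    by (rule continuous_on_compose2[OF uf(2)]) (use y in \<open>auto intro!: continuous_intros\<close>)
  have b_eq: "integral {0..pi} (\<lambda>x. u (x, y) * sin (real k * x)) = b k" if "k \<ge> 1" for k
  proof -
    have "integral {0..pi} (\<lambda>x. u (x, y) * sin (real k * x)) = (LINT x:{0..pi}|lborel. u (x, y) * sin (real k * x))"
      by (intro set_borel_integral_eq_integral(2)[symmetric] borel_integrable_atLeastAtMost' continuous_intros uc)
    then show ?thesis
      using mode_representation[OF l \<sigma> sol F that y] by (simp add: b_def W_def g_def \<kappa>_def)
  qed
  \<comment> \<open>The cubic decay demanded by \<open>sine_series\<close> is inherited from the
    bound on the Green functions; of f only its integral enters.\<close>
  have bd: "\<bar>integral {0..pi} (\<lambda>x. u (x, y) * sin (real k * x))\<bar> \<le> C * (\<integral>z. \<bar>F z\<bar> \<partial>lborel) / real k ^ 3" if k: "k \<ge> 1" for k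
  proof -
    have "\<bar>b k\<bar> \<le> (\<integral>z. \<bar>F z * W k z\<bar> \<partial>lborel)"
      unfolding b_def by (rule integral_abs_bound)
    also have "\<dots> \<le> (\<integral>z. (C / real k ^ 3) * \<bar>F z\<bar> \<partial>lborel)"
    proof (rule integral_mono)
      show "integrable lborel (\<lambda>z. \<bar>F z * W k z\<bar>)" by (intro integrable_abs Wi k)
      show "integrable lborel (\<lambda>z. (C / real k ^ 3) * \<bar>F z\<bar>)" using F.hi by (intro integrable_mult_right) auto
      fix z
      show "\<bar>F z * W k z\<bar> \<le> (C / real k ^ 3) * \<bar>F z\<bar>"
      proof (cases "z \<in> {0..pi} \<times> {-l..l}")
        case True
        then have w: "snd z \<in> {-l..l}" by auto
        have "\<bar>W k z\<bar> \<le> 1 * (C / real k ^ 3)"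
          unfolding W_def abs_mult using gle[OF k w] gpos[OF k w] by (intro mult_mono) auto
        then have "\<bar>F z\<bar> * \<bar>W k z\<bar> \<le> \<bar>F z\<bar> * (C / real k ^ 3)" by (intro mult_left_mono) auto
        then show ?thesis by (simp only: abs_mult mult.commute)
      qed (simp add: F.hz)
    qed
    also have "\<dots> = C * (\<integral>z. \<bar>F z\<bar> \<partial>lborel) / real k ^ 3" by simp
    finally show ?thesis by (simp add: b_eq[OF k])
  qed
  obtain G G' where G: "\<And>x. (G has_real_derivative G' x) (at x)" "\<And>x. x \<in> {0..pi} \<Longrightarrow> u (x, y) = G x"
    and sums: "\<And>x. (\<lambda>k. 2 / pi * integral {0..pi} (\<lambda>x. u (x, y) * sin (real (Suc k) * x)) * sin (real (Suc k) * x)) sums G x"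
  proof (rule sine_series[OF uc bd])
    fix G G' :: "real \<Rightarrow> real"
    assume "\<And>x. (G has_real_derivative G' x) (at x)" "\<And>x. x \<in> {0..pi} \<Longrightarrow> u (x, y) = G x"
      "\<And>x. (\<lambda>k. 2 / pi * integral {0..pi} (\<lambda>x. u (x, y) * sin (real (Suc k) * x)) * sin (real (Suc k) * x)) sums G x"
    then show thesis by (rule that)
  qed
  define c where "c = (\<lambda>w k. (real k)\<^sup>2 * g k w)"
  have cdec: "c w (Suc k) < c w k" if "k \<ge> 1" "w \<in> {-l..l}" for k w
    unfolding c_def g_def by (rule G0_frequency_decreasing[OF l \<kappa>]) (use that y in auto)
  \<comment> \<open>At k = 0 the factor k^2 vanishes, whatever value \<open>G0\<close> takes at
    frequency 0.\<close>
  have cnn: "c w k \<ge> 0" if "w \<in> {-l..l}" for k w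
    using gpos[of k w] that by (cases "k = 0") (auto simp: c_def intro!: mult_nonneg_nonneg)
  \<comment> \<open>The surviving Abel term at k = 1, with the factor sin x split off. It is
    strictly positive on the open plate because c is strictly decreasing in the frequency.\<close>
  define V where "V = (\<lambda>z. sin (fst z) * (c (snd z) 1 - c (snd z) 2))"
  have Vc: "continuous_on S V" for S
    unfolding V_def c_def
    by (intro continuous_intros continuous_on_compose2[OF gc[of 1 UNIV]] continuous_on_compose2[OF gc[of 2 UNIV]]) auto
  have Vi: "integrable lborel (\<lambda>z. F z * V z)" by (rule F.h_mult_integrable[OF Vc])
  have Vpos: "V z > 0" if "z \<in> plate l" for z
    using that sin_gt_zero[of "fst z"] cdec[of 1 "snd z"]
    by (auto simp: V_def plate_def numeral_2_eq_2 intro!: mult_pos_pos)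
  define K where "K = (\<integral>z. F z * V z \<partial>lborel)"
  have FV: "AE z in lborel. F z * V z \<ge> 0"
    using F0 AE_closed_plate[of l]
  proof eventually_elim
    case (elim z)
    show ?case
    proof (cases "z \<in> {0..pi} \<times> {-l..l}")
      case True
      then show ?thesis using elim Vpos[of z] by simp
    qed (simp add: F.hz)
  qed
  have K: "K > 0"
  proof -
    have "K \<ge> 0" unfolding K_def by (rule integral_nonneg_AE[OF FV])
    moreover have "K \<noteq> 0"
    proof
      assume "K = 0"
      then have "AE z in lborel. F z * V z = 0"
        unfolding K_def by (subst (asm) integral_nonneg_eq_0_iff_AE[OF Vi FV])
      then have "AE z in lborel. F z = 0"
        using AE_closed_plate[of l]
      proof eventually_elim
        case (elim z)
        then show ?case using Vpos[of z] F.hz[of z] by (cases "z \<in> {0..pi} \<times> {-l..l}") auto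
      qed
      with Fn show False by simp
    qed
    ultimately show ?thesis by simp
  qed
  have low: "G x \<ge> (2 / pi * K) * sin x" if x: "0 < x" "x < pi" for x
  proof (rule LIMSEQ_le_const)
    show "(\<lambda>n. \<Sum>k<n. 2 / pi * integral {0..pi} (\<lambda>x. u (x, y) * sin (real (Suc k) * x)) * sin (real (Suc k) * x)) \<longlonglongrightarrow> G x"
      using sums[of x] by (simp add: sums_def)
    show "\<exists>N. \<forall>n\<ge>N. (2 / pi * K) * sin x \<le> (\<Sum>k<n. 2 / pi * integral {0..pi} (\<lambda>x. u (x, y) * sin (real (Suc k) * x)) * sin (real (Suc k) * x))"
    \<comment> \<open>The bound involves the first two coefficients, so it holds for partial sums
      with at least two terms.\<close>
    proof (intro exI[of _ 2] allI impI)
      fix n :: nat assume n: "n \<ge> 2"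
      define e where "e = (\<lambda>\<rho> k. sin (real k * x) * sin (real k * \<rho>) / (real k)\<^sup>2)"
      have "(\<Sum>k<n. 2 / pi * integral {0..pi} (\<lambda>x. u (x, y) * sin (real (Suc k) * x)) * sin (real (Suc k) * x))
          = (\<Sum>k<n. 2 / pi * b (Suc k) * sin (real (Suc k) * x))"
        by (rule sum.cong) (simp_all only: b_eq[of "Suc _"] One_nat_def Suc_le_mono le0)
      also have "\<dots> = (\<Sum>k=1..n. 2 / pi * b k * sin (real k * x))"
        unfolding lessThan_atLeast0 by (subst sum.shift_bounds_Suc_ivl[symmetric]) (simp add: atLeastLessThanSuc_atLeastAtMost)
      also have "\<dots> = 2 / pi * (\<integral>z. (\<Sum>k=1..n. F z * W k z * sin (real k * x)) \<partial>lborel)"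
      proof -
        have "(\<integral>z. (\<Sum>k=1..n. F z * W k z * sin (real k * x)) \<partial>lborel) = (\<Sum>k=1..n. (\<integral>z. F z * W k z * sin (real k * x) \<partial>lborel))"
          by (rule Bochner_Integration.integral_sum) (use Wi in \<open>auto intro!: integrable_mult_left\<close>)
        also have "\<dots> = (\<Sum>k=1..n. b k * sin (real k * x))"
          by (simp only: integral_mult_left_zero b_def)
        finally show ?thesis by (simp only: sum_distrib_left mult.assoc)
      qed
      finally have S: "(\<Sum>k<n. 2 / pi * integral {0..pi} (\<lambda>x. u (x, y) * sin (real (Suc k) * x)) * sin (real (Suc k) * x))
          = 2 / pi * (\<integral>z. (\<Sum>k=1..n. F z * W k z * sin (real k * x)) \<partial>lborel)" .
      have "K * sin x = (\<integral>z. F z * V z * sin x \<partial>lborel)" by (simp add: K_def)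
      also have "\<dots> \<le> (\<integral>z. (\<Sum>k=1..n. F z * W k z * sin (real k * x)) \<partial>lborel)"
      proof (rule integral_mono_AE)
        show "integrable lborel (\<lambda>z. F z * V z * sin x)" using Vi by simp
        show "integrable lborel (\<lambda>z. \<Sum>k=1..n. F z * W k z * sin (real k * x))"
          using Wi by (intro Bochner_Integration.integrable_sum integrable_mult_left) auto
        show "AE z in lborel. F z * V z * sin x \<le> (\<Sum>k=1..n. F z * W k z * sin (real k * x))"
          using F0
        proof eventually_elim
          case (elim z)
          show ?case
          proof (cases "z \<in> {0..pi} \<times> {-l..l}")
            case True
            then have z: "0 \<le> fst z" "fst z \<le> pi" "snd z \<in> {-l..l}" by auto
            have "(c (snd z) 1 - c (snd z) 2) * e (fst z) 1 \<le> (\<Sum>k=1..n. c (snd z) k * e (fst z) k)"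
            proof (rule abel_lower_bound[OF _ cnn[OF z(3)] _ n])
              show "c (snd z) (Suc k) \<le> c (snd z) k" if "k \<ge> 1" for k using cdec[OF that z(3)] by simp
              show "(\<Sum>k=1..n. e (fst z) k) \<ge> 0" for n
                unfolding e_def by (rule sine_kernel_nonneg) (use x z in auto)
            qed
            also have "(\<Sum>k=1..n. c (snd z) k * e (fst z) k) = (\<Sum>k=1..n. W k z * sin (real k * x))"
              by (rule sum.cong) (auto simp: c_def e_def W_def)
            also have "(c (snd z) 1 - c (snd z) 2) * e (fst z) 1 = V z * sin x"
              by (simp add: V_def e_def)
            finally have "F z * (V z * sin x) \<le> F z * (\<Sum>k=1..n. W k z * sin (real k * x))"
              using elim by (rule mult_left_mono)
            then show ?thesis by (simp add: sum_distrib_left mult.assoc)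
          qed (simp add: F.hz)
        qed
      qed
      finally have "2 / pi * (K * sin x) \<le> 2 / pi * (\<integral>z. (\<Sum>k=1..n. F z * W k z * sin (real k * x)) \<partial>lborel)"
        by (rule mult_left_mono) simp
      then show "(2 / pi * K) * sin x \<le> (\<Sum>k<n. 2 / pi * integral {0..pi} (\<lambda>x. u (x, y) * sin (real (Suc k) * x)) * sin (real (Suc k) * x))"
        unfolding S by (simp only: mult.assoc)
    qed
  qed
  show ?thesis
    by (rule that[OF G _ _ _ low]) (use G(2)[of 0] G(2)[of pi] uf(3,4)[OF y] K in auto)
qed

theorem corollary2p3:
  fixes l \<sigma> :: real and f u :: "real \<times> real \<Rightarrow> real"
  assumes "l > 0" and "0 \<le> \<sigma>" and "\<sigma> < 1"
    and "f \<in> L2 (plate l)"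
    and "weak_solution l \<sigma> f u"
    and "AE z in lebesgue_on (plate l). f z \<ge> 0"
    and "\<not> (AE z in lebesgue_on (plate l). f z = 0)"
  shows "(\<forall>x\<in>{0<..<pi}. \<forall>y\<in>{-l..l}. u (x, y) > 0) \<and>
         (\<forall>y\<in>{-l..l}. \<exists>d>0. ((\<lambda>x. u (x, y)) has_real_derivative d) (at 0 within {0..pi})) \<and>
         (\<forall>y\<in>{-l..l}. \<exists>d<0. ((\<lambda>x. u (x, y)) has_real_derivative d) (at pi within {0..pi}))"
proof -
  have *: "(\<forall>x\<in>{0<..<pi}. u (x, y) > 0) \<and>
      (\<exists>d>0. ((\<lambda>x. u (x, y)) has_real_derivative d) (at 0 within {0..pi})) \<and>
      (\<exists>d<0. ((\<lambda>x. u (x, y)) has_real_derivative d) (at pi within {0..pi}))" if y: "y \<in> {-l..l}" for y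
  proof -
    obtain G G' K where G: "\<And>x. (G has_real_derivative G' x) (at x)" "\<And>x. x \<in> {0..pi} \<Longrightarrow> u (x, y) = G x"
      "G 0 = 0" "G pi = 0" and K: "K > 0" and low: "\<And>x. 0 < x \<Longrightarrow> x < pi \<Longrightarrow> G x \<ge> K * sin x"
    proof (rule edge_profile[OF assms y])
      fix G G' :: "real \<Rightarrow> real" and K :: real
      assume "\<And>x. (G has_real_derivative G' x) (at x)" "\<And>x. x \<in> {0..pi} \<Longrightarrow> u (x, y) = G x"
        "G 0 = 0" "G pi = 0" "K > 0" "\<And>x. 0 < x \<Longrightarrow> x < pi \<Longrightarrow> G x \<ge> K * sin x"
      then show thesis by (rule that)
    qed
    \<comment> \<open>Outside the closed rectangle the values of u are arbitrary, hence the
      derivative within {0..pi}; it is inherited from the two-sided derivative of G.\<close>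
    have der: "((\<lambda>x. u (x, y)) has_real_derivative G' x) (at x within {0..pi})" if "x \<in> {0..pi}" for x
      by (rule has_field_derivative_transform_within[OF has_field_derivative_at_within[OF G(1)] zero_less_one that])
         (simp add: G(2))
    have "G' 0 > 0" using boundary_slope_left[OF G(1) G(3) low] K by simp
    moreover have "G' pi < 0" using boundary_slope_right[OF G(1) G(4) low] K by simp
    moreover have "u (x, y) > 0" if "x \<in> {0<..<pi}" for x
    proof -
      have "0 < K * sin x" using K sin_gt_zero[of x] that by simp
      also have "\<dots> \<le> G x" using low that by simp
      finally show ?thesis using G(2)[of x] that by simp
    qed
    moreover have "(0::real) \<in> {0..pi}" "pi \<in> {0..pi}" by simp_all
    ultimately show ?thesis using der by blast
  qed
  then show ?thesis by blast
qed

end
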